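(* Let $\Lambda$ be a row finite $k$-graph with no sources, let $\mathcal G$ be the associated path groupoid, let $\mathcal A=C^*(\Lambda)=C^*(\mathcal G)$ and $\mathcal D=C_0(\Lambda^\infty)\subseteq\mathcal A$. Then $\mathcal D$ is a masa (maximal abelian self-adjoint subalgebra) in $\mathcal A$ if, and only if, $\Lambda$ satisfies the aperiodicity condition.
   Context: **$k$-graphs.** A $k$-graph $(\Lambda,d)$ is a small category $\Lambda$ with a functor $d\colon\Lambda\to\mathbb N^k$ satisfying the factorization property: if $d(\lambda)=m+n$ with $m,n\in\mathbb N^k$, there exist unique $\mu,\nu\in\Lambda$ with $\lambda=\mu\nu$, $d(\mu)=m$, $d(\nu)=n$. Here $\mathbb N$ includes $0$, and $r,s$ denote range and source, so $\lambda$ is a morphism from $s(\lambda)$ to $r(\lambda)$, and $\lambda\mu$ is defined when $r(\mu)=s(\lambda)$. $\Lambda^n=d^{-1}(n)$, and $\Lambda^0$ is identified with the objects. For an object $v$ and $n\in\mathbb N^k$, $\Lambda^n(v)=\{\lambda\in\Lambda : d(\lambda)=n,\ r(\lambda)=v\}$. "Row finite with no sources" means every $\Lambda^n(v)$ is finite and non-empty. **Infinite paths.** $\Omega_k$ is the $k$-graph with objects $\mathbb N^k$, morphisms $\{(m,n)\in\mathbb N^k\times\mathbb N^k: m\le n\}$, $r(m,n)=m$, $s(m,n)=n$, $d(m,n)=n-m$. $\Lambda^\infty$ is the set of $k$-graph morphisms (degree-preserving functors) $x\colon\Omega_k\to\Lambda$; $x(0)$ denotes the object $x(0,0)$, and $\Lambda^\infty(v)=\{x\in\Lambda^\infty: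 x(0)=v\}$. For $p\in\mathbb N^k$, $\sigma^p(x)(m,n)=x(m+p,n+p)$. If $x(0)=s(\lambda)$, then $\lambda x$ is the unique $y\in\Lambda^\infty$ with $y(0,d(\lambda))=\lambda$ and $\sigma^{d(\lambda)}y=x$. $\Lambda^\infty$ has the topology generated by the (compact open) sets $Z(\lambda)=\{y\in\Lambda^\infty: y(0,d(\lambda))=\lambda\}$. **Aperiodicity.** $x\in\Lambda^\infty$ is periodic with non-zero period $p\in\mathbb Z^k$ if $x(m+p,n+p)=x(m,n)$ for every $(m,n)\in\Omega_k$ with $m+p\ge0$. $x$ is eventually periodic if $\sigma^n(x)$ is periodic (with some non-zero period) for some $n\in\mathbb N^k$; otherwise $x$ is aperiodic. $\Lambda$ satisfies the aperiodicity condition if for every $v\in\Lambda^0$ there is an aperiodic path $x\in\Lambda^\infty(v)$. **Path groupoid.** $\mathcal G=\{(x,n,y)\in\Lambda^\infty\times\mathbb Z^k\times\Lambda^\infty : \sigma^px=\sigma^qy \text{ and } n=p-q \text{ for some } p,q\in\mathbb N^k\}$, with $(x,n,y)(y,m,z)=(x,n+m,z)$ and $(x,n,y)^{-1}=(y,-n,x)$. A basis for its topology is given by the compact open sets $Z(\lambda,\mu)=\{(\lambda z,d(\lambda)-d(\mu),\mu z): z\in\Lambda^\infty(v)\}$ for $\lambda,\mu\in\Lambda$ with $s(\lambda)=s(\mu)=v$. $\mathcal G$ is a locally compact Hausdorff, $r$-discrete (étale), amenable groupoid. The unit space $\mathcal G^0=\{(x,0,x)\}$ is identified homeomorphically with $\Lambda^\infty$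 via $x\mapsto(x,0,x)$. **The $C^*$-algebra.** $C^*(\Lambda)$ is the universal $C^*$-algebra generated by partial isometries $\{s_\lambda:\lambda\in\Lambda\}$ such that: $\{s_v: v\in\Lambda^0\}$ are mutually orthogonal projections; $s_{\lambda\mu}=s_\lambda s_\mu$ whenever $r(\mu)=s(\lambda)$; $s_\lambda^*s_\lambda=s_{s(\lambda)}$; and $s_v=\sum_{\lambda\in\Lambda^n(v)}s_\lambda s_\lambda^*$ for all $v\in\Lambda^0$, $n\in\mathbb N^k$. It is isomorphic to $C^*(\mathcal G)=C^*_{\mathrm{red}}(\mathcal G)$ (with counting measures as Haar system), with $s_\lambda$ corresponding to the characteristic function of $Z(\lambda,s(\lambda))$. Elements of $\mathcal A=C^*(\mathcal G)$ are viewed as functions in $C_0(\mathcal G)$ through the standard injective norm-decreasing linear map $C^*_{\mathrm{red}}(\mathcal G)\to C_0(\mathcal G)$ extending the identity on $C_c(\mathcal G)$; the product is convolution. $\mathcal D=C_0(\Lambda^\infty)$ is the abelian subalgebra of elements of $\mathcal A$ supported on $\mathcal G^0$. *)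

theory Defs
  imports "HOL-Analysis.Analysis"
begin

section \<open>Higher-rank graphs\<close>

text \<open>
  A small category is given by its morphisms only: objects are identified with their identity
  morphisms, so range and source take values in the identities.  The rank \<open>k\<close> is
  \<open>CARD('k)\<close>, and \<open>nat ^ 'k\<close> carries the componentwise order and arithmetic.
\<close>

record ('m, 'k::finite) kgraph =
  Mor :: "'m set"
  rng :: "'m \<Rightarrow> 'm"
  src :: "'m \<Rightarrow> 'm"
  comp :: "'m \<Rightarrow> 'm \<Rightarrow> 'm"
  deg :: "'m \<Rightarrow> nat ^ 'k"

definition is_category :: "('m, 'k::finite) kgraph \<Rightarrow> bool" where
  "is_category \<Lambda> \<longleftrightarrow>
     (\<forall>a\<in>Mor \<Lambda>. rng \<Lambda> a \<in> Mor \<Lambda> \<and> src \<Lambda> a \<in> Mor \<Lambda> \<and>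
        rng \<Lambda> (rng \<Lambda> a) = rng \<Lambda> a \<and> src \<Lambda> (rng \<Lambda> a) = rng \<Lambda> a \<and>
        rng \<Lambda> (src \<Lambda> a) = src \<Lambda> a \<and> src \<Lambda> (src \<Lambda> a) = src \<Lambda> a \<and>
        comp \<Lambda> (rng \<Lambda> a) a = a \<and> comp \<Lambda> a (src \<Lambda> a) = a) \<and>
     (\<forall>a\<in>Mor \<Lambda>. \<forall>b\<in>Mor \<Lambda>. src \<Lambda> a = rng \<Lambda> b \<longrightarrow>
        comp \<Lambda> a b \<in> Mor \<Lambda> \<and>
        rng \<Lambda> (comp \<Lambda> a b) = rng \<Lambda> a \<and> src \<Lambda> (comp \<Lambda> a b) = src \<Lambda> b) \<and>
     (\<forall>a\<in>Mor \<Lambda>. \<forall>b\<in>Mor \<Lambda>. \<forall>c\<in>Mor \<Lambda>. src \<Lambda> a = rng \<Lambda> b \<longrightarrow> src \<Lambda> b = rng \<Lambda> c \<longrightarrow>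
        comp \<Lambda> (comp \<Lambda> a b) c = comp \<Lambda> a (comp \<Lambda> b c))"

definition is_kgraph :: "('m, 'k::finite) kgraph \<Rightarrow> bool" where
  "is_kgraph \<Lambda> \<longleftrightarrow>
     is_category \<Lambda> \<and>
     (\<forall>a\<in>Mor \<Lambda>. deg \<Lambda> (rng \<Lambda> a) = 0 \<and> deg \<Lambda> (src \<Lambda> a) = 0) \<and>
     (\<forall>a\<in>Mor \<Lambda>. \<forall>b\<in>Mor \<Lambda>. src \<Lambda> a = rng \<Lambda> b \<longrightarrow> deg \<Lambda> (comp \<Lambda> a b) = deg \<Lambda> a + deg \<Lambda> b) \<and>
     (\<forall>l\<in>Mor \<Lambda>. \<forall>m n. deg \<Lambda> l = m + n \<longrightarrow>
        (\<exists>!(a, b). a \<in> Mor \<Lambda> \<and> b \<in> Mor \<Lambda> \<and> src \<Lambda> a = rng \<Lambda> b \<and>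
           l = comp \<Lambda> a b \<and> deg \<Lambda> a = m \<and> deg \<Lambda> b = n))"

definition objects :: "('m, 'k::finite) kgraph \<Rightarrow> 'm set" where
  "objects \<Lambda> = {v \<in> Mor \<Lambda>. deg \<Lambda> v = 0}"

definition paths_of_degree :: "('m, 'k::finite) kgraph \<Rightarrow> nat ^ 'k \<Rightarrow> 'm \<Rightarrow> 'm set" where
  "paths_of_degree \<Lambda> n v = {l \<in> Mor \<Lambda>. deg \<Lambda> l = n \<and> rng \<Lambda> l = v}"

definition row_finite_no_sources :: "('m, 'k::finite) kgraph \<Rightarrow> bool" where
  "row_finite_no_sources \<Lambda> \<longleftrightarrow>
     (\<forall>v\<in>objects \<Lambda>. \<forall>n. finite (paths_of_degree \<Lambda> n v) \<and> paths_of_degree \<Lambda> n v \<noteq> {})"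

definition kgraph_morphism ::
    "('a, 'k::finite) kgraph \<Rightarrow> ('m, 'k) kgraph \<Rightarrow> ('a \<Rightarrow> 'm) \<Rightarrow> bool" where
  "kgraph_morphism \<Gamma> \<Lambda> F \<longleftrightarrow>
     (\<forall>a\<in>Mor \<Gamma>. F a \<in> Mor \<Lambda> \<and> F (rng \<Gamma> a) = rng \<Lambda> (F a) \<and> F (src \<Gamma> a) = src \<Lambda> (F a) \<and>
        deg \<Lambda> (F a) = deg \<Gamma> a) \<and>
     (\<forall>a\<in>Mor \<Gamma>. \<forall>b\<in>Mor \<Gamma>. src \<Gamma> a = rng \<Gamma> b \<longrightarrow> F (comp \<Gamma> a b) = comp \<Lambda> (F a) (F b))"


section \<open>Infinite paths and aperiodicity\<close>

definition Omega :: "((nat ^ 'k) \<times> (nat ^ 'k), 'k::finite) kgraph" where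
  "Omega = \<lparr> Mor = {(m, n). m \<le> n},
             rng = (\<lambda>(m, n). (m, m)),
             src = (\<lambda>(m, n). (n, n)),
             comp = (\<lambda>(m, n) (n', p). (m, p)),
             deg = (\<lambda>(m, n). n - m) \<rparr>"

type_synonym ('m, 'k) path = "(nat ^ 'k) \<times> (nat ^ 'k) \<Rightarrow> 'm"

text \<open>
  Paths are \<open>undefined\<close> outside the morphisms of \<open>Omega\<close>, so that equality of paths is equality
  of functions.
\<close>

definition inf_paths :: "('m, 'k::finite) kgraph \<Rightarrow> ('m, 'k) path set" where
  "inf_paths \<Lambda> = {x. kgraph_morphism Omega \<Lambda> x \<and> x \<in> extensional (Mor Omega)}"

definition inf_paths_at :: "('m, 'k::finite) kgraph \<Rightarrow> 'm \<Rightarrow> ('m, 'k) path set" where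
  "inf_paths_at \<Lambda> v = {x \<in> inf_paths \<Lambda>. x (0, 0) = v}"

definition shift :: "nat ^ 'k \<Rightarrow> ('m, 'k::finite) path \<Rightarrow> ('m, 'k) path" where
  "shift p x = restrict (\<lambda>(m, n). x (m + p, n + p)) (Mor Omega)"

definition prepend :: "('m, 'k::finite) kgraph \<Rightarrow> 'm \<Rightarrow> ('m, 'k) path \<Rightarrow> ('m, 'k) path" where
  "prepend \<Lambda> l x = (THE y. y \<in> inf_paths \<Lambda> \<and> y (0, deg \<Lambda> l) = l \<and> shift (deg \<Lambda> l) y = x)"

definition int_vec :: "nat ^ 'k \<Rightarrow> int ^ 'k::finite" where
  "int_vec m = (\<chi> i. int (m $ i))"

text \<open>
  The pair \<open>(m + p, n + p)\<close> of integer vectors, when non-negative, is represented by natural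
  vectors \<open>m'\<close>, \<open>n'\<close>.
\<close>

definition has_period :: "('m, 'k::finite) path \<Rightarrow> int ^ 'k \<Rightarrow> bool" where
  "has_period x p \<longleftrightarrow>
     (\<forall>m n m' n'. m \<le> n \<longrightarrow> int_vec m' = int_vec m + p \<longrightarrow> int_vec n' = int_vec n + p \<longrightarrow>
        x (m', n') = x (m, n))"

definition periodic :: "('m, 'k::finite) path \<Rightarrow> bool" where
  "periodic x \<longleftrightarrow> (\<exists>p. p \<noteq> 0 \<and> has_period x p)"

definition eventually_periodic :: "('m, 'k::finite) path \<Rightarrow> bool" where
  "eventually_periodic x \<longleftrightarrow> (\<exists>n. periodic (shift n x))"

definition aperiodicity_condition :: "('m, 'k::finite) kgraph \<Rightarrow> bool" where
  "aperiodicity_condition \<Lambda> \<longleftrightarrow>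
     (\<forall>v\<in>objects \<Lambda>. \<exists>x\<in>inf_paths_at \<Lambda> v. \<not> eventually_periodic x)"


section \<open>The path groupoid\<close>

type_synonym ('m, 'k) arrow = "('m, 'k) path \<times> (int ^ 'k) \<times> ('m, 'k) path"

definition path_groupoid :: "('m, 'k::finite) kgraph \<Rightarrow> ('m, 'k) arrow set" where
  "path_groupoid \<Lambda> =
     {(x, n, y). x \<in> inf_paths \<Lambda> \<and> y \<in> inf_paths \<Lambda> \<and>
        (\<exists>p q. shift p x = shift q y \<and> n = int_vec p - int_vec q)}"

fun grng :: "('m, 'k::finite) arrow \<Rightarrow> ('m, 'k) arrow" where
  "grng (x, n, y) = (x, 0, x)"

fun gsrc :: "('m, 'k::finite) arrow \<Rightarrow> ('m, 'k) arrow" where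
  "gsrc (x, n, y) = (y, 0, y)"

text \<open>The product is only meaningful when the inner paths \<open>y\<close> and \<open>y'\<close> agree.\<close>

fun gmult :: "('m, 'k::finite) arrow \<Rightarrow> ('m, 'k) arrow \<Rightarrow> ('m, 'k) arrow" where
  "gmult (x, n, y) (y', m, z) = (x, n + m, z)"

fun ginv :: "('m, 'k::finite) arrow \<Rightarrow> ('m, 'k) arrow" where
  "ginv (x, n, y) = (y, - n, x)"

definition unit_space :: "('m, 'k::finite) kgraph \<Rightarrow> ('m, 'k) arrow set" where
  "unit_space \<Lambda> = {(x, 0, x) |x. x \<in> inf_paths \<Lambda>}"

definition cylinder :: "('m, 'k::finite) kgraph \<Rightarrow> 'm \<Rightarrow> 'm \<Rightarrow> ('m, 'k) arrow set" where
  "cylinder \<Lambda> l m =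
     {(prepend \<Lambda> l z, int_vec (deg \<Lambda> l) - int_vec (deg \<Lambda> m), prepend \<Lambda> m z) |z.
        z \<in> inf_paths_at \<Lambda> (src \<Lambda> l)}"

definition groupoid_topology :: "('m, 'k::finite) kgraph \<Rightarrow> ('m, 'k) arrow topology" where
  "groupoid_topology \<Lambda> =
     topology_generated_by {cylinder \<Lambda> l m |l m. l \<in> Mor \<Lambda> \<and> m \<in> Mor \<Lambda> \<and> src \<Lambda> l = src \<Lambda> m}"

text \<open>Functions on the groupoid are extended by zero to all triples.\<close>

definition Cc_groupoid :: "('m, 'k::finite) kgraph \<Rightarrow> (('m, 'k) arrow \<Rightarrow> complex) set" where
  "Cc_groupoid \<Lambda> =
     {f. continuous_map (groupoid_topology \<Lambda>) euclidean f \<and>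
         (\<exists>K. compactin (groupoid_topology \<Lambda>) K \<and> (\<forall>g. g \<notin> K \<longrightarrow> f g = 0))}"


section \<open>Square-summable functions and their bounded operators\<close>

typedef 'a ell2 = "{f :: 'a \<Rightarrow> complex. (\<lambda>i. (cmod (f i))\<^sup>2) summable_on UNIV}"
  morphisms ell2_apply Abs_ell2
  by (rule exI[of _ "\<lambda>_. 0"]) simp

setup_lifting type_definition_ell2

lemma sq_summable_add:
  fixes f g :: "'a \<Rightarrow> complex"
  assumes "(\<lambda>i. (cmod (f i))\<^sup>2) summable_on UNIV" "(\<lambda>i. (cmod (g i))\<^sup>2) summable_on UNIV"
  shows "(\<lambda>i. (cmod (f i + g i))\<^sup>2) summable_on UNIV"
proof (rule summable_on_comparison_test)
  show "(\<lambda>i. 2 * (cmod (f i))\<^sup>2 + 2 * (cmod (g i))\<^sup>2) summable_on UNIV"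
    using assms by (intro summable_on_add summable_on_cmult_right)
  show "(cmod (f i + g i))\<^sup>2 \<le> 2 * (cmod (f i))\<^sup>2 + 2 * (cmod (g i))\<^sup>2" for i
  proof -
    have "(cmod (f i + g i))\<^sup>2 \<le> (cmod (f i) + cmod (g i))\<^sup>2"
      by (intro power_mono norm_triangle_ineq norm_ge_zero)
    also have "\<dots> \<le> 2 * (cmod (f i))\<^sup>2 + 2 * (cmod (g i))\<^sup>2"
      using sum_squares_bound[of "cmod (f i)" "cmod (g i)"] by (simp add: power2_sum)
    finally show ?thesis .
  qed
qed auto

lemma sq_summable_cmult:
  fixes f :: "'a \<Rightarrow> complex"
  assumes "(\<lambda>i. (cmod (f i))\<^sup>2) summable_on UNIV"
  shows "(\<lambda>i. (cmod (c * f i))\<^sup>2) summable_on UNIV"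
  using summable_on_cmult_right[OF assms, of "(cmod c)\<^sup>2"]
  by (simp add: norm_mult power_mult_distrib)

lemma sq_summable_inner:
  fixes f g :: "'a \<Rightarrow> complex"
  assumes "(\<lambda>i. (cmod (f i))\<^sup>2) summable_on UNIV" "(\<lambda>i. (cmod (g i))\<^sup>2) summable_on UNIV"
  shows "(\<lambda>i. f i \<bullet> g i) summable_on UNIV"
proof (rule abs_summable_summable, rule summable_on_comparison_test)
  show "(\<lambda>i. (cmod (f i))\<^sup>2 + (cmod (g i))\<^sup>2) summable_on UNIV"
    using assms by (rule summable_on_add)
  show "norm (f i \<bullet> g i) \<le> (cmod (f i))\<^sup>2 + (cmod (g i))\<^sup>2" for i
  proof -
    have "norm (f i \<bullet> g i) \<le> cmod (f i) * cmod (g i)"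
      by (simp add: Cauchy_Schwarz_ineq2)
    also have "\<dots> \<le> (cmod (f i))\<^sup>2 + (cmod (g i))\<^sup>2"
      using sum_squares_bound[of "cmod (f i)" "cmod (g i)"]
        mult_nonneg_nonneg[OF norm_ge_zero[of "f i"] norm_ge_zero[of "g i"]] by linarith
    finally show ?thesis .
  qed
qed auto

instantiation ell2 :: (type) real_vector
begin

lift_definition zero_ell2 :: "'a ell2" is "\<lambda>_. 0" by simp
lift_definition plus_ell2 :: "'a ell2 \<Rightarrow> 'a ell2 \<Rightarrow> 'a ell2" is "\<lambda>f g i. f i + g i"
  by (rule sq_summable_add)
lift_definition uminus_ell2 :: "'a ell2 \<Rightarrow> 'a ell2" is "\<lambda>f i. - f i" by simp
lift_definition minus_ell2 :: "'a ell2 \<Rightarrow> 'a ell2 \<Rightarrow> 'a ell2" is "\<lambda>f g i. f i - g i"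
proof -
  fix f g :: "'a \<Rightarrow> complex"
  assume "(\<lambda>i. (cmod (f i))\<^sup>2) summable_on UNIV" "(\<lambda>i. (cmod (g i))\<^sup>2) summable_on UNIV"
  then show "(\<lambda>i. (cmod (f i - g i))\<^sup>2) summable_on UNIV"
    using sq_summable_add[of f "\<lambda>i. - g i"] by simp
qed
lift_definition scaleR_ell2 :: "real \<Rightarrow> 'a ell2 \<Rightarrow> 'a ell2" is "\<lambda>c f i. c *\<^sub>R f i"
  unfolding scaleR_conv_of_real by (rule sq_summable_cmult)

instance
  by standard (transfer; simp add: algebra_simps fun_eq_iff)+

end

instantiation ell2 :: (type) real_inner
begin

lift_definition inner_ell2 :: "'a ell2 \<Rightarrow> 'a ell2 \<Rightarrow> real" is "\<lambda>f g. \<Sum>\<^sub>\<infinity>i. f i \<bullet> g i" .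
definition norm_ell2 :: "'a ell2 \<Rightarrow> real" where "norm_ell2 f = sqrt (f \<bullet> f)"
definition sgn_ell2 :: "'a ell2 \<Rightarrow> 'a ell2" where "sgn_ell2 f = f /\<^sub>R norm f"
definition dist_ell2 :: "'a ell2 \<Rightarrow> 'a ell2 \<Rightarrow> real" where "dist_ell2 f g = norm (f - g)"
definition uniformity_ell2 :: "('a ell2 \<times> 'a ell2) filter" where
  "uniformity_ell2 = (INF e\<in>{0<..}. principal {(x, y). dist x y < e})"
definition open_ell2 :: "'a ell2 set \<Rightarrow> bool" where
  "open_ell2 U \<longleftrightarrow> (\<forall>x\<in>U. \<forall>\<^sub>F (x', y) in uniformity. x' = x \<longrightarrow> y \<in> U)"

instance
proof
  fix x y z :: "'a ell2" and c :: real
  show "x \<bullet> y = y \<bullet> x"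
    by transfer (subst inner_commute, rule refl)
  show "(x + y) \<bullet> z = x \<bullet> z + y \<bullet> z"
    by transfer (unfold inner_add_left, intro infsum_add sq_summable_inner)
  show "(c *\<^sub>R x) \<bullet> y = c * (x \<bullet> y)"
    by transfer (unfold inner_scaleR_left, rule infsum_cmult_right')
  show "0 \<le> x \<bullet> x"
    by transfer (intro infsum_nonneg inner_ge_zero)
  show "x \<bullet> x = 0 \<longleftrightarrow> x = 0"
  proof transfer
    fix f :: "'a \<Rightarrow> complex"
    assume s: "(\<lambda>i. (cmod (f i))\<^sup>2) summable_on UNIV"
    have "f i = 0" if z: "(\<Sum>\<^sub>\<infinity>i. f i \<bullet> f i) = 0" for i
    proof -
      have "f i \<bullet> f i = 0"
        by (rule nonneg_infsum_le_0D[of "\<lambda>i. f i \<bullet> f i" UNIV])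
          (simp_all only: z order_refl sq_summable_inner[OF s s] inner_ge_zero UNIV_I)
      then show ?thesis
        by (simp only: inner_eq_zero_iff)
    qed
    moreover have "(\<Sum>\<^sub>\<infinity>i. f i \<bullet> f i) = 0" if "f = (\<lambda>_. 0)"
      unfolding that by simp
    ultimately show "((\<Sum>\<^sub>\<infinity>i. f i \<bullet> f i) = 0) = (f = (\<lambda>_. 0))"
      by (intro iffI ext)
  qed
qed (rule norm_ell2_def sgn_ell2_def dist_ell2_def uniformity_ell2_def open_ell2_def)+

end

text \<open>
  Library notions see \<open>'a ell2\<close> only as a real space, with real inner product the real part of
  \<open>cinner\<close>; the norm is the usual one.  The complex structure is the following.
\<close>

definition cinner :: "'a ell2 \<Rightarrow> 'a ell2 \<Rightarrow> complex" where
  "cinner \<xi> \<eta> = (\<Sum>\<^sub>\<infinity>i. ell2_apply \<xi> i * cnj (ell2_apply \<eta> i))"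

lift_definition scaleC :: "complex \<Rightarrow> 'a ell2 \<Rightarrow> 'a ell2" is "\<lambda>c f i. c * f i"
  by (rule sq_summable_cmult)

lemma norm_scaleC: "norm (scaleC c \<xi>) = cmod c * norm \<xi>"
proof -
  have "scaleC c \<xi> \<bullet> scaleC c \<xi> = (cmod c)\<^sup>2 * (\<xi> \<bullet> \<xi>)"
  proof transfer
    fix c :: complex and f :: "'a \<Rightarrow> complex"
    show "(\<Sum>\<^sub>\<infinity>i. (c * f i) \<bullet> (c * f i)) = (cmod c)\<^sup>2 * (\<Sum>\<^sub>\<infinity>i. f i \<bullet> f i)"
      unfolding dot_square_norm norm_mult power_mult_distrib by (rule infsum_cmult_right')
  qed
  then show ?thesis
    by (simp add: norm_ell2_def real_sqrt_mult)
qed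

lemma bounded_linear_scaleC: "bounded_linear (scaleC c)"
proof (rule bounded_linear_intro[where K = "cmod c"])
  show "scaleC c (\<xi> + \<eta>) = scaleC c \<xi> + scaleC c \<eta>" for \<xi> \<eta> :: "'a ell2"
    by transfer (simp add: algebra_simps)
  show "scaleC c (r *\<^sub>R \<xi>) = r *\<^sub>R scaleC c \<xi>" for r and \<xi> :: "'a ell2"
    by transfer simp
qed (simp add: norm_scaleC)

definition scaleC_op :: "complex \<Rightarrow> ('a ell2 \<Rightarrow>\<^sub>L 'a ell2) \<Rightarrow> ('a ell2 \<Rightarrow>\<^sub>L 'a ell2)" where
  "scaleC_op c T = Blinfun (\<lambda>\<xi>. scaleC c (T \<xi>))"

lemma scaleC_op_apply: "scaleC_op c T \<xi> = scaleC c (T \<xi>)"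
  unfolding scaleC_op_def
  by (simp add: bounded_linear_Blinfun_apply
      bounded_linear_compose[OF bounded_linear_scaleC blinfun.bounded_linear_right])

definition is_cadjoint :: "('a ell2 \<Rightarrow>\<^sub>L 'a ell2) \<Rightarrow> ('a ell2 \<Rightarrow>\<^sub>L 'a ell2) \<Rightarrow> bool" where
  "is_cadjoint T S \<longleftrightarrow> (\<forall>\<xi> \<eta>. cinner (T \<xi>) \<eta> = cinner \<xi> (S \<eta>))"

lift_definition delta :: "'a \<Rightarrow> 'a ell2" is "\<lambda>a i. if i = a then 1 else 0"
proof -
  fix a :: 'a
  have "(\<lambda>i. (cmod (if i = a then 1 else 0))\<^sup>2) summable_on UNIV \<longleftrightarrow>
        (\<lambda>i. (cmod (if i = a then 1 else 0))\<^sup>2) summable_on {a}"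
    by (rule summable_on_cong_neutral) auto
  then show "(\<lambda>i. (cmod (if i = a then 1 else 0))\<^sup>2) summable_on UNIV"
    by simp
qed


section \<open>Self-adjoint subalgebras and masas\<close>

definition star_subalgebra :: "('a ell2 \<Rightarrow>\<^sub>L 'a ell2) set \<Rightarrow> bool" where
  "star_subalgebra B \<longleftrightarrow>
     0 \<in> B \<and>
     (\<forall>S\<in>B. \<forall>T\<in>B. S + T \<in> B) \<and>
     (\<forall>c. \<forall>T\<in>B. scaleC_op c T \<in> B) \<and>
     (\<forall>S\<in>B. \<forall>T\<in>B. S o\<^sub>L T \<in> B) \<and>
     (\<forall>T\<in>B. \<exists>S\<in>B. is_cadjoint T S)"

definition abelian :: "('a ell2 \<Rightarrow>\<^sub>L 'a ell2) set \<Rightarrow> bool" where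
  "abelian B \<longleftrightarrow> (\<forall>S\<in>B. \<forall>T\<in>B. S o\<^sub>L T = T o\<^sub>L S)"

definition is_masa :: "('a ell2 \<Rightarrow>\<^sub>L 'a ell2) set \<Rightarrow> ('a ell2 \<Rightarrow>\<^sub>L 'a ell2) set \<Rightarrow> bool" where
  "is_masa A D \<longleftrightarrow>
     D \<subseteq> A \<and> star_subalgebra D \<and> abelian D \<and>
     (\<forall>B. D \<subseteq> B \<and> B \<subseteq> A \<and> star_subalgebra B \<and> abelian B \<longrightarrow> B = D)"


section \<open>The C*-algebra of a k-graph and its diagonal\<close>

text \<open>
  The left regular representation: a compactly supported continuous \<open>f\<close> acts by convolution on
  the square-summable functions on the groupoid, \<open>(f * \<xi>)(g) = \<Sum> f(h) \<xi>(h\<^sup>-\<^sup>1 g)\<close> over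
  \<open>r(h) = r(g)\<close>.  This space is the direct sum over all units \<open>u\<close> of the square-summable functions
  on \<open>s\<^sup>-\<^sup>1(u)\<close>, hence the operator norm is the reduced norm (with counting measures as Haar system).
  The representation vanishes on the complement of the groupoid in the type of all triples.
\<close>

definition acts_by_convolution ::
    "('m, 'k::finite) kgraph \<Rightarrow> (('m, 'k) arrow \<Rightarrow> complex) \<Rightarrow>
     (('m, 'k) arrow ell2 \<Rightarrow>\<^sub>L ('m, 'k) arrow ell2) \<Rightarrow> bool" where
  "acts_by_convolution \<Lambda> f T \<longleftrightarrow>
     (\<forall>\<xi> g. ell2_apply (T \<xi>) g =
        (if g \<in> path_groupoid \<Lambda>
         then \<Sum>\<^sub>\<infinity>h\<in>{h \<in> path_groupoid \<Lambda>. grng h = grng g}. f h * ell2_apply \<xi> (gmult (ginv h) g)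
         else 0))"

text \<open>
  The algebra \<open>C*(\<Lambda>) = C*(G) = C*_red(G)\<close>: the path groupoid is amenable, so its C*-algebra is the
  reduced one, i.e. the norm closure of the image of the left regular representation.
\<close>

definition kgraph_cstar ::
    "('m, 'k::finite) kgraph \<Rightarrow> (('m, 'k) arrow ell2 \<Rightarrow>\<^sub>L ('m, 'k) arrow ell2) set" where
  "kgraph_cstar \<Lambda> = closure {T. \<exists>f\<in>Cc_groupoid \<Lambda>. acts_by_convolution \<Lambda> f T}"

text \<open>
  The standard map from the reduced algebra to functions on the groupoid: if \<open>T\<close> is convolution by
  \<open>f\<close> then \<open>(T \<delta>\<^sub>u)(g) = f(g)\<close> for \<open>u = s(g)\<close>.
\<close>

definition as_function ::
    "(('m, 'k::finite) arrow ell2 \<Rightarrow>\<^sub>L ('m, 'k) arrow ell2) \<Rightarrow> ('m, 'k) arrow \<Rightarrow> complex" where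
  "as_function T g = ell2_apply (T (delta (gsrc g))) g"

definition diagonal ::
    "('m, 'k::finite) kgraph \<Rightarrow> (('m, 'k) arrow ell2 \<Rightarrow>\<^sub>L ('m, 'k) arrow ell2) set" where
  "diagonal \<Lambda> =
     {T \<in> kgraph_cstar \<Lambda>. \<forall>g \<in> path_groupoid \<Lambda> - unit_space \<Lambda>. as_function T g = 0}"

end

theory Submission
  imports Defs
begin

text \<open>
  An element of the algebra that commutes with the diagonal is a function on the groupoid supported
  on the isotropy.  It is continuous, so if it is non-zero at some \<open>(x, n, x)\<close> with \<open>n \<noteq> 0\<close>, then a
  whole basic open set lies in the isotropy, i.e. \<open>\<lambda>z = \<mu>z\<close> for all infinite paths \<open>z\<close> from some
  object, and all of these are eventually periodic.  Conversely, if all infinite paths at some object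
  are eventually periodic, a Baire category argument yields an object \<open>w\<close> and \<open>a \<noteq> b\<close> with
  \<open>\<sigma>\<^sup>a z = \<sigma>\<^sup>b z\<close> for all \<open>z\<close> starting at \<open>w\<close>; then translation by \<open>\<plusminus>(a - b)\<close> over the paths starting
  at \<open>w\<close> is a self-adjoint element outside the diagonal that commutes with it, and the diagonal
  and this element generate a strictly larger abelian subalgebra.
\<close>

text \<open>Membership in the closure \<open>A\<close> is awkward to establish, and this shapes the
  proof. Elements of \<open>A\<close> are handled through matrix coefficients, whose identities are
  closed conditions and can be checked on convolutions. In this way the diagonal becomes a set of
  multiplications by functions of the range, which makes its products and adjoints explicit. In the
  converse direction \<open>V\<close> is convolution by the indicator of the arrows (x, c, x) and
  (x, -c, x) with x starting at w and c = a - b; the two translations are adjoint to each other,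
  hence the sum over both signs. For \<open>V\<close> the membership shown is V T in
  \<open>A\<close> for T in \<open>A\<close>. The enlarged algebra is therefore built from left
  multiplications by \<open>V\<close> alone, which dictates the Horner form. Since the diagonal has
  no identity when there are infinitely many objects, \<open>V\<close> itself is obtained as
  \<open>V\<close> times the indicator of the units that start at w. Maximality ranges over all
  star-subalgebras, so polynomials suffice and no limits of them are taken.\<close>

lemma vec_le_add: "m \<le> m + (n::nat^'k::finite)" "m \<le> n + m"
  by (simp_all add: less_eq_vec_def)

lemma vec_add_diff: "m \<le> (n::nat^'k::finite) \<Longrightarrow> m + (n - m) = n"
  by (simp add: less_eq_vec_def vec_eq_iff)

lemma vec_le_ex: "m \<le> (n::nat^'k::finite) \<Longrightarrow> \<exists>c. n = m + c"
  using vec_add_diff by metis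

lemma vec_zero_le: "0 \<le> (n::nat^'k::finite)"
  by (simp add: less_eq_vec_def)

lemma vec_add_mono: "m \<le> n \<Longrightarrow> m + p \<le> n + (p::nat^'k::finite)"
  by (simp add: less_eq_vec_def)

lemma vec_diff_simps:
  fixes m n p :: "nat^'k::finite"
  shows "n - 0 = n" "n - n = 0" "(m + p) - (n + p) = m - n" "(n + m) - n = m" "(n + m) - m = n"
    "(m - n) $ i = m $ i - n $ i"
  by (simp_all add: vec_eq_iff)

lemma int_vec_add: "int_vec (m + n) = int_vec m + int_vec n"
  by (simp add: int_vec_def vec_eq_iff)

lemma int_vec_zero: "int_vec 0 = 0"
  by (simp add: int_vec_def vec_eq_iff)

lemma int_vec_inj: "int_vec m = int_vec n \<longleftrightarrow> m = n"
  by (simp add: int_vec_def vec_eq_iff)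

text \<open>The constant vectors form a cofinal sequence of degrees, so infinite paths, which are
  indexed by a directed set of vectors, can be built by recursion on naturals in steps of
  \<open>diag_vec 1\<close>.\<close>

definition diag_vec :: "nat \<Rightarrow> nat^'k::finite" where
  "diag_vec i = (\<chi> j. i)"

lemma diag_vec_cofinal: "\<exists>i. (n::nat^'k::finite) \<le> diag_vec i"
proof
  show "n \<le> diag_vec (\<Sum>j\<in>UNIV. n $ j)"
    by (auto simp: less_eq_vec_def diag_vec_def intro: member_le_sum)
qed

lemma diag_vec_Suc: "diag_vec (Suc i) = diag_vec i + diag_vec 1"
  by (simp add: diag_vec_def vec_eq_iff)

lemma diag_vec_0: "diag_vec 0 = 0"
  by (simp add: diag_vec_def vec_eq_iff)

lemma diag_vec_mono: "i \<le> j \<Longrightarrow> diag_vec i \<le> diag_vec j"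
  by (simp add: diag_vec_def less_eq_vec_def)

section \<open>Composition and unique factorization\<close>

locale row_finite_kgraph =
  fixes \<Lambda> :: "('m, 'k::finite) kgraph"
  assumes kgraph: "is_kgraph \<Lambda>" and row_finite: "row_finite_no_sources \<Lambda>"
begin

abbreviation "M \<equiv> Mor \<Lambda>"
abbreviation "r \<equiv> rng \<Lambda>"
abbreviation "s \<equiv> src \<Lambda>"
abbreviation "d \<equiv> deg \<Lambda>"
abbreviation cmp (infixl "\<cdot>" 70) where "cmp \<equiv> comp \<Lambda>"
abbreviation "P \<equiv> inf_paths \<Lambda>"

lemma cat:
  assumes "a \<in> M"
  shows "r a \<in> M" "s a \<in> M" "r (r a) = r a" "s (r a) = r a" "r (s a) = s a" "s (s a) = s a"
    "r a \<cdot> a = a" "a \<cdot> s a = a" "d (r a) = 0" "d (s a) = 0"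
  using kgraph assms unfolding is_kgraph_def is_category_def by auto

lemma comp_facts:
  assumes "a \<in> M" "b \<in> M" "s a = r b"
  shows "a \<cdot> b \<in> M" "r (a \<cdot> b) = r a" "s (a \<cdot> b) = s b" "d (a \<cdot> b) = d a + d b"
  using kgraph assms unfolding is_kgraph_def is_category_def by auto

lemma comp_assoc:
  assumes "a \<in> M" "b \<in> M" "c \<in> M" "s a = r b" "s b = r c"
  shows "a \<cdot> b \<cdot> c = a \<cdot> (b \<cdot> c)"
  using kgraph assms unfolding is_kgraph_def is_category_def by auto

lemma factor_ex1:
  assumes "l \<in> M" "d l = m + n"
  shows "\<exists>!(a, b). a \<in> M \<and> b \<in> M \<and> s a = r b \<and> l = a \<cdot> b \<and> d a = m \<and> d b = n"
  using kgraph assms unfolding is_kgraph_def by blast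

lemma factor_ex:
  assumes "l \<in> M" "d l = m + n"
  obtains a b where "a \<in> M" "b \<in> M" "s a = r b" "l = a \<cdot> b" "d a = m" "d b = n"
  using factor_ex1[OF assms] by auto

text \<open>Cancellation form of the factorization property: additivity of the degree forces the
  second factors to have equal degree as well, so comparing the first degrees is enough.\<close>

lemma factor_unique:
  assumes "a \<in> M" "b \<in> M" "s a = r b" "a' \<in> M" "b' \<in> M" "s a' = r b'"
    and eq: "a \<cdot> b = a' \<cdot> b'" and "d a = d a'"
  shows "a = a'" "b = b'"
proof -
  have "d a + d b = d a' + d b'"
    using comp_facts(4)[of a b] comp_facts(4)[of a' b'] assms by simp
  then have db: "d b = d b'"
    using \<open>d a = d a'\<close> by simp
  have "\<exists>!(u, v). u \<in> M \<and> v \<in> M \<and> s u = r v \<and> a \<cdot> b = u \<cdot> v \<and> d u = d a \<and> d v = d b"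
    using assms by (intro factor_ex1 comp_facts)
  then have "(a, b) = (a', b')"
    using assms db by (elim ex1E) (metis (mono_tags, lifting) case_prodI)
  then show "a = a'" "b = b'" by auto
qed

text \<open>Composing \<open>v\<close> with \<open>r v\<close> on the left or with
  \<open>s v\<close> on the right gives two factorizations of \<open>v\<close> whose first factors
  have degree zero, so uniqueness makes the factors agree.\<close>

lemma degree_zero:
  assumes "v \<in> M" "d v = 0"
  shows "r v = v" "s v = v"
proof -
  have "r v \<cdot> v = v \<cdot> s v" using cat[OF assms(1)] by simp
  then show "r v = v" "s v = v"
    using factor_unique[of "r v" v v "s v"] cat[OF assms(1)] assms by auto
qed

lemma object_iff: "v \<in> objects \<Lambda> \<longleftrightarrow> v \<in> M \<and> d v = 0"
  by (simp add: objects_def)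

lemma extend_by_degree:
  assumes "l \<in> M"
  obtains e where "e \<in> M" "s l = r e" "d e = n"
proof -
  have "s l \<in> objects \<Lambda>" using cat[OF assms] by (simp add: object_iff)
  then have "paths_of_degree \<Lambda> n (s l) \<noteq> {}"
    using row_finite unfolding row_finite_no_sources_def by blast
  then show thesis using that unfolding paths_of_degree_def by auto
qed

subsection \<open>Infinite paths\<close>

lemma Mor_Omega: "(m, n) \<in> Mor Omega \<longleftrightarrow> m \<le> n"
  by (simp add: Omega_def)

lemma path_iff:
  "x \<in> P \<longleftrightarrow>
    (\<forall>m n. m \<le> n \<longrightarrow> x (m, n) \<in> M \<and> r (x (m, n)) = x (m, m) \<and> s (x (m, n)) = x (n, n) \<and> d (x (m, n)) = n - m) \<and>
    (\<forall>m n p. m \<le> n \<longrightarrow> n \<le> p \<longrightarrow> x (m, p) = x (m, n) \<cdot> x (n, p)) \<and>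
    (\<forall>m n. \<not> m \<le> n \<longrightarrow> x (m, n) = undefined)"
proof -
  have ball: "(\<forall>a\<in>Mor Omega. Q a) \<longleftrightarrow> (\<forall>m n. m \<le> n \<longrightarrow> Q (m, n))" for Q :: "(nat^'k) \<times> (nat^'k) \<Rightarrow> bool"
    by (auto simp: Omega_def)
  have ops: "rng Omega (m, n) = (m, m)" "src Omega (m, n) = (n, n)" "comp Omega (m, n) (n', p) = (m, p)"
    "deg Omega (m, n) = n - m" for m n n' p :: "nat^'k"
    by (simp_all add: Omega_def)
  have comp: "(\<forall>m n. m \<le> n \<longrightarrow> (\<forall>n' p. n' \<le> p \<longrightarrow> (n, n) = (n', n') \<longrightarrow> x (m, p) = x (m, n) \<cdot> x (n', p)))
    \<longleftrightarrow> (\<forall>m n p. m \<le> n \<longrightarrow> n \<le> p \<longrightarrow> x (m, p) = x (m, n) \<cdot> x (n, p))"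
    by blast
  have ext: "(\<forall>a. a \<notin> Mor Omega \<longrightarrow> x a = undefined) \<longleftrightarrow> (\<forall>m n. \<not> m \<le> n \<longrightarrow> x (m, n) = undefined)"
    by (simp add: split_paired_all Mor_Omega)
  show ?thesis
    unfolding inf_paths_def kgraph_morphism_def extensional_def mem_Collect_eq ball ops comp ext
    by (simp only: conj_assoc eq_commute[of "x (_, _)" "r _"] eq_commute[of "x (_, _)" "s _"])
qed

lemma path_facts:
  assumes "x \<in> P" "m \<le> n"
  shows "x (m, n) \<in> M" "r (x (m, n)) = x (m, m)" "s (x (m, n)) = x (n, n)" "d (x (m, n)) = n - m"
  using assms unfolding path_iff by blast+

lemma path_comp:
  assumes "x \<in> P" "m \<le> n" "n \<le> p"
  shows "x (m, p) = x (m, n) \<cdot> x (n, p)"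
  using assms unfolding path_iff by blast

lemma path_undefined:
  assumes "x \<in> P" "\<not> m \<le> n"
  shows "x (m, n) = undefined"
  using path_iff[of x, THEN iffD1, OF assms(1), THEN conjunct2, THEN conjunct2] assms(2) by blast

lemma path_segment_unique:
  assumes "x \<in> P" "m \<le> n" "n \<le> p" "y \<in> P" "m' \<le> n'" "n' \<le> p'"
    and "x (m, p) = y (m', p')" "n - m = n' - m'"
  shows "x (m, n) = y (m', n')" "x (n, p) = y (n', p')"
proof -
  have "x (m, n) \<cdot> x (n, p) = y (m', n') \<cdot> y (n', p')"
    using path_comp[of x m n p] path_comp[of y m' n' p'] assms by simp
  note * = factor_unique[OF _ _ _ _ _ _ this]
  show "x (m, n) = y (m', n')" "x (n, p) = y (n', p')"
    by (rule *; simp add: path_facts assms)+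
qed

lemma path_prefix_eq:
  assumes "x \<in> P" "y \<in> P" "x (0, p) = y (0, p)" "m \<le> n" "n \<le> p"
  shows "x (m, n) = y (m, n)"
proof -
  have "x (0, n) = y (0, n)"
    using path_segment_unique(1)[of x 0 n p y 0 n p] assms by (auto simp: vec_zero_le)
  then show ?thesis
    using path_segment_unique(2)[of x 0 m n y 0 m n] assms by (auto simp: vec_zero_le)
qed

lemma path_ext:
  assumes "x \<in> P" "y \<in> P" "\<And>n. x (0, n) = y (0, n)"
  shows "x = y"
proof
  fix mn :: "(nat^'k) \<times> (nat^'k)"
  obtain m n where mn: "mn = (m, n)" by fastforce
  show "x mn = y mn"
  proof (cases "m \<le> n")
    case True
    then show ?thesis using path_prefix_eq[of x y n m n] assms mn by auto
  next
    case False
    then have "x (m, n) = undefined" "y (m, n) = undefined"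
      using path_undefined assms(1,2) by blast+
    then show ?thesis using mn by simp
  qed
qed

lemma path_ext_cofinal:
  assumes "x \<in> P" "y \<in> P" "\<And>n. \<exists>p\<ge>n. x (0, p) = y (0, p)"
  shows "x = y"
proof (rule path_ext[OF assms(1,2)])
  fix n
  obtain p where "p \<ge> n" "x (0, p) = y (0, p)" using assms(3) by blast
  then show "x (0, n) = y (0, n)"
    using path_prefix_eq assms(1,2) vec_zero_le by blast
qed

text \<open>By left cancellation the segment from m to n is the only e with c n = c m e; the
  composition law holds because both of its sides solve the same such equation.\<close>

lemma path_of_prefixes:
  assumes c: "\<And>n. c n \<in> M" "\<And>n. d (c n) = n"
    and ex: "\<And>m n. m \<le> n \<Longrightarrow> \<exists>e\<in>M. s (c m) = r e \<and> c n = c m \<cdot> e"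
  obtains x where "x \<in> P" "\<And>n. x (0, n) = c n"
proof -
  define t where "t m n = (SOME e. e \<in> M \<and> s (c m) = r e \<and> c n = c m \<cdot> e)" for m n
  have t: "t m n \<in> M" "s (c m) = r (t m n)" "c n = c m \<cdot> t m n" if "m \<le> n" for m n
    using someI_ex[of "\<lambda>e. e \<in> M \<and> s (c m) = r e \<and> c n = c m \<cdot> e"] ex[OF that]
    unfolding t_def by blast+
  have t_unique: "t m n = e" if "m \<le> n" "e \<in> M" "s (c m) = r e" "c n = c m \<cdot> e" for m n e
    using factor_unique(2)[of "c m" "t m n" "c m" e] t[OF that(1)] that c by auto
  have t_src: "s (t m n) = s (c n)" if "m \<le> n" for m n
    using comp_facts(3)[of "c m" "t m n"] t[OF that] c by simp
  have t_self: "t n n = s (c n)" for n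
    by (rule t_unique) (use c cat in auto)
  have t_deg: "d (t m n) = n - m" if "m \<le> n" for m n
  proof -
    have "n = m + d (t m n)"
      using comp_facts(4)[of "c m" "t m n"] t[OF that] c by metis
    then show ?thesis by (metis vec_diff_simps(4))
  qed
  have t_comp: "t m p = t m n \<cdot> t n p" if "m \<le> n" "n \<le> p" for m n p
  proof (rule t_unique)
    show "m \<le> p" using that by order
    have sr: "s (t m n) = r (t n p)" using t_src[OF that(1)] t(2)[OF that(2)] by simp
    show "t m n \<cdot> t n p \<in> M" "s (c m) = r (t m n \<cdot> t n p)"
      using comp_facts[of "t m n" "t n p"] t that sr by auto
    show "c p = c m \<cdot> (t m n \<cdot> t n p)"
      using comp_assoc[of "c m" "t m n" "t n p"] t[OF that(1)] t[OF that(2)] sr c by simp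
  qed
  define x where "x = (\<lambda>(m, n). if m \<le> n then t m n else undefined)"
  have "x \<in> P"
    unfolding path_iff
  proof (intro conjI allI impI)
    fix m n p :: "nat^'k"
    show "m \<le> n \<Longrightarrow> n \<le> p \<Longrightarrow> x (m, p) = x (m, n) \<cdot> x (n, p)"
      using t_comp[of m n p] order_trans[of m n p] by (simp add: x_def)
  qed (simp_all add: x_def t t_self t_src t_deg)
  moreover have "x (0, n) = c n" for n
  proof -
    have "c 0 = r (t 0 n)" "c n = c 0 \<cdot> t 0 n"
      using t[of 0 n] degree_zero[of "c 0"] c by (auto simp: vec_zero_le)
    then show ?thesis
      using cat(7) t(1)[of 0 n] by (simp add: x_def vec_zero_le)
  qed
  ultimately show thesis using that by blast
qed

text \<open>The constructor behind all infinite paths built below. Cofinality provides a left factor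
  of each degree in some \<open>l i\<close>, and two candidates are compared inside a common later
  \<open>l j\<close>, where factorization is unique.\<close>

lemma path_of_chain:
  fixes l :: "nat \<Rightarrow> 'm"
  assumes l: "\<And>i. l i \<in> M"
    and ext: "\<And>i. \<exists>e\<in>M. s (l i) = r e \<and> l (Suc i) = l i \<cdot> e"
    and cofinal: "\<And>n. \<exists>i. n \<le> d (l i)"
  obtains x where "x \<in> P" "\<And>i. x (0, d (l i)) = l i"
proof -
  have ext': "\<exists>e\<in>M. s (l i) = r e \<and> l j = l i \<cdot> e" if "i \<le> j" for i j
    using that
  proof (induction j rule: dec_induct)
    case base
    show ?case using cat[OF l] by (intro bexI[of _ "s (l i)"]) auto
  next
    case (step j)
    then obtain e where e: "e \<in> M" "s (l i) = r e" "l j = l i \<cdot> e" by blast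
    obtain f where f: "f \<in> M" "s (l j) = r f" "l (Suc j) = l j \<cdot> f" using ext by blast
    have "s e = r f" using comp_facts(3)[OF l e(1,2)] e f by simp
    then show ?case
      using comp_facts[of e f] comp_assoc[of "l i" e f] e f l
      by (intro bexI[of _ "e \<cdot> f"]) auto
  qed
  define initial where "initial n a \<longleftrightarrow> a \<in> M \<and> d a = n \<and> (\<exists>i. \<exists>b\<in>M. s a = r b \<and> l i = a \<cdot> b)" for n a
  have initial_ex: "\<exists>a. initial n a" for n
  proof -
    obtain i where "n \<le> d (l i)" using cofinal by blast
    then obtain c where "d (l i) = n + c" using vec_le_ex by blast
    then obtain a b where "a \<in> M" "b \<in> M" "s a = r b" "l i = a \<cdot> b" "d a = n"
      using factor_ex[OF l] by blast
    then show ?thesis unfolding initial_def by blast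
  qed
  have initial_common: "\<exists>j. \<exists>b\<in>M. \<exists>b'\<in>M. s a = r b \<and> s a' = r b' \<and> l j = a \<cdot> b \<and> l j = a' \<cdot> b'"
    if ia: "initial n a" and ia': "initial n' a'" for n n' a a'
  proof -
    obtain i b where b: "b \<in> M" "s a = r b" "l i = a \<cdot> b"
      using ia unfolding initial_def by blast
    obtain i' b' where b': "b' \<in> M" "s a' = r b'" "l i' = a' \<cdot> b'"
      using ia' unfolding initial_def by blast
    obtain e where e: "e \<in> M" "s (l i) = r e" "l (max i i') = l i \<cdot> e" using ext'[of i "max i i'"] by auto
    obtain e' where e': "e' \<in> M" "s (l i') = r e'" "l (max i i') = l i' \<cdot> e'" using ext'[of i' "max i i'"] by auto
    have "a \<in> M" "a' \<in> M" using ia ia' unfolding initial_def by auto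
    then have "s b = r e" "s b' = r e'"
      using comp_facts(3)[of a b] comp_facts(3)[of a' b'] b b' e e' by simp_all
    then have "l (max i i') = a \<cdot> (b \<cdot> e)" "l (max i i') = a' \<cdot> (b' \<cdot> e')" "b \<cdot> e \<in> M" "b' \<cdot> e' \<in> M"
        "s a = r (b \<cdot> e)" "s a' = r (b' \<cdot> e')"
      using comp_assoc[of a b e] comp_assoc[of a' b' e'] comp_facts[of b e] comp_facts[of b' e']
        \<open>a \<in> M\<close> \<open>a' \<in> M\<close> b b' e(1) e'(1) e(3) e'(3) by simp_all
    then show ?thesis by blast
  qed
  define c where "c n = (SOME a. initial n a)" for n
  have c: "initial n (c n)" for n
    unfolding c_def using initial_ex by (rule someI_ex)
  have c_unique: "c n = a" if ia: "initial n a" for n a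
  proof -
    obtain j b b' where "b \<in> M" "b' \<in> M" "s (c n) = r b" "s a = r b'" "l j = c n \<cdot> b" "l j = a \<cdot> b'"
      using initial_common[OF c ia] by blast
    then show ?thesis
      using factor_unique(1)[of "c n" b a b'] c[of n] ia unfolding initial_def by auto
  qed
  have c_ext: "\<exists>e\<in>M. s (c m) = r e \<and> c n = c m \<cdot> e" if "m \<le> n" for m n
  proof -
    obtain q where q: "n = m + q" using \<open>m \<le> n\<close> vec_le_ex by blast
    have cn: "c n \<in> M" "d (c n) = m + q" using c[of n] q unfolding initial_def by auto
    obtain a b where ab: "a \<in> M" "b \<in> M" "s a = r b" "c n = a \<cdot> b" "d a = m" "d b = q"
      using factor_ex[OF cn] .
    obtain i f where f: "f \<in> M" "s (c n) = r f" "l i = c n \<cdot> f"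
      using c[of n] unfolding initial_def by blast
    have "s b = r f" using comp_facts(3)[OF ab(1-3)] ab f by simp
    then have "l i = a \<cdot> (b \<cdot> f)" "b \<cdot> f \<in> M" "r (b \<cdot> f) = r b"
      using comp_assoc[of a b f] comp_facts[of b f] ab f by auto
    moreover from this have "s a = r (b \<cdot> f)" using ab by simp
    \<comment> \<open>Cutting \<open>c n\<close> at degree m yields a left factor of the chain
      again, so uniqueness identifies it with \<open>c m\<close>.\<close>
    ultimately have "initial m a" using ab(1,5) unfolding initial_def by blast
    then have "c m = a" by (rule c_unique)
    then show ?thesis using ab by auto
  qed
  obtain x where x: "x \<in> P" "\<And>n. x (0, n) = c n"
    using path_of_prefixes[of c] c c_ext unfolding initial_def by blast
  have "c (d (l i)) = l i" for i
  proof (rule c_unique)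
    show "initial (d (l i)) (l i)"
      unfolding initial_def using cat[OF l[of i]] l[of i]
      by (intro conjI exI[of _ i] bexI[of _ "s (l i)"]) simp_all
  qed
  then show thesis using that x by metis
qed

subsection \<open>Shifts\<close>

lemma shift_apply: "m \<le> n \<Longrightarrow> shift p x (m, n) = x (m + p, n + p)"
  by (simp add: shift_def Mor_Omega)

lemma shift_path:
  assumes "x \<in> P" shows "shift p x \<in> P"
  unfolding path_iff
proof (intro conjI allI impI)
  fix m n q :: "nat^'k"
  show "m \<le> n \<Longrightarrow> n \<le> q \<Longrightarrow> shift p x (m, q) = shift p x (m, n) \<cdot> shift p x (n, q)"
    using path_comp[OF assms] order_trans[of m n q] by (simp add: shift_apply vec_add_mono)
  show "\<not> m \<le> n \<Longrightarrow> shift p x (m, n) = undefined"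
    by (simp add: shift_def Mor_Omega)
qed (simp_all add: path_facts[OF assms] shift_apply vec_add_mono vec_diff_simps)

lemma shift_shift: "shift p (shift q x) = shift (p + q) x"
  by (auto simp: shift_def restrict_def Mor_Omega vec_add_mono add.assoc fun_eq_iff)

lemma shift_zero: "x \<in> P \<Longrightarrow> shift 0 x = x"
  by (rule path_ext) (simp_all add: shift_path shift_apply vec_zero_le)

lemma shift_prefix: "shift p x (0, n) = x (p, p + n)"
  by (simp add: shift_apply vec_zero_le add.commute)

lemma path_join:
  assumes "x \<in> P" "y \<in> P" "x (0, p) = y (0, p)" "shift p x = shift p y"
  shows "x = y"
proof (rule path_ext_cofinal[OF assms(1,2)])
  fix n
  have "x (p, p + n) = y (p, p + n)"
    using assms(4) by (metis shift_prefix)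
  then have "x (0, p + n) = y (0, p + n)"
    using path_comp[of x 0 p "p + n"] path_comp[of y 0 p "p + n"] assms
    by (simp add: vec_zero_le vec_le_add)
  then show "\<exists>q\<ge>n. x (0, q) = y (0, q)"
    using vec_le_add by blast
qed

text \<open>Brings an equality of tails back from p + c and q + c to p and q at the price of one
  finite segment. This is what lets prefixes of an arrow be lengthened freely.\<close>

lemma shift_join:
  assumes "x \<in> P" "y \<in> P" "x (p, p + c) = y (q, q + c)" "shift (p + c) x = shift (q + c) y"
  shows "shift p x = shift q y"
proof (rule path_join)
  show "shift p x (0, c) = shift q y (0, c)" using assms by (simp add: shift_prefix)
  show "shift c (shift p x) = shift c (shift q y)"
    using assms by (simp add: shift_shift add.commute)
qed (use assms shift_path in auto)

text \<open>Composing \<open>l\<close> with the prefixes of \<open>z\<close> gives a chain of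
  cofinal degrees; unique factorization at degree \<open>d l\<close> recovers \<open>l\<close> and
  the prefixes of \<open>z\<close> from the limit path.\<close>

lemma prepend_ex:
  assumes l: "l \<in> M" and z: "z \<in> P" "z (0, 0) = s l"
  obtains y where "y \<in> P" "y (0, d l) = l" "shift (d l) y = z"
proof -
  define z' where "z' i = z (0, diag_vec i)" for i
  define f where "f i = l \<cdot> z' i" for i
  have z': "z' i \<in> M" "s l = r (z' i)" "d (z' i) = diag_vec i" "s (z' i) = z (diag_vec i, diag_vec i)" for i
    using path_facts[OF z(1) vec_zero_le] z(2) by (auto simp: z'_def vec_diff_simps)
  have f: "f i \<in> M" "d (f i) = d l + diag_vec i" "s (f i) = s (z' i)" for i
    using comp_facts[OF l z'(1,2)] z' by (auto simp: f_def)
  have ext: "\<exists>e\<in>M. s (f i) = r e \<and> f (Suc i) = f i \<cdot> e" for i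
  proof -
    define e where "e = z (diag_vec i, diag_vec (Suc i))"
    have le: "diag_vec i \<le> diag_vec (Suc i)" by (rule diag_vec_mono) simp
    have eq: "z' (Suc i) = z' i \<cdot> e" unfolding z'_def e_def
      by (rule path_comp[OF z(1) vec_zero_le le])
    have e: "e \<in> M" "s (z' i) = r e"
      using path_facts[OF z(1) le] z'(4)[of i] by (simp_all add: e_def)
    have "f (Suc i) = f i \<cdot> e"
      using comp_assoc[OF l z'(1) e(1) z'(2) e(2)] by (simp add: f_def eq)
    then show ?thesis
      using e f(3)[of i] by auto
  qed
  have cofinal: "\<exists>i. n \<le> d (f i)" for n
  proof -
    obtain i where "n \<le> diag_vec i" using diag_vec_cofinal by blast
    also have "diag_vec i \<le> d (f i)" by (simp add: f vec_le_add)
    finally show "\<exists>i. n \<le> d (f i)" by blast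
  qed
  obtain y where y: "y \<in> P" "\<And>i. y (0, d (f i)) = f i"
    using path_of_chain[of f, OF f(1) ext cofinal] by blast
  have seg: "y (0, d l) = l" "y (d l, d l + diag_vec i) = z' i" for i
  proof -
    have le: "0 \<le> d l" "d l \<le> d l + diag_vec i" by (simp_all add: vec_zero_le vec_le_add)
    have "y (0, d l) \<cdot> y (d l, d l + diag_vec i) = l \<cdot> z' i"
      using path_comp[OF y(1) le] y(2)[of i] f(2)[of i] unfolding f_def by metis
    note * = factor_unique[OF _ _ _ _ _ _ this]
    show "y (0, d l) = l" "y (d l, d l + diag_vec i) = z' i"
      by (rule *; simp add: path_facts[OF y(1)] le l z' vec_diff_simps)+
  qed
  have "shift (d l) y = z"
  proof (rule path_ext_cofinal)
    fix n :: "nat^'k"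
    obtain i where "n \<le> diag_vec i" using diag_vec_cofinal by blast
    then show "\<exists>p\<ge>n. shift (d l) y (0, p) = z (0, p)"
      using seg(2) by (intro exI[of _ "diag_vec i"]) (auto simp: shift_prefix z'_def)
  qed (use y z shift_path in auto)
  then show thesis using that y seg by blast
qed

lemma prepend_props:
  assumes l: "l \<in> M" and z: "z \<in> P" "z (0, 0) = s l"
  shows "prepend \<Lambda> l z \<in> P" "prepend \<Lambda> l z (0, d l) = l" "shift (d l) (prepend \<Lambda> l z) = z"
proof -
  obtain y where y: "y \<in> P" "y (0, d l) = l" "shift (d l) y = z" using prepend_ex[OF assms] .
  have "\<exists>!y. y \<in> P \<and> y (0, d l) = l \<and> shift (d l) y = z"
    using y by (intro ex1I[of _ y]) (auto intro: path_join[of _ _ "d l"])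
  from theI'[OF this]
  show "prepend \<Lambda> l z \<in> P" "prepend \<Lambda> l z (0, d l) = l" "shift (d l) (prepend \<Lambda> l z) = z"
    unfolding prepend_def by auto
qed

lemma prepend_unique:
  assumes "y \<in> P" "y (0, d l) = l"
  shows "prepend \<Lambda> l (shift (d l) y) = y"
  unfolding prepend_def using assms by (intro the_equality) (auto intro: path_join[of _ _ "d l"])

lemma path_exists:
  assumes "l \<in> M"
  obtains x where "x \<in> P" "x (0, d l) = l"
proof -
  define ext where "ext a = (SOME e. e \<in> M \<and> s a = r e \<and> d e = diag_vec 1)" for a
  have ext: "ext a \<in> M" "s a = r (ext a)" "d (ext a) = diag_vec 1" if "a \<in> M" for a
  proof -
    have "\<exists>e. e \<in> M \<and> s a = r e \<and> d e = diag_vec 1"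
      using extend_by_degree[OF that] by metis
    from someI_ex[OF this] show "ext a \<in> M" "s a = r (ext a)" "d (ext a) = diag_vec 1"
      by (simp_all add: ext_def)
  qed
  define f where "f = rec_nat l (\<lambda>_ a. a \<cdot> ext a)"
  have f_Suc: "f (Suc i) = f i \<cdot> ext (f i)" for i
    by (simp add: f_def)
  have f: "f i \<in> M \<and> d (f i) = d l + diag_vec i" for i
  proof (induction i)
    case 0
    show ?case using assms by (simp add: f_def diag_vec_0)
  next
    case (Suc i)
    then show ?case
      using comp_facts(1,4)[OF _ ext(1,2), of "f i"] ext(3)[of "f i"]
      by (simp add: f_Suc diag_vec_Suc[of i] add.assoc)
  qed
  have fM: "f i \<in> M" for i
    using f by blast
  have f_ext: "\<exists>e\<in>M. s (f i) = r e \<and> f (Suc i) = f i \<cdot> e" for i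
    using ext[OF fM] f_Suc by blast
  have cofinal: "\<exists>i. n \<le> d (f i)" for n
  proof -
    obtain i where "n \<le> diag_vec i" using diag_vec_cofinal by blast
    also have "diag_vec i \<le> d (f i)" using f[of i] by (simp add: vec_le_add)
    finally show "\<exists>i. n \<le> d (f i)" by blast
  qed
  obtain x where x: "x \<in> P" "\<And>i. x (0, d (f i)) = f i"
    using path_of_chain[of f, OF fM f_ext cofinal] by blast
  then show thesis using that[of x] x(2)[of 0] by (simp add: f_def)
qed


subsection \<open>The topology of the path groupoid\<close>

abbreviation "G \<equiv> path_groupoid \<Lambda>"
abbreviation "X \<equiv> groupoid_topology \<Lambda>"

text \<open>The basic set Z(\<lambda>, \<mu>) named by an arrow in it, with \<lambda> = x (0, p) and
  \<mu> = y (0, q). Membership becomes a condition on prefixes and shifts and avoids the description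
  operator in \<open>prepend\<close>.\<close>

definition nbhd ::
    "nat^'k \<Rightarrow> nat^'k \<Rightarrow> ('m, 'k) path \<Rightarrow> ('m, 'k) path \<Rightarrow> ('m, 'k) arrow set" where
  "nbhd p q x y = {(x', int_vec p - int_vec q, y') | x' y'. x' \<in> P \<and> y' \<in> P \<and>
     x' (0, p) = x (0, p) \<and> y' (0, q) = y (0, q) \<and> shift p x' = shift q y'}"

text \<open>An arrow has many witnesses (p, q), each with its own basic neighbourhood, so the
  witness is kept as a parameter.\<close>

definition valid :: "nat^'k \<Rightarrow> nat^'k \<Rightarrow> ('m, 'k) arrow \<Rightarrow> bool" where
  "valid p q = (\<lambda>(x, n, y). x \<in> P \<and> y \<in> P \<and> n = int_vec p - int_vec q \<and> shift p x = shift q y)"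

lemma valid_iff:
  "valid p q (x, n, y) \<longleftrightarrow> x \<in> P \<and> y \<in> P \<and> n = int_vec p - int_vec q \<and> shift p x = shift q y"
  by (simp add: valid_def)

lemma groupoid_iff: "(x, n, y) \<in> G \<longleftrightarrow> (\<exists>p q. valid p q (x, n, y))"
  by (auto simp: path_groupoid_def valid_iff)

lemma groupoidI: "valid p q h \<Longrightarrow> h \<in> G"
  by (cases h) (use groupoid_iff in blast)

lemma mem_nbhd:
  "(x', n, y') \<in> nbhd p q x y \<longleftrightarrow>
    valid p q (x', n, y') \<and> x' (0, p) = x (0, p) \<and> y' (0, q) = y (0, q)"
  by (auto simp: nbhd_def valid_iff)

lemma nbhd_self: "valid p q (x, n, y) \<Longrightarrow> (x, n, y) \<in> nbhd p q x y"
  by (simp add: mem_nbhd)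

lemma nbhd_subset: "nbhd p q x y \<subseteq> G"
  by (auto simp: mem_nbhd intro: groupoidI)

lemma valid_add: "valid p q (x, n, y) \<Longrightarrow> valid (p + c) (q + c) (x, n, y)"
  using shift_shift[of c p x] shift_shift[of c q y]
  by (simp add: valid_iff int_vec_add add.commute)

text \<open>Two witnesses of one arrow have a common enlargement: (p + p', q + p') is also (p' + p,
  q' + p).\<close>

lemma int_vec_diff_eq_iff:
  "int_vec p - int_vec q = int_vec p' - int_vec q' \<longleftrightarrow> p + q' = p' + (q :: nat^'k)"
proof -
  have "int_vec p - int_vec q = int_vec p' - int_vec q' \<longleftrightarrow> int_vec (p + q') = int_vec (p' + q)"
    unfolding int_vec_add by (auto simp: algebra_simps)
  then show ?thesis by (simp add: int_vec_inj)
qed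

text \<open>The paths x' and y' copy x and y up to p + c and q + c. Since x and y agree on the
  segments of degree c after p and q, so do x' and y', and \<open>shift_join\<close> moves the tail
  condition down to (p, q).\<close>

lemma nbhd_mono:
  assumes v: "valid p q (x, n, y)"
  shows "nbhd (p + c) (q + c) x y \<subseteq> nbhd p q x y"
proof
  fix h assume h: "h \<in> nbhd (p + c) (q + c) x y"
  obtain x' m y' where h_eq: "h = (x', m, y')" by (cases h)
  have xy: "x \<in> P" "y \<in> P" "shift p x = shift q y" using v by (auto simp: valid_iff)
  have h': "x' \<in> P" "y' \<in> P" "m = int_vec (p + c) - int_vec (q + c)" "shift (p + c) x' = shift (q + c) y'"
    "x' (0, p + c) = x (0, p + c)" "y' (0, q + c) = y (0, q + c)"
    using h unfolding h_eq mem_nbhd valid_iff by auto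
  have eq: "x' (i, j) = x (i, j)" if "i \<le> j" "j \<le> p + c" for i j
    using path_prefix_eq[OF h'(1) xy(1) h'(5) that] .
  have eq': "y' (i, j) = y (i, j)" if "i \<le> j" "j \<le> q + c" for i j
    using path_prefix_eq[OF h'(2) xy(2) h'(6) that] .
  have "x (p, p + c) = y (q, q + c)"
    using xy(3) by (metis shift_prefix)
  then have "shift p x' = shift q y'"
    using shift_join[OF h'(1,2) _ h'(4)] eq eq' by (simp add: vec_le_add)
  then show "h \<in> nbhd p q x y"
    using h' eq eq' by (simp add: h_eq mem_nbhd valid_iff vec_le_add vec_zero_le int_vec_add)
qed

lemma cylinder_eq:
  assumes l: "l \<in> M" and m: "m \<in> M" and sr: "s l = s m"
  shows "(x, n, y) \<in> cylinder \<Lambda> l m \<longleftrightarrow> valid (d l) (d m) (x, n, y) \<and> x (0, d l) = l \<and> y (0, d m) = m"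
    (is "?L \<longleftrightarrow> ?R")
proof
  assume ?L
  then obtain z where z: "x = prepend \<Lambda> l z" "n = int_vec (d l) - int_vec (d m)" "y = prepend \<Lambda> m z"
      "z \<in> P" "z (0, 0) = s l"
    by (auto simp: cylinder_def inf_paths_at_def)
  then show ?R
    using prepend_props[OF l z(4)] prepend_props[OF m z(4)] sr by (simp add: valid_iff)
next
  assume R: ?R
  define z where "z = shift (d l) x"
  have z: "z \<in> P" "z = shift (d m) y" using R by (auto simp: z_def valid_iff shift_path)
  have "z (0, 0) = x (d l, d l)" by (simp add: z_def shift_apply)
  also have "\<dots> = s l"
    using path_facts(3)[of x 0 "d l"] R by (simp add: valid_iff vec_zero_le)
  finally have "z \<in> inf_paths_at \<Lambda> (s l)" using z by (simp add: inf_paths_at_def)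
  moreover have "prepend \<Lambda> l z = x"
    using prepend_unique[of x l] R by (simp add: z_def valid_iff)
  moreover have "prepend \<Lambda> m z = y"
    using prepend_unique[of y m] R by (simp add: z(2) valid_iff)
  ultimately show ?L
    using R unfolding cylinder_def valid_iff by blast
qed

lemma valid_ends:
  assumes "valid p q (x, n, y)"
  shows "x (0, p) \<in> M" "y (0, q) \<in> M" "d (x (0, p)) = p" "d (y (0, q)) = q"
    "s (x (0, p)) = s (y (0, q))"
proof -
  have v: "x \<in> P" "y \<in> P" "shift p x = shift q y" using assms by (auto simp: valid_iff)
  show "x (0, p) \<in> M" "y (0, q) \<in> M" "d (x (0, p)) = p" "d (y (0, q)) = q"
    using path_facts[OF v(1) vec_zero_le] path_facts[OF v(2) vec_zero_le]
    by (simp_all add: vec_diff_simps)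
  have "x (p, p) = shift p x (0, 0)" "y (q, q) = shift q y (0, 0)" by (simp_all add: shift_apply)
  then show "s (x (0, p)) = s (y (0, q))"
    using path_facts(3)[OF v(1) vec_zero_le] path_facts(3)[OF v(2) vec_zero_le] v(3) by simp
qed

lemma nbhd_eq_cylinder:
  assumes "valid p q (x, n, y)"
  shows "nbhd p q x y = cylinder \<Lambda> (x (0, p)) (y (0, q))"
proof -
  note e = valid_ends[OF assms]
  have "(x', m, y') \<in> nbhd p q x y \<longleftrightarrow> (x', m, y') \<in> cylinder \<Lambda> (x (0, p)) (y (0, q))" for x' m y'
    unfolding mem_nbhd cylinder_eq[OF e(1,2,5)] by (simp add: e)
  then show ?thesis by auto
qed

lemma cylinder_eq_nbhd:
  assumes "l \<in> M" "m \<in> M" "s l = s m" "(x, n, y) \<in> cylinder \<Lambda> l m"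
  shows "cylinder \<Lambda> l m = nbhd (d l) (d m) x y"
  using nbhd_eq_cylinder[of "d l" "d m" x n y] assms cylinder_eq[OF assms(1-3), of x n y] by simp

lemma open_nbhd:
  assumes "valid p q (x, n, y)"
  shows "openin X (nbhd p q x y)"
  unfolding nbhd_eq_cylinder[OF assms] groupoid_topology_def
  using valid_ends[OF assms] by (intro topology_generated_by_Basis) auto

text \<open>The point is the intersection case: two witnesses of the same arrow have a common
  enlargement, whose neighbourhood lies in both given ones. Thus the generating cylinders form a
  base.\<close>

lemma openin_iff:
  "openin X U \<longleftrightarrow> U \<subseteq> G \<and> (\<forall>x n y. (x, n, y) \<in> U \<longrightarrow> (\<exists>p q. valid p q (x, n, y) \<and> nbhd p q x y \<subseteq> U))"
  (is "_ \<longleftrightarrow> ?R U")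
proof
  assume "openin X U"
  then have "generate_topology_on {cylinder \<Lambda> l m |l m. l \<in> M \<and> m \<in> M \<and> s l = s m} U"
    unfolding groupoid_topology_def by (rule openin_topology_generated_by)
  then show "?R U"
  proof induction
    case Empty
    show ?case by simp
  next
    case (Int U V)
    have "\<exists>p q. valid p q (x, n, y) \<and> nbhd p q x y \<subseteq> U \<inter> V" if h: "(x, n, y) \<in> U \<inter> V" for x n y
    proof -
      obtain p q p' q' where v: "valid p q (x, n, y)" "nbhd p q x y \<subseteq> U"
          "valid p' q' (x, n, y)" "nbhd p' q' x y \<subseteq> V"
        using Int.IH h by blast
      have "p + q' = p' + q"
        using v(1,3) int_vec_diff_eq_iff[of p q p' q'] by (simp add: valid_iff)
      then have "nbhd (p + p') (q + p') x y \<subseteq> nbhd p' q' x y"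
        using nbhd_mono[OF v(3), of p] by (simp add: add.commute)
      then show ?thesis
        using nbhd_mono[OF v(1), of p'] valid_add[OF v(1), of p'] v by blast
    qed
    then show ?case using Int.IH by blast
  next
    case (UN K)
    then show ?case by (meson Sup_least UnionE Union_upper order_trans)
  next
    case (Basis U)
    then obtain l m where lm: "U = cylinder \<Lambda> l m" "l \<in> M" "m \<in> M" "s l = s m" by blast
    have "valid (d l) (d m) (x, n, y) \<and> nbhd (d l) (d m) x y \<subseteq> U" if "(x, n, y) \<in> U" for x n y
      using that cylinder_eq[OF lm(2-4), of x n y] cylinder_eq_nbhd[OF lm(2-4), of x n y] lm(1) by simp
    moreover have "U \<subseteq> G"
      using cylinder_eq[OF lm(2-4)] lm(1) by (auto intro: groupoidI)
    ultimately show ?case by blast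
  qed
next
  assume R: "?R U"
  show "openin X U"
    unfolding openin_subopen[of X U]
  proof
    fix h assume "h \<in> U"
    obtain x n y where h: "h = (x, n, y)" by (cases h)
    obtain p q where "valid p q (x, n, y)" "nbhd p q x y \<subseteq> U" using R \<open>h \<in> U\<close> h by blast
    then show "\<exists>T. openin X T \<and> h \<in> T \<and> T \<subseteq> U"
      using open_nbhd[of p q x n y] nbhd_self[of p q x n y] h by (intro exI[of _ "nbhd p q x y"]) simp
  qed
qed

text \<open>The witness is arbitrary and only some enlargement of it has to fit, so a proof may take
  prefixes as long as it likes.\<close>

lemma openinI:
  assumes "U \<subseteq> G" "\<And>x n y p q. (x, n, y) \<in> U \<Longrightarrow> valid p q (x, n, y) \<Longrightarrow> \<exists>c. nbhd (p + c) (q + c) x y \<subseteq> U"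
  shows "openin X U"
  unfolding openin_iff
proof (intro conjI allI impI)
  fix x n y assume h: "(x, n, y) \<in> U"
  then obtain p q where "valid p q (x, n, y)" using assms(1) groupoid_iff by blast
  then show "\<exists>p q. valid p q (x, n, y) \<and> nbhd p q x y \<subseteq> U"
    using assms(2)[OF h] valid_add by blast
qed (rule assms(1))

lemma topspace_eq: "topspace X = G"
proof
  show "topspace X \<subseteq> G" using openin_iff[of "topspace X"] by simp
  have "openin X G" by (rule openinI) (use nbhd_subset in auto)
  then show "G \<subseteq> topspace X" by (rule openin_subset)
qed

text \<open>A witness of a unit has p = q, so its neighbourhood lies in the one for (0, 0), where
  the tail condition is equality of the two paths.\<close>

lemma open_units: "openin X (unit_space \<Lambda>)"
proof (rule openinI)
  show "unit_space \<Lambda> \<subseteq> G"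
    by (auto simp: unit_space_def groupoid_iff valid_iff intro!: exI[of _ 0])
next
  fix x n y p q assume u: "(x, n, y) \<in> unit_space \<Lambda>" and v: "valid p q (x, n, y)"
  have n: "x \<in> P" "n = 0" "y = x" using u by (auto simp: unit_space_def)
  have v0: "valid 0 0 (x, n, y)" using n by (simp add: valid_iff)
  have "int_vec p - int_vec q = int_vec 0 - int_vec (0 :: nat^'k)" using v n by (simp add: valid_iff)
  then have "p = q" unfolding int_vec_diff_eq_iff by simp
  then have "nbhd (p + 0) (q + 0) x y \<subseteq> nbhd 0 0 x y"
    using nbhd_mono[OF v0, of p] by simp
  also have "\<dots> \<subseteq> unit_space \<Lambda>"
    by (auto simp: mem_nbhd valid_iff unit_space_def shift_zero)
  finally show "\<exists>c. nbhd (p + c) (q + c) x y \<subseteq> unit_space \<Lambda>" by blast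
qed

text \<open>With \<open>open_units\<close> this makes the unit space clopen, so functions can be cut
  down to it. The integer coordinate is constant on a neighbourhood; when it is 0, a prefix long
  enough to separate x from y excludes units.\<close>

lemma open_compl_units: "openin X (G - unit_space \<Lambda>)"
proof (rule openinI)
  fix x n y p q assume u: "(x, n, y) \<in> G - unit_space \<Lambda>" and v: "valid p q (x, n, y)"
  show "\<exists>c. nbhd (p + c) (q + c) x y \<subseteq> G - unit_space \<Lambda>"
  proof (cases "n = 0")
    case False
    then have "nbhd (p + 0) (q + 0) x y \<subseteq> G - unit_space \<Lambda>"
      using v nbhd_subset[of p q x y] by (auto simp: mem_nbhd valid_iff unit_space_def)
    then show ?thesis by blast
  next
    case True
    then have "int_vec p - int_vec q = int_vec 0 - int_vec (0 :: nat^'k)" using v by (simp add: valid_iff)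
    then have pq: "p = q" unfolding int_vec_diff_eq_iff by simp
    have xy: "x \<in> P" "y \<in> P" using v by (auto simp: valid_iff)
    then have "x \<noteq> y" using u True by (auto simp: unit_space_def)
    then obtain c where c: "x (0, c) \<noteq> y (0, c)" using path_ext[OF xy] by blast
    have "x' \<notin> P" if "x' (0, p + c) = x (0, p + c)" "x' (0, p + c) = y (0, p + c)" for x'
    proof
      assume "x' \<in> P"
      then have "x' (0, c) = x (0, c)" "x' (0, c) = y (0, c)"
        using path_prefix_eq[of x' x "p + c" 0 c] path_prefix_eq[of x' y "p + c" 0 c] xy that
        by (simp_all add: vec_le_add vec_zero_le)
      then show False using c by simp
    qed
    then have disj: "(x', m, x') \<notin> nbhd (p + c) (q + c) x y" for x' m
      by (metis mem_nbhd valid_iff pq)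
    have "nbhd (p + c) (q + c) x y \<inter> unit_space \<Lambda> = {}"
      using disj by (auto simp: unit_space_def)
    then have "nbhd (p + c) (q + c) x y \<subseteq> G - unit_space \<Lambda>"
      using nbhd_subset by blast
    then show ?thesis by blast
  qed
qed simp

text \<open>The condition concerns the range only, so this is a union of range fibres; for an object
  it collects the arrows whose range starts there.\<close>

definition start :: "'m \<Rightarrow> ('m, 'k) arrow set" where
  "start l = {(x, n, y). (x, n, y) \<in> G \<and> x (0, d l) = l}"

lemma mem_start: "(x, n, y) \<in> start l \<longleftrightarrow> (x, n, y) \<in> G \<and> x (0, d l) = l"
  by (simp add: start_def)

lemma nbhd_start:
  assumes "valid p q (x, n, y)" "(x', n', y') \<in> nbhd (p + d l) (q + d l) x y"
  shows "x' (0, d l) = x (0, d l)"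
proof (rule path_prefix_eq)
  show "x' (0, p + d l) = x (0, p + d l)" "x' \<in> P" "x \<in> P"
    using assms by (auto simp: mem_nbhd valid_iff)
qed (simp_all add: vec_zero_le vec_le_add)

lemma open_start: "openin X (start l)" "openin X (G - start l)"
proof -
  show "openin X (start l)"
  proof (rule openinI)
    fix x n y p q assume "(x, n, y) \<in> start l" and v: "valid p q (x, n, y)"
    then have "nbhd (p + d l) (q + d l) x y \<subseteq> start l"
      using nbhd_start[OF v, of _ _ _ l] nbhd_subset[of "p + d l" "q + d l" x y]
      by (auto simp: mem_start)
    then show "\<exists>c. nbhd (p + c) (q + c) x y \<subseteq> start l" by blast
  qed (auto simp: start_def)
  show "openin X (G - start l)"
  proof (rule openinI)
    fix x n y p q assume "(x, n, y) \<in> G - start l" and v: "valid p q (x, n, y)"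
    then have "nbhd (p + d l) (q + d l) x y \<subseteq> G - start l"
      using nbhd_start[OF v, of _ _ _ l] nbhd_subset[of "p + d l" "q + d l" x y]
      by (auto simp: mem_start)
    then show "\<exists>c. nbhd (p + c) (q + c) x y \<subseteq> G - start l" by blast
  qed simp
qed

section \<open>Diagonal cylinders and compactness\<close>

lemma cylinder_diagonal:
  assumes "l \<in> M"
  shows "cylinder \<Lambda> l l = unit_space \<Lambda> \<inter> start l"
proof -
  have "(x, n, y) \<in> cylinder \<Lambda> l l \<longleftrightarrow> (x, n, y) \<in> unit_space \<Lambda> \<inter> start l" for x n y
  proof
    assume "(x, n, y) \<in> cylinder \<Lambda> l l"
    then have v: "valid (d l) (d l) (x, n, y)" "x (0, d l) = l" "y (0, d l) = l"
      using cylinder_eq[OF assms assms] by auto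
    then have "x = y" by (intro path_join[of x y "d l"]) (auto simp: valid_iff)
    then show "(x, n, y) \<in> unit_space \<Lambda> \<inter> start l"
      using v groupoidI[OF v(1)] by (auto simp: unit_space_def mem_start valid_iff)
  next
    assume "(x, n, y) \<in> unit_space \<Lambda> \<inter> start l"
    then show "(x, n, y) \<in> cylinder \<Lambda> l l"
      using cylinder_eq[OF assms assms] by (auto simp: unit_space_def mem_start valid_iff)
  qed
  then show ?thesis by auto
qed

lemma cylinder_split:
  assumes a: "a \<in> M" and b: "b \<in> M" and sr: "s a = s b" and h: "h \<in> cylinder \<Lambda> a b"
  shows "\<exists>e\<in>paths_of_degree \<Lambda> c (s a). h \<in> cylinder \<Lambda> (a \<cdot> e) (b \<cdot> e)"
proof -
  obtain x n y where h_eq: "h = (x, n, y)" by (cases h)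
  have v: "valid (d a) (d b) (x, n, y)" "x (0, d a) = a" "y (0, d b) = b"
    using h cylinder_eq[OF a b sr] h_eq by auto
  then have xy: "x \<in> P" "y \<in> P" "shift (d a) x = shift (d b) y" by (auto simp: valid_iff)
  define e where "e = x (d a, d a + c)"
  have e': "e = y (d b, d b + c)"
    using xy(3) unfolding e_def by (metis shift_prefix)
  have e: "e \<in> M" "d e = c" "r e = s a"
    using path_facts[OF xy(1), of "d a" "d a + c"] path_facts(3)[OF xy(1), of 0 "d a"] v(2)
    by (simp_all add: e_def vec_le_add vec_diff_simps vec_zero_le)
  have "x (0, d a + c) = a \<cdot> e" "y (0, d b + c) = b \<cdot> e"
    using path_comp[OF xy(1), of 0 "d a" "d a + c"] path_comp[OF xy(2), of 0 "d b" "d b + c"] v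
    by (simp_all add: e_def[symmetric] e'[symmetric] vec_le_add vec_zero_le)
  then have "(x, n, y) \<in> cylinder \<Lambda> (a \<cdot> e) (b \<cdot> e)"
    using cylinder_eq[of "a \<cdot> e" "b \<cdot> e"] comp_facts[OF a e(1)] comp_facts[OF b e(1)] e sr
      valid_add[OF v(1), of c] by simp
  then show ?thesis
    using e h_eq by (auto simp: paths_of_degree_def)
qed

text \<open>A Koenig argument: by row-finiteness a cylinder is covered by finitely many longer ones,
  so the lack of a finite subcover passes to some extension of degree \<open>diag_vec 1\<close>.
  Iteration gives a path z, and the member of the cover around the arrow given by z contains one of
  the bad cylinders.\<close>

lemma compact_cylinder:
  assumes l: "l \<in> M" and m: "m \<in> M" and sr: "s l = s m"
  shows "compactin X (cylinder \<Lambda> l m)"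
  unfolding compactin_def
proof (intro conjI allI impI)
  show "cylinder \<Lambda> l m \<subseteq> topspace X"
    using cylinder_eq[OF l m sr] by (auto simp: topspace_eq intro: groupoidI)
next
  fix \<U> assume U: "(\<forall>U\<in>\<U>. openin X U) \<and> cylinder \<Lambda> l m \<subseteq> \<Union>\<U>"
  define good where "good a \<longleftrightarrow> (\<exists>\<F>. finite \<F> \<and> \<F> \<subseteq> \<U> \<and> cylinder \<Lambda> (l \<cdot> a) (m \<cdot> a) \<subseteq> \<Union>\<F>)" for a
  have step: "\<exists>e. e \<in> M \<and> s a = r e \<and> d e = diag_vec 1 \<and> \<not> good (a \<cdot> e)"
    if a: "a \<in> M" "s l = r a" and bad: "\<not> good a" for a
  proof (rule ccontr)
    assume contra: "\<nexists>e. e \<in> M \<and> s a = r e \<and> d e = diag_vec 1 \<and> \<not> good (a \<cdot> e)"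
    let ?E = "paths_of_degree \<Lambda> (diag_vec 1) (s a)"
    have "finite ?E"
      using row_finite cat(2,10)[OF a(1)] unfolding row_finite_no_sources_def by (simp add: object_iff)
    have "\<forall>e\<in>?E. \<exists>\<F>. finite \<F> \<and> \<F> \<subseteq> \<U> \<and> cylinder \<Lambda> (l \<cdot> a \<cdot> e) (m \<cdot> a \<cdot> e) \<subseteq> \<Union>\<F>"
    proof
      fix e assume e_in: "e \<in> ?E"
      have e: "e \<in> M" "s a = r e" "d e = diag_vec 1" using e_in by (auto simp: paths_of_degree_def)
      then have "good (a \<cdot> e)" using contra by blast
      then show "\<exists>\<F>. finite \<F> \<and> \<F> \<subseteq> \<U> \<and> cylinder \<Lambda> (l \<cdot> a \<cdot> e) (m \<cdot> a \<cdot> e) \<subseteq> \<Union>\<F>"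
        using comp_assoc[OF l a(1) e(1)] comp_assoc[OF m a(1) e(1)] a(2) sr e(2) by (simp add: good_def)
    qed
    then have "\<exists>\<F>. \<forall>e\<in>?E. finite (\<F> e) \<and> \<F> e \<subseteq> \<U> \<and>
        cylinder \<Lambda> (l \<cdot> a \<cdot> e) (m \<cdot> a \<cdot> e) \<subseteq> \<Union>(\<F> e)"
      by (rule bchoice)
    then obtain \<F> where F: "\<forall>e\<in>?E. finite (\<F> e) \<and> \<F> e \<subseteq> \<U> \<and>
        cylinder \<Lambda> (l \<cdot> a \<cdot> e) (m \<cdot> a \<cdot> e) \<subseteq> \<Union>(\<F> e)" ..
    have la: "l \<cdot> a \<in> M" "m \<cdot> a \<in> M" "s (l \<cdot> a) = s (m \<cdot> a)" "s (l \<cdot> a) = s a"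
      using comp_facts[OF l a(1)] comp_facts[OF m a(1)] a sr by auto
    have "cylinder \<Lambda> (l \<cdot> a) (m \<cdot> a) \<subseteq> \<Union>(\<Union>(\<F> ` ?E))"
    proof
      fix h assume "h \<in> cylinder \<Lambda> (l \<cdot> a) (m \<cdot> a)"
      then obtain e where "e \<in> ?E" "h \<in> cylinder \<Lambda> (l \<cdot> a \<cdot> e) (m \<cdot> a \<cdot> e)"
        using cylinder_split[OF la(1-3), of h "diag_vec 1"] la(4) by auto
      then show "h \<in> \<Union>(\<Union>(\<F> ` ?E))" using bspec[OF F, of e] by blast
    qed
    moreover have "finite (\<Union>(\<F> ` ?E))"
      using \<open>finite ?E\<close> bspec[OF F] by (intro finite_UN_I) auto
    moreover have "\<Union>(\<F> ` ?E) \<subseteq> \<U>"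
      using bspec[OF F] by (intro UN_least) auto
    ultimately have "good a" unfolding good_def by blast
    then show False using bad by simp
  qed
  have "good (s l)"
  proof (rule ccontr)
    assume bad0: "\<not> good (s l)"
    define ext where "ext a = (SOME e. e \<in> M \<and> s a = r e \<and> d e = diag_vec 1 \<and> \<not> good (a \<cdot> e))" for a
    have ext: "ext a \<in> M \<and> s a = r (ext a) \<and> d (ext a) = diag_vec 1 \<and> \<not> good (a \<cdot> ext a)"
      if "a \<in> M" "s l = r a" "\<not> good a" for a
      unfolding ext_def by (rule someI_ex[OF step[OF that]])
    define f where "f = rec_nat (s l) (\<lambda>_ a. a \<cdot> ext a)"
    have f_Suc: "f (Suc i) = f i \<cdot> ext (f i)" for i
      by (simp add: f_def)
    have f: "f i \<in> M \<and> s l = r (f i) \<and> d (f i) = diag_vec i \<and> \<not> good (f i)" for i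
    proof (induction i)
      case 0
      show ?case using cat[OF l] bad0 by (simp add: f_def diag_vec_0)
    next
      case (Suc i)
      then show ?case
        using comp_facts[of "f i" "ext (f i)"] ext[of "f i"]
        by (simp add: f_Suc diag_vec_Suc[of i])
    qed
    have fM: "f i \<in> M" for i using f by blast
    have f_ext: "\<exists>e\<in>M. s (f i) = r e \<and> f (Suc i) = f i \<cdot> e" for i
      using ext[of "f i"] f f_Suc by blast
    have cofinal: "\<exists>i. n \<le> d (f i)" for n
      using f diag_vec_cofinal[of n] by metis
    obtain z where z: "z \<in> P" "\<And>i. z (0, d (f i)) = f i"
      using path_of_chain[of f, OF fM f_ext cofinal] by blast
    have z0: "z (0, 0) = s l" "z (0, 0) = s m"
      using z(2)[of 0] cat[OF l] sr by (simp_all add: f_def)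
    define x where "x = prepend \<Lambda> l z"
    define y where "y = prepend \<Lambda> m z"
    have x: "x \<in> P" "x (0, d l) = l" "shift (d l) x = z"
      unfolding x_def using prepend_props[OF l z(1) z0(1)] .
    have y: "y \<in> P" "y (0, d m) = m" "shift (d m) y = z"
      unfolding y_def using prepend_props[OF m z(1) z0(2)] .
    define n where "n = int_vec (d l) - int_vec (d m)"
    have v: "valid (d l) (d m) (x, n, y)" using x y by (simp add: valid_iff n_def)
    have "(x, n, y) \<in> cylinder \<Lambda> l m"
      using cylinder_eq[OF l m sr] v x y by simp
    then obtain U where UU: "U \<in> \<U>" "openin X U" "(x, n, y) \<in> U" using U by blast
    obtain p q where pq: "valid p q (x, n, y)" "nbhd p q x y \<subseteq> U" using UU openin_iff by blast
    have eq: "p + d m = d l + q"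
      using pq(1) v int_vec_diff_eq_iff[of p q "d l" "d m"] by (simp add: valid_iff)
    obtain i where "p \<le> diag_vec i" using diag_vec_cofinal by blast
    then obtain c where c: "diag_vec i = p + c" using vec_le_ex by blast
    have D: "d (f i) = diag_vec i" using f by blast
    have zi: "z (0, diag_vec i) = f i" using z(2)[of i] D by simp
    have "x (0, d l + diag_vec i) = l \<cdot> f i"
      using path_comp[OF x(1), of 0 "d l" "d l + diag_vec i"] x(2) shift_prefix[of "d l" x "diag_vec i"] x(3) zi
      by (simp add: vec_le_add vec_zero_le)
    moreover have "y (0, d m + diag_vec i) = m \<cdot> f i"
      using path_comp[OF y(1), of 0 "d m" "d m + diag_vec i"] y(2) shift_prefix[of "d m" y "diag_vec i"] y(3) zi
      by (simp add: vec_le_add vec_zero_le)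
    ultimately have "cylinder \<Lambda> (l \<cdot> f i) (m \<cdot> f i) = nbhd (d l + diag_vec i) (d m + diag_vec i) x y"
      using nbhd_eq_cylinder[OF valid_add[OF v, of "diag_vec i"]] by simp
    \<comment> \<open>Because p + d m = d l + q, both prefix degrees exceed (p, q) by the same
      vector, as \<open>nbhd_mono\<close> demands.\<close>
    also have "\<dots> = nbhd (p + (d l + c)) (q + (d l + c)) x y"
    proof -
      have "d l + diag_vec i = p + (d l + c)" "d m + diag_vec i = q + (d l + c)"
        using c eq by (simp_all add: algebra_simps)
      then show ?thesis by simp
    qed
    also have "\<dots> \<subseteq> U" using nbhd_mono[OF pq(1)] pq(2) by blast
    finally have "good (f i)"
      unfolding good_def using UU(1) by (intro exI[of _ "{U}"]) auto
    then show False using f by blast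
  qed
  then show "\<exists>\<F>. finite \<F> \<and> \<F> \<subseteq> \<U> \<and> cylinder \<Lambda> l m \<subseteq> \<Union>\<F>"
    using cat(8)[OF l] cat(8)[OF m] sr by (simp add: good_def)
qed

end

subsection \<open>Operators on square-summable functions\<close>

lemmas ell2_apply_simps =
  plus_ell2.rep_eq minus_ell2.rep_eq zero_ell2.rep_eq uminus_ell2.rep_eq scaleR_ell2.rep_eq
  scaleC.rep_eq delta.rep_eq

lemma ell2_eqI: "(\<And>g. ell2_apply \<xi> g = ell2_apply \<eta> g) \<Longrightarrow> \<xi> = \<eta>"
  using ell2_apply_inject by blast

lemma ell2_blinfun_eqI:
  fixes S T :: "'a ell2 \<Rightarrow>\<^sub>L 'a ell2"
  assumes "\<And>\<xi> g. ell2_apply (S \<xi>) g = ell2_apply (T \<xi>) g"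
  shows "S = T"
  by (intro blinfun_eqI ell2_eqI assms)

lemma ell2_summable: "(\<lambda>i. (cmod (ell2_apply \<xi> i))\<^sup>2) summable_on A"
  using summable_on_subset_banach[of _ UNIV A] ell2_apply[of \<xi>] by auto

lemma norm_ell2_sq: "(norm \<xi>)\<^sup>2 = (\<Sum>\<^sub>\<infinity>i. (cmod (ell2_apply \<xi> i))\<^sup>2)"
proof -
  have "(norm \<xi>)\<^sup>2 = \<xi> \<bullet> \<xi>"
    by (simp add: norm_ell2_def)
  also have "\<dots> = (\<Sum>\<^sub>\<infinity>i. (cmod (ell2_apply \<xi> i))\<^sup>2)"
    by (simp only: inner_ell2.rep_eq dot_square_norm)
  finally show ?thesis .
qed

lemma cmod_ell2_apply_le: "cmod (ell2_apply \<xi> i) \<le> norm \<xi>"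
proof (rule power2_le_imp_le)
  have "(\<Sum>\<^sub>\<infinity>j\<in>{i}. (cmod (ell2_apply \<xi> j))\<^sup>2) \<le> (\<Sum>\<^sub>\<infinity>j. (cmod (ell2_apply \<xi> j))\<^sup>2)"
    by (rule infsum_mono2) (auto simp: ell2_summable)
  then show "(cmod (ell2_apply \<xi> i))\<^sup>2 \<le> (norm \<xi>)\<^sup>2"
    by (simp add: norm_ell2_sq)
qed simp

lemma norm_delta: "norm (delta a) = 1"
proof -
  have "(norm (delta a))\<^sup>2 = (\<Sum>\<^sub>\<infinity>i\<in>{a}. (1::real))"
    unfolding norm_ell2_sq by (rule infsum_cong_neutral) (auto simp: delta.rep_eq)
  then show ?thesis by (simp add: power2_eq_1_iff) (smt (verit) norm_ge_zero)
qed

lemma bounded_linear_ell2_apply: "bounded_linear (\<lambda>\<xi>. ell2_apply \<xi> i)"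
  by (rule bounded_linear_intro[where K = 1]) (simp_all add: ell2_apply_simps cmod_ell2_apply_le)

lemma ell2_apply_sum: "ell2_apply (sum f F) i = (\<Sum>j\<in>F. ell2_apply (f j) i)"
  by (rule linear_sum[OF bounded_linear.linear[OF bounded_linear_ell2_apply]])

lemma tendsto_ell2_apply:
  fixes T :: "'a ell2 \<Rightarrow>\<^sub>L 'b ell2"
  assumes "(Tn \<longlongrightarrow> T) F"
  shows "((\<lambda>n. ell2_apply (Tn n \<xi>) g) \<longlongrightarrow> ell2_apply (T \<xi>) g) F"
  using assms by (intro bounded_linear.tendsto[OF bounded_linear_ell2_apply] blinfun.tendsto tendsto_const)

lemma cmod_blinfun_ell2_le:
  fixes T :: "'a ell2 \<Rightarrow>\<^sub>L 'b ell2"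
  shows "cmod (ell2_apply (T (delta a)) g) \<le> norm T"
  using cmod_ell2_apply_le[of "T (delta a)" g] norm_blinfun[of T "delta a"] by (simp add: norm_delta)

text \<open>One shape for both kinds of operator: with \<tau> the identity it multiplies by a
  function, with \<tau> a change of the integer coordinate it translates.\<close>

definition weighted_comp :: "('a \<Rightarrow> complex) \<Rightarrow> ('a \<Rightarrow> 'a) \<Rightarrow> 'a ell2 \<Rightarrow>\<^sub>L 'a ell2" where
  "weighted_comp \<phi> \<tau> = Blinfun (\<lambda>\<xi>. Abs_ell2 (\<lambda>g. \<phi> g * ell2_apply \<xi> (\<tau> g)))"

text \<open>Injectivity of \<tau> bounds the square sum of \<xi> along \<tau> by the square sum of
  \<xi>, so a bound for the weight is a bound for the operator.\<close>

lemma weighted_comp: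
  fixes \<phi> :: "'a \<Rightarrow> complex"
  assumes inj: "inj \<tau>" and bd: "\<And>g. cmod (\<phi> g) \<le> B"
  shows "ell2_apply (weighted_comp \<phi> \<tau> \<xi>) g = \<phi> g * ell2_apply \<xi> (\<tau> g)"
    and "norm (weighted_comp \<phi> \<tau>) \<le> B"
proof -
  let ?f = "\<lambda>\<xi>. Abs_ell2 (\<lambda>g. \<phi> g * ell2_apply \<xi> (\<tau> g))"
  have B: "0 \<le> B" using order_trans[OF norm_ge_zero bd] .
  have reindex: "(\<lambda>g. (cmod (ell2_apply \<xi> (\<tau> g)))\<^sup>2) summable_on UNIV"
      "(\<Sum>\<^sub>\<infinity>g. (cmod (ell2_apply \<xi> (\<tau> g)))\<^sup>2) \<le> (norm \<xi>)\<^sup>2" for \<xi> :: "'a ell2"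
  proof -
    have b: "bij_betw \<tau> UNIV (range \<tau>)" using inj by (simp add: bij_betw_def)
    show "(\<lambda>g. (cmod (ell2_apply \<xi> (\<tau> g)))\<^sup>2) summable_on UNIV"
      using summable_on_reindex_bij_betw[OF b, of "\<lambda>g. (cmod (ell2_apply \<xi> g))\<^sup>2"] ell2_summable by blast
    have "(\<Sum>\<^sub>\<infinity>g. (cmod (ell2_apply \<xi> (\<tau> g)))\<^sup>2) = (\<Sum>\<^sub>\<infinity>g\<in>range \<tau>. (cmod (ell2_apply \<xi> g))\<^sup>2)"
      using infsum_reindex_bij_betw[OF b, of "\<lambda>g. (cmod (ell2_apply \<xi> g))\<^sup>2"] .
    also have "\<dots> \<le> (norm \<xi>)\<^sup>2"
      unfolding norm_ell2_sq by (rule infsum_mono2) (auto simp: ell2_summable)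
    finally show "(\<Sum>\<^sub>\<infinity>g. (cmod (ell2_apply \<xi> (\<tau> g)))\<^sup>2) \<le> (norm \<xi>)\<^sup>2" .
  qed
  have le: "(cmod (\<phi> g * ell2_apply \<xi> (\<tau> g)))\<^sup>2 \<le> B\<^sup>2 * (cmod (ell2_apply \<xi> (\<tau> g)))\<^sup>2" for g and \<xi> :: "'a ell2"
    using bd[of g] by (simp add: norm_mult power_mult_distrib mult_right_mono power_mono)
  have summ: "(\<lambda>g. (cmod (\<phi> g * ell2_apply \<xi> (\<tau> g)))\<^sup>2) summable_on UNIV" for \<xi> :: "'a ell2"
    by (rule summable_on_comparison_test[OF summable_on_cmult_right[OF reindex(1)] le]) auto
  have ap: "ell2_apply (?f \<xi>) g = \<phi> g * ell2_apply \<xi> (\<tau> g)" for \<xi> g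
    by (subst Abs_ell2_inverse) (use summ in auto)
  have nrm: "norm (?f \<xi>) \<le> norm \<xi> * B" for \<xi>
  proof (rule power2_le_imp_le)
    have "(norm (?f \<xi>))\<^sup>2 \<le> (\<Sum>\<^sub>\<infinity>g. B\<^sup>2 * (cmod (ell2_apply \<xi> (\<tau> g)))\<^sup>2)"
      unfolding norm_ell2_sq ap
      by (rule infsum_mono[OF summ summable_on_cmult_right[OF reindex(1)] le])
    also have "\<dots> = B\<^sup>2 * (\<Sum>\<^sub>\<infinity>g. (cmod (ell2_apply \<xi> (\<tau> g)))\<^sup>2)"
      by (rule infsum_cmult_right')
    also have "\<dots> \<le> B\<^sup>2 * (norm \<xi>)\<^sup>2"
      by (rule mult_left_mono[OF reindex(2)]) simp
    finally show "(norm (?f \<xi>))\<^sup>2 \<le> (norm \<xi> * B)\<^sup>2"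
      by (simp add: power_mult_distrib mult.commute)
  qed (simp add: B)
  have bl: "bounded_linear ?f"
  proof (rule bounded_linear_intro[OF _ _ nrm])
    show "?f (\<xi> + \<eta>) = ?f \<xi> + ?f \<eta>" for \<xi> \<eta>
      by (rule ell2_eqI) (subst plus_ell2.rep_eq, simp only: ap, simp add: plus_ell2.rep_eq distrib_left)
    show "?f (c *\<^sub>R \<xi>) = c *\<^sub>R ?f \<xi>" for c \<xi>
      by (rule ell2_eqI) (subst scaleR_ell2.rep_eq, simp only: ap, simp add: scaleR_ell2.rep_eq)
  qed
  have wc: "blinfun_apply (weighted_comp \<phi> \<tau>) = ?f"
    unfolding weighted_comp_def by (rule bounded_linear_Blinfun_apply[OF bl])
  show "ell2_apply (weighted_comp \<phi> \<tau> \<xi>) g = \<phi> g * ell2_apply \<xi> (\<tau> g)"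
    by (simp add: wc ap)
  show "norm (weighted_comp \<phi> \<tau>) \<le> B"
    by (rule norm_blinfun_bound[OF B]) (use nrm in \<open>simp add: wc mult.commute\<close>)
qed

lemma ell2_approx_finite:
  assumes "0 < e"
  obtains F where "finite F" "norm (\<xi> - (\<Sum>i\<in>F. scaleC (ell2_apply \<xi> i) (delta i))) < e"
proof -
  let ?q = "\<lambda>i. (cmod (ell2_apply \<xi> i))\<^sup>2"
  have "(sum ?q \<longlongrightarrow> infsum ?q UNIV) (finite_subsets_at_top UNIV)"
    by (rule infsum_tendsto[OF ell2_summable])
  then have "\<forall>\<^sub>F F in finite_subsets_at_top UNIV. dist (sum ?q F) (infsum ?q UNIV) < e\<^sup>2"
    using assms by (intro tendstoD) auto
  then obtain F where F: "finite F" "dist (sum ?q F) (infsum ?q UNIV) < e\<^sup>2"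
    unfolding eventually_finite_subsets_at_top by auto
  let ?t = "\<Sum>i\<in>F. scaleC (ell2_apply \<xi> i) (delta i)"
  have t: "ell2_apply ?t i = (if i \<in> F then ell2_apply \<xi> i else 0)" for i
    using F(1) by (simp add: ell2_apply_sum ell2_apply_simps if_distrib[of "(*) _"] sum.delta cong: if_cong)
  have "(norm (\<xi> - ?t))\<^sup>2 = infsum ?q (UNIV - F)"
    unfolding norm_ell2_sq by (rule infsum_cong_neutral) (auto simp: minus_ell2.rep_eq t)
  also have "\<dots> = infsum ?q UNIV - infsum ?q F"
    by (rule infsum_Diff) (auto simp: ell2_summable)
  also have "\<dots> < e\<^sup>2"
    using F by (simp add: dist_real_def)
  finally have "norm (\<xi> - ?t) < e"
    using assms by (simp add: power2_less_imp_less)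
  then show thesis using that F(1) by blast
qed

text \<open>Finite combinations of deltas are dense and both sides are continuous in \<xi>. Complex
  homogeneity is assumed separately because these operators are only real-linear by type.\<close>

lemma diagonal_operator_apply:
  fixes T :: "'a ell2 \<Rightarrow>\<^sub>L 'a ell2"
  assumes lin: "\<And>c \<xi>. T (scaleC c \<xi>) = scaleC c (T \<xi>)"
    and diag: "\<And>g. ell2_apply (T (delta g)) h = (if g = h then t else 0)"
  shows "ell2_apply (T \<xi>) h = t * ell2_apply \<xi> h"
proof -
  have "cmod (ell2_apply (T \<xi>) h - t * ell2_apply \<xi> h) \<le> (norm T + cmod t) * e" if e: "0 < e" for e
  proof -
    obtain F where F: "finite F" "norm (\<xi> - (\<Sum>i\<in>F. scaleC (ell2_apply \<xi> i) (delta i))) < e"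
      using ell2_approx_finite[OF e] .
    define u where "u = (\<Sum>i\<in>F. scaleC (ell2_apply \<xi> i) (delta i))"
    have "ell2_apply (T u) h = (\<Sum>i\<in>F. ell2_apply \<xi> i * ell2_apply (T (delta i)) h)"
      by (simp add: u_def blinfun.sum_right lin ell2_apply_sum scaleC.rep_eq)
    also have "\<dots> = t * ell2_apply u h"
      by (auto simp: u_def ell2_apply_sum ell2_apply_simps diag sum_distrib_left intro!: sum.cong)
    finally have u: "ell2_apply (T u) h = t * ell2_apply u h" .
    have "ell2_apply (T \<xi>) h - t * ell2_apply \<xi> h = ell2_apply (T (\<xi> - u)) h - t * ell2_apply (\<xi> - u) h"
      by (simp add: blinfun.diff_right minus_ell2.rep_eq u algebra_simps)
    also have "cmod \<dots> \<le> cmod (ell2_apply (T (\<xi> - u)) h) + cmod t * cmod (ell2_apply (\<xi> - u) h)"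
      by (rule order_trans[OF norm_triangle_ineq4]) (simp add: norm_mult)
    also have "\<dots> \<le> norm T * norm (\<xi> - u) + cmod t * norm (\<xi> - u)"
      by (intro add_mono mult_left_mono order_trans[OF cmod_ell2_apply_le norm_blinfun] cmod_ell2_apply_le) simp
    also have "\<dots> \<le> (norm T + cmod t) * e"
      unfolding distrib_right[symmetric] using F(2) by (intro mult_left_mono) (auto simp: u_def)
    finally show ?thesis .
  qed
  note bound = this
  have "cmod (ell2_apply (T \<xi>) h - t * ell2_apply \<xi> h) \<le> 0"
  proof (rule field_le_epsilon)
    fix e :: real assume "0 < e"
    \<comment> \<open>The added 1 keeps the divisor positive when both the operator and
      \<open>t\<close> vanish.\<close>
    define K where "K = norm T + cmod t + 1"
    have "0 < K" unfolding K_def using norm_ge_zero[of T] norm_ge_zero[of t] by linarith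
    have "(norm T + cmod t) * (e / K) \<le> K * (e / K)"
      using \<open>0 < e\<close> \<open>0 < K\<close> by (intro mult_right_mono) (auto simp: K_def)
    then show "cmod (ell2_apply (T \<xi>) h - t * ell2_apply \<xi> h) \<le> 0 + e"
      using bound[of "e / K"] \<open>0 < e\<close> \<open>0 < K\<close> by simp
  qed
  then show ?thesis by simp
qed

lemma cinner_summable: "(\<lambda>i. ell2_apply \<xi> i * cnj (ell2_apply \<eta> i)) summable_on A"
proof (rule abs_summable_summable, rule summable_on_comparison_test)
  show "(\<lambda>i. (cmod (ell2_apply \<xi> i))\<^sup>2 + (cmod (ell2_apply \<eta> i))\<^sup>2) summable_on A"
    by (intro summable_on_add ell2_summable)
  show "norm (ell2_apply \<xi> i * cnj (ell2_apply \<eta> i)) \<le> (cmod (ell2_apply \<xi> i))\<^sup>2 + (cmod (ell2_apply \<eta> i))\<^sup>2" for i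
    using sum_squares_bound[of "cmod (ell2_apply \<xi> i)" "cmod (ell2_apply \<eta> i)"]
      mult_nonneg_nonneg[OF norm_ge_zero[of "ell2_apply \<xi> i"] norm_ge_zero[of "ell2_apply \<eta> i"]]
    unfolding norm_mult complex_mod_cnj by linarith
qed auto

lemma is_cadjoint_add:
  assumes "is_cadjoint S S'" "is_cadjoint T T'"
  shows "is_cadjoint (S + T) (S' + T')"
proof -
  have l: "cinner (\<xi> + \<xi>') \<eta> = cinner \<xi> \<eta> + cinner \<xi>' \<eta>" for \<xi> \<xi>' \<eta> :: "'a ell2"
    unfolding cinner_def plus_ell2.rep_eq distrib_right by (intro infsum_add cinner_summable)
  have r: "cinner \<eta> (\<xi> + \<xi>') = cinner \<eta> \<xi> + cinner \<eta> \<xi>'" for \<xi> \<xi>' \<eta> :: "'a ell2"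
    unfolding cinner_def plus_ell2.rep_eq complex_cnj_add distrib_left by (intro infsum_add cinner_summable)
  show ?thesis
    using assms by (simp add: is_cadjoint_def l r blinfun.add_left)
qed

lemma is_cadjoint_compose:
  "is_cadjoint S S' \<Longrightarrow> is_cadjoint T T' \<Longrightarrow> is_cadjoint (S o\<^sub>L T) (T' o\<^sub>L S')"
  by (simp add: is_cadjoint_def)

text \<open>Reindexing the inner product along the bijection \<sigma> removes \<tau> from the first
  argument and puts its inverse into the second.\<close>

lemma is_cadjoint_weighted_comp:
  fixes \<phi> :: "'a \<Rightarrow> complex"
  assumes inv: "\<And>g. \<sigma> (\<tau> g) = g" "\<And>g. \<tau> (\<sigma> g) = g"
    and bd: "\<And>g. cmod (\<phi> g) \<le> B"
    and \<psi>: "\<And>g. \<psi> g = cnj (\<phi> (\<sigma> g))"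
  shows "is_cadjoint (weighted_comp \<phi> \<tau>) (weighted_comp \<psi> \<sigma>)"
  unfolding is_cadjoint_def
proof (intro allI)
  fix \<xi> \<eta> :: "'a ell2"
  have inj: "inj \<tau>" "inj \<sigma>" using inv by (metis injI)+
  have b: "bij_betw \<sigma> UNIV UNIV"
    by (rule bij_betw_byWitness[where f' = \<tau>]) (auto simp: inv)
  have bd': "cmod (\<psi> g) \<le> B" for g using bd[of "\<sigma> g"] by (simp add: \<psi>)
  have "cinner (weighted_comp \<phi> \<tau> \<xi>) \<eta> = (\<Sum>\<^sub>\<infinity>g. \<phi> g * ell2_apply \<xi> (\<tau> g) * cnj (ell2_apply \<eta> g))"
    by (simp add: cinner_def weighted_comp(1)[OF inj(1) bd])
  also have "\<dots> = (\<Sum>\<^sub>\<infinity>g. \<phi> (\<sigma> g) * ell2_apply \<xi> g * cnj (ell2_apply \<eta> (\<sigma> g)))"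
    using infsum_reindex_bij_betw[OF b, of "\<lambda>g. \<phi> g * ell2_apply \<xi> (\<tau> g) * cnj (ell2_apply \<eta> g)"]
    by (simp add: inv)
  also have "\<dots> = cinner \<xi> (weighted_comp \<psi> \<sigma> \<eta>)"
    by (simp add: cinner_def weighted_comp(1)[OF inj(2) bd'] \<psi> mult_ac)
  finally show "cinner (weighted_comp \<phi> \<tau> \<xi>) \<eta> = cinner \<xi> (weighted_comp \<psi> \<sigma> \<eta>)" .
qed

lemma closure_blinfun_compose:
  fixes A :: "('a::real_normed_vector \<Rightarrow>\<^sub>L 'a) set"
  assumes "\<And>S T. S \<in> A \<Longrightarrow> T \<in> A \<Longrightarrow> S o\<^sub>L T \<in> A" "S \<in> closure A" "T \<in> closure A"
  shows "S o\<^sub>L T \<in> closure A"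
proof -
  obtain Sn Tn where "\<And>n. Sn n \<in> A" "Sn \<longlonglongrightarrow> S" "\<And>n. Tn n \<in> A" "Tn \<longlonglongrightarrow> T"
    using assms(2,3) unfolding closure_sequential by metis
  then show ?thesis
    unfolding closure_sequential
    by (intro exI[of _ "\<lambda>n. Sn n o\<^sub>L Tn n"] conjI allI assms(1)
        bounded_bilinear.tendsto[OF bounded_bilinear_blinfun_compose]) auto
qed

lemma infsum_eq_single:
  fixes f :: "'a \<Rightarrow> 'b::{comm_monoid_add, t2_space}"
  assumes "\<And>j. j \<in> A \<Longrightarrow> j \<noteq> i \<Longrightarrow> f j = 0"
  shows "infsum f A = (if i \<in> A then f i else 0)"
proof -
  have "infsum f A = infsum f (A \<inter> {i})"
    by (rule infsum_cong_neutral) (use assms in auto)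
  then show ?thesis by auto
qed

context row_finite_kgraph
begin

subsection \<open>Continuous functions with compact support\<close>

abbreviation "Cc \<equiv> Cc_groupoid \<Lambda>"

lemma Cc_iff:
  "f \<in> Cc \<longleftrightarrow> continuous_map X euclidean f \<and> (\<exists>K. compactin X K \<and> (\<forall>g. g \<notin> K \<longrightarrow> f g = 0))"
  by (simp add: Cc_groupoid_def)

lemma continuous_map_complex_iff:
  "continuous_map X euclidean (f :: _ \<Rightarrow> complex) \<longleftrightarrow> (\<forall>h\<in>topspace X. (f \<longlongrightarrow> f h) (atin X h))"
  by (simp add: continuous_map_atin)

lemma Cc_add: "f \<in> Cc \<Longrightarrow> f' \<in> Cc \<Longrightarrow> (\<lambda>g. f g + f' g) \<in> Cc"
  unfolding Cc_iff
proof (elim conjE exE, intro conjI)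
  fix K K' assume "compactin X K" "compactin X K'" "\<forall>g. g \<notin> K \<longrightarrow> f g = 0" "\<forall>g. g \<notin> K' \<longrightarrow> f' g = 0"
  then show "\<exists>K. compactin X K \<and> (\<forall>g. g \<notin> K \<longrightarrow> f g + f' g = 0)"
    by (intro exI[of _ "K \<union> K'"]) (simp add: compactin_Un)
qed (simp add: continuous_map_add)

lemma Cc_mult: "f \<in> Cc \<Longrightarrow> f' \<in> Cc \<Longrightarrow> (\<lambda>g. f g * f' g) \<in> Cc"
  unfolding Cc_iff continuous_map_complex_iff by (auto intro!: tendsto_mult)

lemma Cc_scale: "f \<in> Cc \<Longrightarrow> (\<lambda>g. c * f g) \<in> Cc"
  unfolding Cc_iff continuous_map_complex_iff by (auto intro!: tendsto_intros)

lemma Cc_cnj: "f \<in> Cc \<Longrightarrow> (\<lambda>g. cnj (f g)) \<in> Cc"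
  unfolding Cc_iff continuous_map_complex_iff by (auto intro!: tendsto_cnj)

lemma Cc_zero: "(\<lambda>g. 0) \<in> Cc"
  unfolding Cc_iff by (auto intro!: exI[of _ "{}"])

lemma Cc_bounded:
  assumes "f \<in> Cc"
  obtains B where "\<And>g. cmod (f g) \<le> B"
proof -
  obtain K where K: "compactin X K" "\<And>g. g \<notin> K \<Longrightarrow> f g = 0" and c: "continuous_map X euclidean f"
    using assms unfolding Cc_iff by blast
  have "bounded (f ` K)"
    using image_compactin[OF K(1) c] by (simp add: compact_imp_bounded)
  then obtain B where "\<And>g. g \<in> K \<Longrightarrow> cmod (f g) \<le> B" unfolding bounded_iff by blast
  then have "cmod (f g) \<le> max B 0" for g using K(2)[of g] by (cases "g \<in> K") (auto simp: le_max_iff_disj)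
  then show thesis using that by blast
qed

text \<open>Extension by zero from a clopen set preserves continuity; cutting to the units,
  indicators and translates all rest on this.\<close>

lemma openin_vimage_if:
  assumes "openin X C" "openin X (G - C)" "openin X {h \<in> C. f h \<in> W}"
  shows "openin X {h \<in> G. (if h \<in> C then f h else 0) \<in> W}"
proof -
  have "C \<subseteq> G" using assms(1) openin_iff by blast
  then have "{h \<in> G. (if h \<in> C then f h else 0) \<in> W} = {h \<in> C. f h \<in> W} \<union> (if 0 \<in> W then G - C else {})"
    by auto
  then show ?thesis using assms by auto
qed

lemma Cc_restrict:
  assumes f: "f \<in> Cc" and C: "openin X C" "openin X (G - C)"
  shows "(\<lambda>g. if g \<in> C then f g else 0) \<in> Cc"
proof -
  have "C \<subseteq> G" using C(1) openin_iff by blast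
  have "continuous_map X euclidean (\<lambda>g. if g \<in> C then f g else 0)"
    unfolding continuous_map_def topspace_eq
  proof (intro conjI allI impI)
    fix W :: "complex set" assume W: "openin euclidean W"
    have "{h \<in> C. f h \<in> W} = C \<inter> {h \<in> topspace X. f h \<in> W}"
      using \<open>C \<subseteq> G\<close> by (auto simp: topspace_eq)
    then have "openin X {h \<in> C. f h \<in> W}"
      using C(1) f W unfolding Cc_iff by (simp add: continuous_map openin_Int openin_continuous_map_preimage)
    then show "openin X {h \<in> G. (if h \<in> C then f h else 0) \<in> W}"
      by (rule openin_vimage_if[OF C])
  qed simp
  then show ?thesis using f unfolding Cc_iff by auto
qed

lemma indicator_Cc:
  assumes l: "l \<in> M"
  shows "(\<lambda>g. if g \<in> unit_space \<Lambda> \<inter> start l then 1 else 0) \<in> Cc"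
proof -
  let ?C = "unit_space \<Lambda> \<inter> start l"
  have C: "openin X ?C" using open_units open_start by blast
  have "openin X ((G - unit_space \<Lambda>) \<union> (G - start l))" using open_compl_units open_start by blast
  then have C': "openin X (G - ?C)" by (simp add: Diff_Int)
  have "continuous_map X euclidean (\<lambda>g. if g \<in> ?C then 1 else (0::complex))"
    unfolding continuous_map_def topspace_eq
  proof (intro conjI allI impI)
    fix W :: "complex set"
    have "{h \<in> ?C. (1::complex) \<in> W} = (if 1 \<in> W then ?C else {})" by auto
    then have "openin X {h \<in> ?C. (1::complex) \<in> W}" using C by simp
    then show "openin X {h \<in> G. (if h \<in> ?C then 1 else 0) \<in> W}"
      by (rule openin_vimage_if[OF C C'])
  qed simp
  moreover have "compactin X ?C"
    using compact_cylinder[OF l l refl] cylinder_diagonal[OF l] by simp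
  ultimately show ?thesis unfolding Cc_iff by auto
qed

lemma Cc_near:
  assumes f: "f \<in> Cc" and g: "(x, n, y) \<in> G" and e: "0 < e"
  obtains p q where "valid p q (x, n, y)" "\<And>h. h \<in> nbhd p q x y \<Longrightarrow> cmod (f h - f (x, n, y)) < e"
proof -
  let ?U = "{h \<in> topspace X. f h \<in> ball (f (x, n, y)) e}"
  have "openin X ?U"
    using f unfolding Cc_iff by (intro openin_continuous_map_preimage[of X euclidean]) auto
  moreover have "(x, n, y) \<in> ?U" using g e by (simp add: topspace_eq)
  ultimately obtain p q where pq: "valid p q (x, n, y)" "nbhd p q x y \<subseteq> ?U"
    using openin_iff[of ?U] by meson
  have "cmod (f h - f (x, n, y)) < e" if "h \<in> nbhd p q x y" for h
  proof -
    have "f h \<in> ball (f (x, n, y)) e" using pq(2) that by blast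
    then show ?thesis by (simp add: dist_norm norm_minus_commute)
  qed
  then show thesis using that pq(1) by blast
qed

text \<open>The support is covered by finitely many basic sets, and within each the range and the
  fixed prefix y (0, q) determine the arrow. Hence convolution sums are finite.\<close>

lemma Cc_finite_fiber:
  assumes f: "f \<in> Cc"
  shows "finite {h \<in> G. grng h = u \<and> f h \<noteq> 0}"
proof -
  obtain K where K: "compactin X K" "\<And>g. g \<notin> K \<Longrightarrow> f g = 0"
    using f unfolding Cc_iff by blast
  let ?U = "{nbhd p q x y | p q x n y. valid p q (x, n, y)}"
  have "K \<subseteq> \<Union>?U"
  proof
    fix h assume "h \<in> K"
    then have "h \<in> G" using compactin_subset_topspace[OF K(1)] topspace_eq by blast
    obtain x n y where h: "h = (x, n, y)" by (cases h)
    then obtain p q where v: "valid p q (x, n, y)" using \<open>h \<in> G\<close> groupoid_iff by blast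
    have "nbhd p q x y \<in> ?U" using v by blast
    then show "h \<in> \<Union>?U" using nbhd_self[OF v] h by blast
  qed
  moreover have "\<forall>U\<in>?U. openin X U" using open_nbhd by blast
  ultimately obtain \<F> where F: "finite \<F>" "\<F> \<subseteq> ?U" "K \<subseteq> \<Union>\<F>"
    using K(1) unfolding compactin_def by meson
  have fin: "finite {h \<in> U. grng h = u}" if U_in: "U \<in> ?U" for U
  proof -
    obtain p q x y where U: "U = nbhd p q x y" using U_in by blast
    have "h = h'" if "h \<in> U" "h' \<in> U" "grng h = u" "grng h' = u" for h h'
    proof -
      obtain x1 n1 y1 where h: "h = (x1, n1, y1)" by (cases h)
      obtain x2 n2 y2 where h': "h' = (x2, n2, y2)" by (cases h')
      have "x1 = x2" using that h h' by auto
      moreover have v: "valid p q (x1, n1, y1)" "valid p q (x2, n2, y2)" "y1 (0, q) = y2 (0, q)"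
        using that h h' U by (auto simp: mem_nbhd)
      ultimately show ?thesis
        using path_join[of y1 y2 q] h h' by (simp add: valid_iff)
    qed
    note unique = this
    show ?thesis
    proof (cases "{h \<in> U. grng h = u} = {}")
      case False
      then obtain h where "h \<in> U" "grng h = u" by blast
      then have "{h \<in> U. grng h = u} \<subseteq> {h}" using unique by blast
      then show ?thesis using finite_subset by blast
    qed (simp only: finite.emptyI)
  qed
  have "finite (\<Union>U\<in>\<F>. {h \<in> U. grng h = u})"
    by (rule finite_UN_I[OF F(1) fin[OF subsetD[OF F(2)]]])
  moreover have "{h \<in> G. grng h = u \<and> f h \<noteq> 0} \<subseteq> (\<Union>U\<in>\<F>. {h \<in> U. grng h = u})"
  proof
    fix h assume h: "h \<in> {h \<in> G. grng h = u \<and> f h \<noteq> 0}"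
    then have "h \<in> K" using K(2)[of h] by auto
    then show "h \<in> (\<Union>U\<in>\<F>. {h \<in> U. grng h = u})" using F(3) h by auto
  qed
  ultimately show ?thesis using finite_subset by blast
qed

text \<open>This is the indicator of the arrows (x, c, x) with x starting at \<open>w\<close>,
  convolved with \<open>f\<close>: the first factor must be (x, c, x), and its inverse times (x, n,
  y) is (x, n - c, y).\<close>

definition translate :: "'m \<Rightarrow> int^'k \<Rightarrow> (('m, 'k) arrow \<Rightarrow> complex) \<Rightarrow> ('m, 'k) arrow \<Rightarrow> complex" where
  "translate w c f = (\<lambda>(x, n, y). if (x, n, y) \<in> start w then f (x, n - c, y) else 0)"

lemma shift_commute: "shift p (shift q x) = shift q (shift p x)"
  by (simp add: shift_shift add.commute)

text \<open>Under the hypothesis on \<open>w\<close> the triple (x, a - b, x) is itself an arrow,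
  and multiplying by it turns a witness (p, q) into (p + a, q + b).\<close>

lemma start_translate:
  assumes per: "\<And>x. x \<in> P \<Longrightarrow> x (0, 0) = w \<Longrightarrow> shift a x = shift b x" and w: "w \<in> objects \<Lambda>"
    and g: "(x, n, y) \<in> start w"
  shows "(x, n + (int_vec a - int_vec b), y) \<in> start w"
proof -
  obtain p q where v: "valid p q (x, n, y)" using g groupoid_iff by (auto simp: mem_start)
  have x0: "x (0, 0) = w" using g w by (simp add: mem_start object_iff)
  have xy: "x \<in> P" "shift p x = shift q y" using v by (auto simp: valid_iff)
  have "shift (p + a) x = shift p (shift b x)"
    using per[OF xy(1) x0] by (simp flip: shift_shift)
  also have "\<dots> = shift (q + b) y"
    using xy(2) shift_commute[of p b x] shift_commute[of b q y] by (simp flip: shift_shift)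
  finally have "valid (p + a) (q + b) (x, n + (int_vec a - int_vec b), y)"
    using v by (simp add: valid_iff int_vec_add)
  then show ?thesis using g by (simp add: mem_start groupoidI)
qed

text \<open>With a and b exchanged it covers the inverse as well, so translation is a homeomorphism
  of the arrows over \<open>w\<close>. The difficulty is that the tail condition at (p + a, q + b)
  must be brought back to (p, q).\<close>

lemma open_translate:
  assumes per: "\<And>x. x \<in> P \<Longrightarrow> x (0, 0) = w \<Longrightarrow> shift a x = shift b x" and w: "w \<in> objects \<Lambda>"
    and U: "openin X U"
  shows "openin X {(x, n, y). (x, n, y) \<in> start w \<and> (x, n - (int_vec a - int_vec b), y) \<in> U}" (is "openin X ?V")
  unfolding openin_iff
proof (intro conjI allI impI)
  show "?V \<subseteq> G" by (auto simp: start_def)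
next
  fix x n y assume "(x, n, y) \<in> ?V"
  then have g: "(x, n, y) \<in> G" "x (0, 0) = w" "(x, n - (int_vec a - int_vec b), y) \<in> U"
    using w by (auto simp: mem_start object_iff)
  then obtain p q where v: "valid p q (x, n - (int_vec a - int_vec b), y)" "nbhd p q x y \<subseteq> U"
    using U openin_iff by meson
  then have xy: "x \<in> P" "y \<in> P" "shift p x = shift q y" "n = int_vec (p + a) - int_vec (q + b)"
    by (auto simp: valid_iff int_vec_add algebra_simps)
  have "shift (p + a) x = shift p (shift b x)"
    using per[OF xy(1) g(2)] by (simp flip: shift_shift)
  also have "\<dots> = shift (q + b) y"
    using xy(3) shift_commute[of p b x] shift_commute[of b q y] by (simp flip: shift_shift)
  finally have v1: "valid (p + a) (q + b) (x, n, y)"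
    using xy by (simp add: valid_iff)
  \<comment> \<open>The extra b makes the prefixes reach p + b and q + b. As
    \<open>shift a x' = shift b x'\<close>, the tails agree from there on, and the segments before
    that are copied from x and y.\<close>
  have "nbhd (p + a + b) (q + b + b) x y \<subseteq> ?V"
  proof
    fix h assume h: "h \<in> nbhd (p + a + b) (q + b + b) x y"
    obtain x' n' y' where h_eq: "h = (x', n', y')" by (cases h)
    have "h \<in> nbhd (p + a) (q + b) x y" using nbhd_mono[OF v1] h by blast
    then have h': "n' = n" "x' \<in> P" "y' \<in> P" "shift (p + a) x' = shift (q + b) y'"
      using v1 by (auto simp: h_eq mem_nbhd valid_iff)
    have pre: "x' (0, p + a + b) = x (0, p + a + b)" "y' (0, q + b + b) = y (0, q + b + b)"
      using h by (auto simp: h_eq mem_nbhd)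
    have lex: "p \<le> p + a + b" "p + b \<le> p + a + b" by (simp_all add: less_eq_vec_def)
    have ley: "q \<le> q + b + b" "q + b \<le> q + b + b" by (simp_all add: less_eq_vec_def)
    note ex = path_prefix_eq[OF h'(2) xy(1) pre(1)]
    note ey = path_prefix_eq[OF h'(3) xy(2) pre(2)]
    have x0: "x' (0, 0) = w" using ex[of 0 0] g(2) by (simp add: vec_zero_le)
    have "x' (p, p + b) = x (p, p + b)" by (rule ex) (simp_all add: lex vec_le_add)
    also have "\<dots> = y (q, q + b)" using xy(3) by (metis shift_prefix)
    also have "\<dots> = y' (q, q + b)" by (rule ey[symmetric]) (simp_all add: ley vec_le_add)
    finally have seg: "x' (p, p + b) = y' (q, q + b)" .
    have "shift (p + b) x' = shift p (shift b x')" by (simp add: shift_shift)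
    also have "\<dots> = shift p (shift a x')" using per[OF h'(2) x0] by simp
    also have "\<dots> = shift (q + b) y'" using h'(4) by (simp add: shift_shift)
    finally have "shift p x' = shift q y'"
      by (rule shift_join[OF h'(2,3) seg])
    moreover have "x' (0, p) = x (0, p)" "y' (0, q) = y (0, q)"
      using ex[of 0 p] ey[of 0 q] lex ley by (simp_all add: vec_zero_le)
    ultimately have "(x', n - (int_vec a - int_vec b), y') \<in> nbhd p q x y"
      using h'(2,3) v(1) by (simp add: mem_nbhd valid_iff)
    then have "(x', n - (int_vec a - int_vec b), y') \<in> U" using v(2) by blast
    moreover have "(x', n', y') \<in> G" using h h_eq nbhd_subset by blast
    ultimately show "h \<in> ?V"
      using x0 w h'(1) by (simp add: h_eq mem_start object_iff)
  qed
  then show "\<exists>p q. valid p q (x, n, y) \<and> nbhd p q x y \<subseteq> ?V"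
    using valid_add[OF v1] by blast
qed

lemma Cc_translate:
  assumes per: "\<And>x. x \<in> P \<Longrightarrow> x (0, 0) = w \<Longrightarrow> shift a x = shift b x" and w: "w \<in> objects \<Lambda>"
    and f: "f \<in> Cc"
  shows "translate w (int_vec a - int_vec b) f \<in> Cc"
proof -
  define c where "c = int_vec a - int_vec b"
  obtain K where K: "compactin X K" "\<And>g. g \<notin> K \<Longrightarrow> f g = 0" and cont: "continuous_map X euclidean f"
    using f unfolding Cc_iff by blast
  note S = open_start[of w]
  have tr: "translate w c f = (\<lambda>g. if g \<in> start w then (\<lambda>(x, n, y). f (x, n - c, y)) g else 0)"
    by (auto simp: translate_def fun_eq_iff)
  have "continuous_map X euclidean (translate w c f)"
    unfolding continuous_map_def topspace_eq tr
  proof (intro conjI allI impI)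
    fix W :: "complex set" assume W: "openin euclidean W"
    have "openin X {(x, n, y). (x, n, y) \<in> start w \<and> (x, n - (int_vec a - int_vec b), y) \<in> {h \<in> topspace X. f h \<in> W}}"
      by (rule open_translate[OF per w openin_continuous_map_preimage[OF cont W]])
    moreover have "{(x, n, y). (x, n, y) \<in> start w \<and> (x, n - (int_vec a - int_vec b), y) \<in> {h \<in> topspace X. f h \<in> W}}
      = {h \<in> start w. (\<lambda>(x, n, y). f (x, n - c, y)) h \<in> W}"
    proof -
      have "(x, n - c, y) \<in> G" if "(x, n, y) \<in> start w" for x n y
        using start_translate[of w b a x n y] per w that by (simp add: c_def mem_start algebra_simps)
      then show ?thesis by (auto simp: c_def topspace_eq)
    qed
    ultimately have "openin X {h \<in> start w. (\<lambda>(x, n, y). f (x, n - c, y)) h \<in> W}" by simp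
    then show "openin X {h \<in> G. (if h \<in> start w then (\<lambda>(x, n, y). f (x, n - c, y)) h else 0) \<in> W}"
      by (rule openin_vimage_if[OF S])
  qed simp
  moreover have "\<exists>K'. compactin X K' \<and> (\<forall>g. g \<notin> K' \<longrightarrow> translate w c f g = 0)"
  proof (intro exI conjI)
    let ?t = "\<lambda>(x, n, y). (x, n + c, y)"
    have SG: "start w \<subseteq> G" using S(1) openin_iff by blast
    then have "closedin X (start w)" using S(2) by (simp add: closedin_def topspace_eq)
    then have "compactin (subtopology X (start w)) (start w \<inter> K)"
      using K(1) by (simp add: compactin_subtopology closed_Int_compactin)
    moreover have "continuous_map (subtopology X (start w)) X ?t"
      unfolding continuous_map_def
    proof (intro conjI allI impI)
      show "?t \<in> topspace (subtopology X (start w)) \<rightarrow> topspace X"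
        using start_translate[of w a b, OF per w] SG by (auto simp: topspace_eq c_def mem_start)
    next
      fix U assume U: "openin X U"
      have "openin X {(x, n, y). (x, n, y) \<in> start w \<and> (x, n - (int_vec b - int_vec a), y) \<in> U}"
        by (rule open_translate[OF _ w U]) (use per in auto)
      moreover have "{(x, n, y). (x, n, y) \<in> start w \<and> (x, n - (int_vec b - int_vec a), y) \<in> U}
          = {h \<in> topspace (subtopology X (start w)). ?t h \<in> U}"
        using SG by (auto simp: topspace_eq c_def algebra_simps)
      ultimately show "openin (subtopology X (start w)) {h \<in> topspace (subtopology X (start w)). ?t h \<in> U}"
        by (simp add: openin_open_subtopology S) (use SG in \<open>auto simp: topspace_eq\<close>)
    qed
    ultimately show "compactin X (?t ` (start w \<inter> K))" by (rule image_compactin)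
    show "\<forall>g. g \<notin> ?t ` (start w \<inter> K) \<longrightarrow> translate w c f g = 0"
    proof (intro allI impI)
      fix g assume g: "g \<notin> ?t ` (start w \<inter> K)"
      obtain x n y where g_eq: "g = (x, n, y)" by (cases g)
      have "(x, n - c, y) \<notin> K" if "(x, n, y) \<in> start w"
      proof
        assume "(x, n - c, y) \<in> K"
        moreover have "(x, n - c, y) \<in> start w"
          using start_translate[of w b a x n y] per w that by (simp add: c_def algebra_simps)
        ultimately have "?t (x, n - c, y) \<in> ?t ` (start w \<inter> K)" by blast
        then show False using g g_eq by simp
      qed
      then show "translate w c f g = 0" using K(2) by (auto simp: translate_def g_eq)
    qed
  qed
  ultimately show ?thesis unfolding Cc_iff c_def by blast
qed

end

type_synonym ('m, 'k) arrow_op = "('m, 'k) arrow ell2 \<Rightarrow>\<^sub>L ('m, 'k) arrow ell2"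

context row_finite_kgraph
begin

subsection \<open>The reduced algebra\<close>

abbreviation "conv \<equiv> acts_by_convolution \<Lambda>"
abbreviation "A \<equiv> kgraph_cstar \<Lambda>"

lemma conv_apply:
  assumes "conv f T"
  shows "ell2_apply (T \<xi>) g =
    (if g \<in> G then \<Sum>\<^sub>\<infinity>h\<in>{h \<in> G. grng h = grng g}. f h * ell2_apply \<xi> (gmult (ginv h) g) else 0)"
  using assms unfolding acts_by_convolution_def by blast

lemma groupoid_mult:
  assumes "(x, n, y) \<in> G" "(y, m, z) \<in> G"
  shows "(x, n + m, z) \<in> G"
proof -
  obtain p q p' q' where v: "valid p q (x, n, y)" "valid p' q' (y, m, z)"
    using assms groupoid_iff by blast
  have "shift (p' + p) x = shift p' (shift q y)"
    using v by (simp add: valid_iff flip: shift_shift)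
  also have "\<dots> = shift (q + q') z"
    using v shift_commute[of p' q y] by (simp add: valid_iff flip: shift_shift)
  finally have "valid (p' + p) (q + q') (x, n + m, z)"
    using v by (simp add: valid_iff int_vec_add)
  then show ?thesis by (rule groupoidI)
qed

lemma groupoid_inv:
  assumes "(x, n, y) \<in> G"
  shows "(y, - n, x) \<in> G"
proof -
  obtain p q where "valid p q (x, n, y)"
    using assms groupoid_iff by blast
  then have "valid q p (y, - n, x)" by (simp add: valid_iff)
  then show ?thesis by (rule groupoidI)
qed

lemma groupoid_units: "(x, n, y) \<in> G \<Longrightarrow> (x, 0, x) \<in> G" "(x, n, y) \<in> G \<Longrightarrow> (y, 0, y) \<in> G"
  using groupoid_mult[OF _ groupoid_inv] groupoid_mult[OF groupoid_inv] by fastforce+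

text \<open>In the range fibre of x only h = (x, n - l, z) sends (x, n, y) to (z, l, y), so at most
  one term survives.\<close>

lemma conv_delta:
  assumes "conv f T"
  shows "ell2_apply (T (delta (z, l, y'))) (x, n, y) =
    (if (x, n, y) \<in> G \<and> y = y' \<and> (x, n - l, z) \<in> G then f (x, n - l, z) else 0)"
proof (cases "(x, n, y) \<in> G")
  case True
  let ?A = "{h \<in> G. grng h = grng (x, n, y)}"
  let ?i = "(x, n - l, z)"
  have "ell2_apply (T (delta (z, l, y'))) (x, n, y) =
      (\<Sum>\<^sub>\<infinity>h\<in>?A. f h * ell2_apply (delta (z, l, y')) (gmult (ginv h) (x, n, y)))"
    by (simp only: conv_apply[OF assms] True if_True)
  also have "\<dots> = (if ?i \<in> ?A then f ?i * ell2_apply (delta (z, l, y')) (gmult (ginv ?i) (x, n, y)) else 0)"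
    by (rule infsum_eq_single) (auto simp: delta.rep_eq)
  finally show ?thesis using True by (auto simp: delta.rep_eq)
qed (simp add: conv_apply[OF assms])

lemma conv_as_function:
  assumes "conv f T" "g \<in> G"
  shows "as_function T g = f g"
proof -
  obtain x n y where g: "g = (x, n, y)" by (cases g)
  show ?thesis
    using assms(2) unfolding as_function_def g gsrc.simps conv_delta[OF assms(1)] by simp
qed

lemma conv_in_A: "f \<in> Cc \<Longrightarrow> conv f T \<Longrightarrow> T \<in> A"
  unfolding kgraph_cstar_def by (rule subsetD[OF closure_subset]) auto

lemma A_closed_induct:
  assumes "T \<in> A" "closed {T :: ('m, 'k) arrow_op. Q T}" "\<And>f T. f \<in> Cc \<Longrightarrow> conv f T \<Longrightarrow> Q T"
  shows "Q T"
proof -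
  have "{T. \<exists>f\<in>Cc. conv f T} \<subseteq> {T. Q T}" using assms(3) by blast
  then have "A \<subseteq> {T. Q T}" unfolding kgraph_cstar_def by (rule closure_minimal[OF _ assms(2)])
  then show ?thesis using assms(1) by blast
qed

lemma A_approx:
  assumes "T \<in> A" "0 < e"
  obtains f S where "f \<in> Cc" "conv f S" "norm (S - T) < e"
proof -
  obtain S where "S \<in> {T. \<exists>f\<in>Cc. conv f T}" "dist S T < e"
    using assms unfolding kgraph_cstar_def closure_approachable by meson
  then show thesis using that by (auto simp: dist_norm)
qed

lemma continuous_matrix_coefficient:
  fixes \<xi> :: "('m, 'k) arrow ell2"
  shows "continuous_on UNIV (\<lambda>T::('m, 'k) arrow_op. ell2_apply (T \<xi>) g)"
  unfolding continuous_on_def by (intro ballI tendsto_ell2_apply tendsto_ident_at)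

lemma continuous_on_if_const:
  "continuous_on S u \<Longrightarrow> continuous_on S v \<Longrightarrow> continuous_on S (\<lambda>x. if c then u x else v x)"
  by (cases c) auto

text \<open>Once f is replaced by \<open>as_function T\<close>, the formula of
  \<open>conv_delta\<close> mentions T alone and survives limits. Together with
  \<open>A_scaleC\<close> it allows T to be recovered from its function on the groupoid.\<close>

lemma A_matrix:
  fixes T :: "('m, 'k) arrow_op"
  assumes "T \<in> A"
  shows "ell2_apply (blinfun_apply T (delta (z, l, y'))) (x, n, y) =
    (if (x, n, y) \<in> G \<and> y = y' \<and> (x, n - l, z) \<in> G then as_function T (x, n - l, z) else 0)"
  using assms
proof (rule A_closed_induct)
  show "closed {T :: ('m, 'k) arrow_op. ell2_apply (blinfun_apply T (delta (z, l, y'))) (x, n, y) =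
      (if (x, n, y) \<in> G \<and> y = y' \<and> (x, n - l, z) \<in> G then as_function T (x, n - l, z) else 0)}"
    unfolding as_function_def
    by (intro closed_Collect_eq continuous_on_if_const continuous_matrix_coefficient continuous_on_const)
  show "ell2_apply (blinfun_apply T (delta (z, l, y'))) (x, n, y) =
      (if (x, n, y) \<in> G \<and> y = y' \<and> (x, n - l, z) \<in> G then as_function T (x, n - l, z) else 0)"
    if "conv f T" for f T
    unfolding conv_delta[OF that] using conv_as_function[OF that] by auto
qed

lemma A_scaleC:
  assumes "T \<in> A"
  shows "T (scaleC c \<xi>) = scaleC c (T \<xi>)"
proof (rule ell2_eqI)
  fix g
  have "ell2_apply (T (scaleC c \<xi>)) g = c * ell2_apply (T \<xi>) g"
    using assms
  proof (rule A_closed_induct)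
    show "closed {T :: ('m, 'k) arrow_op. ell2_apply (T (scaleC c \<xi>)) g = c * ell2_apply (T \<xi>) g}"
      by (intro closed_Collect_eq continuous_on_mult_left continuous_matrix_coefficient)
    show "ell2_apply (T (scaleC c \<xi>)) g = c * ell2_apply (T \<xi>) g" if "conv f T" for f T
      unfolding conv_apply[OF that] scaleC.rep_eq mult.left_commute[of _ c]
      by (simp add: infsum_cmult_right')
  qed
  then show "ell2_apply (T (scaleC c \<xi>)) g = ell2_apply (scaleC c (T \<xi>)) g"
    by (simp add: scaleC.rep_eq)
qed

lemma closed_A: "closed A"
  by (simp add: kgraph_cstar_def)

text \<open>Left multiplication by a fixed operator is continuous and \<open>A\<close> is closed.
  Scalars and translations are both treated this way.\<close>

lemma A_compose_left:
  assumes "T \<in> A" "\<And>f T. f \<in> Cc \<Longrightarrow> conv f T \<Longrightarrow> V o\<^sub>L T \<in> A"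
  shows "V o\<^sub>L T \<in> A"
  using assms(1)
proof (rule A_closed_induct)
  have "continuous_on UNIV (\<lambda>T. V o\<^sub>L T)"
    by (intro continuous_intros bounded_bilinear.continuous_on[OF bounded_bilinear_blinfun_compose])
  then show "closed {T :: ('m, 'k) arrow_op. V o\<^sub>L T \<in> A}"
    using closed_vimage[OF closed_A, of "\<lambda>T. V o\<^sub>L T"] by (simp add: vimage_def)
qed (rule assms(2))

lemma conv_summable:
  assumes "f \<in> Cc"
  shows "(\<lambda>h. f h * c h) summable_on {h \<in> G. grng h = u}"
proof -
  let ?F = "{h \<in> G. grng h = u \<and> f h \<noteq> 0}"
  have "(\<lambda>h. f h * c h) summable_on {h \<in> G. grng h = u} \<longleftrightarrow> (\<lambda>h. f h * c h) summable_on ?F"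
    by (rule summable_on_cong_neutral) auto
  then show ?thesis using Cc_finite_fiber[OF assms, of u] by simp
qed

lemma conv_add:
  assumes "f \<in> Cc" "f' \<in> Cc" "conv f S" "conv f' T"
  shows "conv (\<lambda>g. f g + f' g) (S + T)"
  unfolding acts_by_convolution_def
  by (auto simp: blinfun.add_left plus_ell2.rep_eq conv_apply[OF assms(3)] conv_apply[OF assms(4)]
      distrib_right intro!: infsum_add[symmetric] conv_summable assms)

lemma A_add:
  assumes "S \<in> A" "T \<in> A"
  shows "S + T \<in> A"
proof -
  obtain Sn Tn where *: "\<And>n. \<exists>f\<in>Cc. conv f (Sn n)" "Sn \<longlonglongrightarrow> S" "\<And>n. \<exists>f\<in>Cc. conv f (Tn n)" "Tn \<longlonglongrightarrow> T"
    using assms unfolding kgraph_cstar_def closure_sequential by auto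
  have "\<exists>f\<in>Cc. conv f (Sn n + Tn n)" for n
    using *(1)[of n] *(3)[of n] conv_add Cc_add by blast
  then show ?thesis
    unfolding kgraph_cstar_def closure_sequential
    using tendsto_add[OF *(2,4)] by (intro exI[of _ "\<lambda>n. Sn n + Tn n"]) auto
qed

lemma zero_in_A: "0 \<in> A"
  by (rule conv_in_A[OF Cc_zero]) (simp add: acts_by_convolution_def zero_ell2.rep_eq)

lemma A_scale:
  assumes "T \<in> A"
  shows "scaleC_op c T \<in> A"
proof -
  define V where "V = (Blinfun (scaleC c) :: ('m, 'k) arrow_op)"
  have V: "V \<xi> = scaleC c \<xi>" for \<xi>
    by (simp add: V_def bounded_linear_Blinfun_apply bounded_linear_scaleC)
  have op: "scaleC_op c T = V o\<^sub>L T" for T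
    by (rule blinfun_eqI) (simp add: scaleC_op_apply V)
  have "V o\<^sub>L T \<in> A"
    using assms
  proof (rule A_compose_left)
    fix f T assume f: "f \<in> Cc" "conv f T"
    have "conv (\<lambda>g. c * f g) (V o\<^sub>L T)"
      unfolding acts_by_convolution_def
      by (simp add: V scaleC.rep_eq conv_apply[OF f(2)] mult.assoc infsum_cmult_right')
    then show "V o\<^sub>L T \<in> A" using conv_in_A Cc_scale[OF f(1)] by blast
  qed
  then show ?thesis by (simp add: op)
qed

lemma as_function_diff_le: "cmod (as_function S g - as_function T g) \<le> norm (S - T)"
  using cmod_blinfun_ell2_le[of "S - T" "gsrc g" g]
  by (simp add: as_function_def blinfun.diff_left minus_ell2.rep_eq)

lemma as_function_le: "cmod (as_function T g) \<le> norm T"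
  using as_function_diff_le[of T g 0] by (simp add: as_function_def zero_ell2.rep_eq)

subsection \<open>The diagonal\<close>

abbreviation "D \<equiv> diagonal \<Lambda>"

text \<open>Convolution by a function on the units multiplies by its value at the range, so only the
  values of \<open>f\<close> on units count. The cutoff makes the operator vanish off the groupoid,
  as the regular representation does.\<close>

definition mult_op :: "(('m, 'k) arrow \<Rightarrow> complex) \<Rightarrow> ('m, 'k) arrow_op" where
  "mult_op f = weighted_comp (\<lambda>g. if g \<in> G then f (grng g) else 0) id"

lemma mem_units: "(x, n, y) \<in> unit_space \<Lambda> \<longleftrightarrow> (x, n, y) \<in> G \<and> n = 0 \<and> y = x"
proof -
  have "unit_space \<Lambda> \<subseteq> G" using open_units openin_iff by blast
  moreover have "x \<in> P" if "(x, n, y) \<in> G" using that by (auto simp: groupoid_iff valid_iff)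
  ultimately show ?thesis by (auto simp: unit_space_def)
qed

lemma grng_unit: "g \<in> G \<Longrightarrow> grng g \<in> unit_space \<Lambda>" "g \<in> G \<Longrightarrow> grng g \<in> G"
  using groupoid_units(1) by (cases g; simp add: mem_units)+

lemma mult_op:
  assumes "\<And>u. u \<in> unit_space \<Lambda> \<Longrightarrow> cmod (f u) \<le> B"
  shows "ell2_apply (mult_op f \<xi>) g = (if g \<in> G then f (grng g) else 0) * ell2_apply \<xi> g"
    and "0 \<le> B \<Longrightarrow> norm (mult_op f) \<le> B"
proof -
  \<comment> \<open>\<open>B\<close> may be negative when there are no units, while the weight is 0
    off the groupoid.\<close>
  have le: "cmod (if h \<in> G then f (grng h) else 0) \<le> max B 0" for h
    using assms[OF grng_unit(1), of h] by (auto simp: le_max_iff_disj)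
  note * = weighted_comp[of id "\<lambda>h. if h \<in> G then f (grng h) else 0", OF _ le]
  show "ell2_apply (mult_op f \<xi>) g = (if g \<in> G then f (grng g) else 0) * ell2_apply \<xi> g"
    "0 \<le> B \<Longrightarrow> norm (mult_op f) \<le> B"
    unfolding mult_op_def using * by simp_all
qed

lemma mult_op_apply:
  assumes "\<And>g. cmod (f g) \<le> B"
  shows "ell2_apply (mult_op f \<xi>) g = (if g \<in> G then f (grng g) else 0) * ell2_apply \<xi> g"
  using mult_op(1)[of f B] assms by blast

lemma norm_mult_op_diff_le:
  assumes f: "\<And>g. cmod (f g) \<le> B" and f': "\<And>g. cmod (f' g) \<le> B'"
    and le: "\<And>u. u \<in> unit_space \<Lambda> \<Longrightarrow> cmod (f u - f' u) \<le> e" and e: "0 \<le> e"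
  shows "norm (mult_op f - mult_op f') \<le> e"
proof -
  have "mult_op f - mult_op f' = mult_op (\<lambda>g. f g - f' g)"
    by (rule ell2_blinfun_eqI)
      (simp add: blinfun.diff_left minus_ell2.rep_eq mult_op_apply[OF f] mult_op_apply[OF f']
        mult_op(1)[of "\<lambda>g. f g - f' g", OF le] left_diff_distrib)
  then show ?thesis using mult_op(2)[of "\<lambda>g. f g - f' g", OF le e] by simp
qed

text \<open>The compactly supported continuous functions on the path space, extended by zero; their
  multiplication operators will be dense in the diagonal.\<close>

definition C_units :: "(('m, 'k) arrow \<Rightarrow> complex) set" where
  "C_units = {f \<in> Cc. \<forall>g. g \<notin> unit_space \<Lambda> \<longrightarrow> f g = 0}"

lemma conv_mult_op:
  assumes "f \<in> C_units"
  shows "conv f (mult_op f)"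
  unfolding acts_by_convolution_def
proof (intro allI)
  fix \<xi> g
  have f: "f \<in> Cc" "\<And>g. g \<notin> unit_space \<Lambda> \<Longrightarrow> f g = 0" using assms by (auto simp: C_units_def)
  obtain B where B: "\<And>g. cmod (f g) \<le> B" using Cc_bounded[OF f(1)] by blast
  show "ell2_apply (mult_op f \<xi>) g = (if g \<in> G
         then \<Sum>\<^sub>\<infinity>h\<in>{h \<in> G. grng h = grng g}. f h * ell2_apply \<xi> (gmult (ginv h) g) else 0)"
  proof (cases "g \<in> G")
    case True
    obtain x n y where g: "g = (x, n, y)" by (cases g)
    have "(\<Sum>\<^sub>\<infinity>h\<in>{h \<in> G. grng h = grng g}. f h * ell2_apply \<xi> (gmult (ginv h) g)) =
      (if grng g \<in> {h \<in> G. grng h = grng g} then f (grng g) * ell2_apply \<xi> (gmult (ginv (grng g)) g) else 0)"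
      by (rule infsum_eq_single) (auto simp: g mem_units intro!: f(2))
    also have "\<dots> = f (grng g) * ell2_apply \<xi> g"
      using grng_unit(2)[OF True] by (simp add: g)
    finally show ?thesis using True by (simp add: mult_op_apply[OF B])
  qed (simp add: mult_op_apply[OF B])
qed

lemma mult_op_in_D:
  assumes "f \<in> C_units"
  shows "mult_op f \<in> D"
  unfolding diagonal_def
  using assms conv_mult_op[OF assms] conv_in_A conv_as_function[OF conv_mult_op[OF assms]]
  by (auto simp: C_units_def)

text \<open>The coefficient of T between distinct arrows is 0 or the value of
  \<open>as_function T\<close> at a non-unit, which is 0 too, so T is diagonal in the basis of
  deltas. Commutativity and adjoints in the diagonal rest on this.\<close>

lemma D_eq_mult_op:
  assumes T: "T \<in> D"
  shows "T = mult_op (as_function T)"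
proof (rule ell2_blinfun_eqI)
  fix \<xi> and h :: "('m, 'k) arrow"
  have TA: "T \<in> A" and off: "\<And>g. g \<in> G \<Longrightarrow> g \<notin> unit_space \<Lambda> \<Longrightarrow> as_function T g = 0"
    using T by (auto simp: diagonal_def)
  obtain x n y where h: "h = (x, n, y)" by (cases h)
  have "ell2_apply (T \<xi>) h = (if h \<in> G then as_function T (grng h) else 0) * ell2_apply \<xi> h"
  proof (rule diagonal_operator_apply)
    fix g :: "('m, 'k) arrow"
    obtain z l y' where g: "g = (z, l, y')" by (cases g)
    have "as_function T (x, n - l, z) = 0" if "(x, n - l, z) \<in> G" "n \<noteq> l \<or> x \<noteq> z"
      using off[OF that(1)] that by (auto simp: mem_units)
    then show "ell2_apply (T (delta g)) h = (if g = h then if h \<in> G then as_function T (grng h) else 0 else 0)"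
      using groupoid_units(1) unfolding h g A_matrix[OF TA] by auto
  qed (rule A_scaleC[OF TA])
  then show "ell2_apply (T \<xi>) h = ell2_apply (mult_op (as_function T) \<xi>) h"
    by (simp add: mult_op_apply[OF as_function_le])
qed

text \<open>Cutting an approximating function down to the clopen unit space keeps it in
  \<open>Cc\<close> and preserves its values on units: the conditional expectation at the level of
  functions.\<close>

lemma D_approx:
  assumes T: "T \<in> D" and e: "0 < e"
  obtains f where "f \<in> C_units" "\<And>u. u \<in> unit_space \<Lambda> \<Longrightarrow> cmod (f u - as_function T u) < e"
proof -
  have TA: "T \<in> A" using T by (simp add: diagonal_def)
  obtain f S where f: "f \<in> Cc" "conv f S" "norm (S - T) < e" using A_approx[OF TA e] .
  let ?f = "\<lambda>g. if g \<in> unit_space \<Lambda> then f g else 0"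
  have "?f \<in> C_units"
    using Cc_restrict[OF f(1) open_units open_compl_units] by (simp add: C_units_def)
  moreover have "cmod (?f u - as_function T u) < e" if u: "u \<in> unit_space \<Lambda>" for u
  proof -
    have "u \<in> G" using u open_units openin_iff by blast
    then have "as_function S u = f u" by (rule conv_as_function[OF f(2)])
    then show ?thesis using as_function_diff_le[of S u T] f(3) u by simp
  qed
  ultimately show thesis using that by blast
qed

lemma C_units_bounded:
  assumes "f \<in> C_units"
  obtains B where "\<And>g. cmod (f g) \<le> B"
  using assms Cc_bounded unfolding C_units_def by blast

text \<open>The norm of a multiplication operator is controlled by its values on units, so uniform
  approximation there is norm approximation. Products and adjoints can then be formed with functions
  in \<open>C_units\<close>.\<close>

lemma D_eq_closure: "D = closure (mult_op ` C_units)"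
proof
  show "D \<subseteq> closure (mult_op ` C_units)"
  proof
    fix T assume T: "T \<in> D"
    have "\<exists>S\<in>mult_op ` C_units. dist S T < e" if e: "0 < e" for e
    proof -
      obtain f where f: "f \<in> C_units" "\<And>u. u \<in> unit_space \<Lambda> \<Longrightarrow> cmod (f u - as_function T u) < e / 2"
        using D_approx[OF T, of "e / 2"] e by auto
      obtain B where B: "\<And>g. cmod (f g) \<le> B" using C_units_bounded[OF f(1)] by blast
      have "norm (mult_op f - mult_op (as_function T)) \<le> e / 2"
        by (rule norm_mult_op_diff_le[OF B as_function_le]) (use f(2) e in \<open>auto intro: less_imp_le\<close>)
      then show ?thesis using f(1) e D_eq_mult_op[OF T] by (auto simp: dist_norm intro!: bexI[of _ f])
    qed
    then show "T \<in> closure (mult_op ` C_units)" unfolding closure_approachable by blast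
  qed
  have "closed {T :: ('m, 'k) arrow_op. as_function T g = 0}" for g
    unfolding as_function_def by (intro closed_Collect_eq continuous_matrix_coefficient continuous_on_const)
  then have "closed (A \<inter> (\<Inter>g\<in>G - unit_space \<Lambda>. {T. as_function T g = 0}))"
    using closed_A by (intro closed_Int closed_INT) auto
  moreover have "D = A \<inter> (\<Inter>g\<in>G - unit_space \<Lambda>. {T. as_function T g = 0})"
    by (auto simp: diagonal_def)
  ultimately show "closure (mult_op ` C_units) \<subseteq> D"
    using mult_op_in_D by (intro closure_minimal) auto
qed

lemma mult_op_commute:
  assumes "\<And>g. cmod (f g) \<le> B" "\<And>g. cmod (f' g) \<le> B'"
  shows "mult_op f o\<^sub>L mult_op f' = mult_op f' o\<^sub>L mult_op f"
  by (rule ell2_blinfun_eqI) (simp add: mult_op_apply[OF assms(1)] mult_op_apply[OF assms(2)])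

lemma D_abelian: "abelian D"
  unfolding abelian_def
proof (intro ballI)
  fix S T assume "S \<in> D" "T \<in> D"
  then show "S o\<^sub>L T = T o\<^sub>L S"
    using mult_op_commute[of "as_function S" "norm S" "as_function T" "norm T"]
    by (simp only: as_function_le D_eq_mult_op[symmetric] simp_thms)
qed

lemma D_star_subalgebra: "star_subalgebra D"
  unfolding star_subalgebra_def
proof (intro conjI ballI allI)
  show "0 \<in> D" using zero_in_A by (simp add: diagonal_def as_function_def zero_ell2.rep_eq)
next
  fix S T assume "S \<in> D" "T \<in> D"
  then show "S + T \<in> D"
    using A_add by (simp add: diagonal_def as_function_def blinfun.add_left plus_ell2.rep_eq)
next
  fix c T assume "T \<in> D"
  then show "scaleC_op c T \<in> D"
    using A_scale by (simp add: diagonal_def as_function_def scaleC_op_apply scaleC.rep_eq)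
next
  fix S T assume ST: "S \<in> D" "T \<in> D"
  show "S o\<^sub>L T \<in> D"
    unfolding D_eq_closure
  proof (rule closure_blinfun_compose)
    fix S T assume "S \<in> mult_op ` C_units" "T \<in> mult_op ` C_units"
    then obtain f f' where f: "f \<in> C_units" "S = mult_op f" and f': "f' \<in> C_units" "T = mult_op f'"
      by blast
    have ff: "(\<lambda>g. f g * f' g) \<in> C_units" using f f' Cc_mult by (simp add: C_units_def)
    obtain B where B: "\<And>g. cmod (f g) \<le> B" using C_units_bounded[OF f(1)] by blast
    obtain B' where B': "\<And>g. cmod (f' g) \<le> B'" using C_units_bounded[OF f'(1)] by blast
    obtain B'' where B'': "\<And>g. cmod (f g * f' g) \<le> B''" using C_units_bounded[OF ff] by blast
    have "S o\<^sub>L T = mult_op (\<lambda>g. f g * f' g)"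
      by (rule ell2_blinfun_eqI)
        (simp add: f f' mult_op_apply[OF B] mult_op_apply[OF B'] mult_op_apply[of "\<lambda>g. f g * f' g", OF B''])
    then show "S o\<^sub>L T \<in> mult_op ` C_units" using ff by blast
  qed (use ST D_eq_closure in auto)
next
  fix T assume T: "T \<in> D"
  let ?t = "as_function T"
  let ?S = "mult_op (\<lambda>g. cnj (?t g))"
  have cnj_le: "cmod (cnj (?t g)) \<le> norm T" for g by (simp add: as_function_le)
  \<comment> \<open>The candidate adjoint multiplies by the conjugate function; conjugating
    approximants of T places it in the diagonal.\<close>
  have "\<exists>S\<in>mult_op ` C_units. dist S ?S < e" if e: "0 < e" for e
  proof -
    obtain f where f: "f \<in> C_units" "\<And>u. u \<in> unit_space \<Lambda> \<Longrightarrow> cmod (f u - as_function T u) < e / 2"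
      using D_approx[OF T, of "e / 2"] e by auto
    have f': "(\<lambda>g. cnj (f g)) \<in> C_units" using f Cc_cnj by (simp add: C_units_def)
    obtain B where B: "\<And>g. cmod (cnj (f g)) \<le> B" using C_units_bounded[OF f'] by blast
    have le: "cmod (cnj (f u) - cnj (?t u)) \<le> e / 2" if "u \<in> unit_space \<Lambda>" for u
      using f(2)[OF that] by (simp flip: complex_cnj_diff)
    have "norm (mult_op (\<lambda>g. cnj (f g)) - ?S) \<le> e / 2"
      by (rule norm_mult_op_diff_le[OF B cnj_le le]) (use e in auto)
    then show ?thesis using f' e by (auto simp: dist_norm intro!: bexI[of _ "\<lambda>g. cnj (f g)"])
  qed
  then have "?S \<in> D" unfolding D_eq_closure closure_approachable by blast
  moreover have "is_cadjoint (mult_op ?t) ?S"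
    unfolding mult_op_def
    by (rule is_cadjoint_weighted_comp[where B = "norm T"]) (auto simp: as_function_le)
  ultimately show "\<exists>S\<in>D. is_cadjoint T S"
    using D_eq_mult_op[OF T] by auto
qed

end

section \<open>Adjoining a commuting self-adjoint operator\<close>

lemma blinfun_compose_add:
  "(S + T) o\<^sub>L U = (S o\<^sub>L U) + (T o\<^sub>L U)" "U o\<^sub>L (S + T) = (U o\<^sub>L S) + (U o\<^sub>L T)"
  by (rule blinfun_eqI; simp add: blinfun.add_left blinfun.add_right)+

lemma blinfun_compose_assoc_right: "(S o\<^sub>L T) o\<^sub>L U = S o\<^sub>L (T o\<^sub>L U)"
  by (rule blinfun_eqI) simp

text \<open>Polynomials in \<open>V\<close> with coefficients in \<open>D\<close>: Horner form makes products need only left multiplication by \<open>V\<close>.\<close>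

inductive_set horner_polys :: "('a ell2 \<Rightarrow>\<^sub>L 'a ell2) set \<Rightarrow> ('a ell2 \<Rightarrow>\<^sub>L 'a ell2) \<Rightarrow> ('a ell2 \<Rightarrow>\<^sub>L 'a ell2) set"
  for D :: "('a ell2 \<Rightarrow>\<^sub>L 'a ell2) set" and V :: "'a ell2 \<Rightarrow>\<^sub>L 'a ell2" where
  const: "E \<in> D \<Longrightarrow> E \<in> horner_polys D V"
| step: "E \<in> D \<Longrightarrow> X \<in> horner_polys D V \<Longrightarrow> E + (V o\<^sub>L X) \<in> horner_polys D V"

text \<open>Coefficients move past \<open>V\<close>, so products return to Horner form, and
  self-adjointness of \<open>V\<close> does the same for adjoints. Commutativity is obtained in
  stages: first \<open>V\<close>, then each coefficient, commutes with every polynomial.\<close>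

lemma horner_polys_abelian_star_subalgebra:
  fixes D :: "('a ell2 \<Rightarrow>\<^sub>L 'a ell2) set"
  assumes D: "star_subalgebra D" "abelian D"
    and VD: "\<And>T. T \<in> D \<Longrightarrow> V o\<^sub>L T = T o\<^sub>L V"
    and adj: "is_cadjoint V V"
    and lin: "\<And>c \<xi>. V (scaleC c \<xi>) = scaleC c (V \<xi>)"
  shows "star_subalgebra (horner_polys D V)" "abelian (horner_polys D V)"
proof -
  let ?B = "horner_polys D V"
  have D0: "0 \<in> D" and Dadd: "\<And>S T. S \<in> D \<Longrightarrow> T \<in> D \<Longrightarrow> S + T \<in> D"
    and Dscale: "\<And>c T. T \<in> D \<Longrightarrow> scaleC_op c T \<in> D"
    and Dmult: "\<And>S T. S \<in> D \<Longrightarrow> T \<in> D \<Longrightarrow> S o\<^sub>L T \<in> D"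
    and Dadj: "\<And>T. T \<in> D \<Longrightarrow> \<exists>S\<in>D. is_cadjoint T S"
    using D(1) unfolding star_subalgebra_def by blast+
  have Dcomm: "S o\<^sub>L T = T o\<^sub>L S" if "S \<in> D" "T \<in> D" for S T
    using D(2) that unfolding abelian_def by blast
  have add: "S + T \<in> ?B" if "S \<in> ?B" "T \<in> ?B" for S T
    using that
  proof (induction arbitrary: T)
    case (const E)
    from const(2) show ?case
    proof cases
      case const
      then show ?thesis using \<open>E \<in> D\<close> by (intro horner_polys.const Dadd)
    next
      case (step E' X')
      then show ?thesis
        using horner_polys.step[OF Dadd[OF \<open>E \<in> D\<close> step(2)] step(3)] by (simp add: add.assoc)
    qed
  next
    case (step E X)
    from step.prems show ?case
    proof cases
      case const
      then show ?thesis
        using horner_polys.step[OF Dadd[OF step.hyps(1) const] step.hyps(2)] by (simp add: ac_simps)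
    next
      case (step E' X')
      then show ?thesis
        using horner_polys.step[OF Dadd[OF \<open>E \<in> D\<close> step(2)] step.IH[OF step(3)]]
        by (simp add: blinfun_compose_add ac_simps)
    qed
  qed
  have Vmult: "V o\<^sub>L S \<in> ?B" if "S \<in> ?B" for S
    using horner_polys.step[OF D0 that] by simp
  have Emult: "E o\<^sub>L S \<in> ?B" if "S \<in> ?B" "E \<in> D" for E S
    using that(1)
  proof induction
    case (const E')
    then show ?case using Dmult that(2) by (intro horner_polys.const) auto
  next
    case (step E' X)
    have "E o\<^sub>L (E' + (V o\<^sub>L X)) = (E o\<^sub>L E') + (V o\<^sub>L (E o\<^sub>L X))"
      by (simp add: blinfun_compose_add VD[OF that(2)] flip: blinfun_compose_assoc_right)
    then show ?case using horner_polys.step[OF Dmult[OF that(2) step.hyps(1)] step.IH] by simp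
  qed
  have mult: "S o\<^sub>L T \<in> ?B" if "S \<in> ?B" "T \<in> ?B" for S T
    using that(1)
  proof induction
    case (const E)
    then show ?case using Emult that(2) by blast
  next
    case (step E X)
    then show ?case
      using add[OF Emult[OF that(2) step.hyps(1)] Vmult[OF step.IH]]
      by (simp add: blinfun_compose_add blinfun_compose_assoc_right)
  qed
  have Vcomm: "V o\<^sub>L S = S o\<^sub>L V" if "S \<in> ?B" for S
    using that
  proof induction
    case (step E X)
    show ?case
      by (simp only: blinfun_compose_add VD[OF step.hyps(1)] blinfun_compose_assoc_right step.IH[symmetric])
  qed (rule VD)
  have Ecomm: "E o\<^sub>L S = S o\<^sub>L E" if "S \<in> ?B" "E \<in> D" for E S
    using that(1)
  proof induction
    case (step E' X)
    have "E o\<^sub>L (V o\<^sub>L X) = V o\<^sub>L (E o\<^sub>L X)"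
      by (simp add: VD[OF that(2)] flip: blinfun_compose_assoc_right)
    then show ?case
      by (simp add: blinfun_compose_add Dcomm[OF that(2) step.hyps(1)] step.IH blinfun_compose_assoc_right)
  qed (use Dcomm that in auto)
  have comm: "S o\<^sub>L T = T o\<^sub>L S" if "S \<in> ?B" "T \<in> ?B" for S T
    using that(1)
  proof induction
    case (const E)
    then show ?case using Ecomm[OF that(2)] by blast
  next
    case (step E X)
    have "V o\<^sub>L (T o\<^sub>L X) = T o\<^sub>L (V o\<^sub>L X)"
      by (simp add: Vcomm[OF that(2)] flip: blinfun_compose_assoc_right)
    then show ?case
      by (simp add: blinfun_compose_add Ecomm[OF that(2) step.hyps(1)] step.IH blinfun_compose_assoc_right)
  qed
  have scale: "scaleC_op c S \<in> ?B" if "S \<in> ?B" for c S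
    using that
  proof induction
    case (const E)
    then show ?case by (intro horner_polys.const Dscale)
  next
    case (step E X)
    have "scaleC c (\<xi> + \<eta>) = scaleC c \<xi> + scaleC c \<eta>" for \<xi> \<eta> :: "'a ell2"
      using bounded_linear.linear[OF bounded_linear_scaleC] by (rule linear_add)
    then have "scaleC_op c (E + (V o\<^sub>L X)) = scaleC_op c E + (V o\<^sub>L scaleC_op c X)"
      by (intro blinfun_eqI) (simp add: scaleC_op_apply blinfun.add_left lin)
    then show ?case using horner_polys.step[OF Dscale[OF step.hyps(1)] step.IH] by simp
  qed
  have adjoint: "\<exists>S'\<in>?B. is_cadjoint S S'" if "S \<in> ?B" for S
    using that
  proof induction
    case (const E)
    then show ?case using Dadj horner_polys.const by blast
  next
    case (step E X)
    obtain E' where E': "E' \<in> D" "is_cadjoint E E'" using Dadj[OF step.hyps(1)] by blast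
    obtain X' where X': "X' \<in> ?B" "is_cadjoint X X'" using step.IH by blast
    \<comment> \<open>The adjoint of V X arrives as X' V; since X' is again a polynomial, it
      commutes with \<open>V\<close>.\<close>
    have "is_cadjoint (E + (V o\<^sub>L X)) (E' + (V o\<^sub>L X'))"
      unfolding Vcomm[OF X'(1)] by (intro is_cadjoint_add is_cadjoint_compose E' X' adj)
    then show ?case using horner_polys.step[OF E'(1) X'(1)] by blast
  qed
  show "star_subalgebra ?B"
    unfolding star_subalgebra_def
    by (intro conjI ballI allI horner_polys.const[OF D0] add scale mult adjoint)
  show "abelian ?B"
    unfolding abelian_def by (intro ballI comm)
qed

context row_finite_kgraph
begin

subsection \<open>Aperiodicity implies maximality\<close>

text \<open>Measured from q on, the equality of the two shifts is invariance under translation by p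
  - q.\<close>

lemma periodic_of_shift_eq:
  fixes x :: "('m, 'k) path"
  assumes eq: "shift p x = shift q x" and ne: "p \<noteq> q"
  shows "periodic (shift q x)"
  unfolding periodic_def has_period_def
proof (intro exI[of _ "int_vec p - int_vec q"] conjI allI impI)
  show "int_vec p - int_vec q \<noteq> 0" using ne int_vec_inj[of p q] by simp
next
  fix m n m' n' :: "nat^'k"
  assume mn: "m \<le> n" and m': "int_vec m' = int_vec m + (int_vec p - int_vec q)"
    and n': "int_vec n' = int_vec n + (int_vec p - int_vec q)"
  have "int_vec (m' + q) = int_vec (m + p)" "int_vec (n' + q) = int_vec (n + p)"
    using m' n' by (simp_all add: int_vec_add)
  then have e: "m' + q = m + p" "n' + q = n + p" by (simp_all only: int_vec_inj)
  have "m' + q \<le> n' + q" unfolding e using mn by (rule vec_add_mono)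
  then have "m' \<le> n'" by (simp add: less_eq_vec_def)
  then have "shift q x (m', n') = x (m + p, n + p)" by (simp add: shift_apply e)
  also have "\<dots> = shift p x (m, n)" using mn by (simp add: shift_apply)
  finally show "shift q x (m', n') = shift q x (m, n)" by (simp add: eq)
qed

lemma mult_op_delta:
  assumes "\<And>g. cmod (f g) \<le> B"
  shows "mult_op f (delta (y, 0, y)) = scaleC (if (y, 0, y) \<in> G then f (y, 0, y) else 0) (delta (y, 0, y))"
  by (rule ell2_eqI) (auto simp: mult_op_apply[OF assms] scaleC.rep_eq delta.rep_eq)

text \<open>A cylinder around x that misses y gives f in \<open>C_units\<close> with value 1 at x
  and 0 at y. At (x, n, y) the product T f carries the factor f(y) and f T the factor f(x), so the
  value of T there vanishes.\<close>

lemma commutant_off_isotropy: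
  assumes T: "T \<in> A" and comm: "\<And>f. f \<in> C_units \<Longrightarrow> T o\<^sub>L mult_op f = mult_op f o\<^sub>L T"
    and g: "(x, n, y) \<in> G" and ne: "as_function T (x, n, y) \<noteq> 0"
  shows "x = y"
proof (rule ccontr)
  assume "x \<noteq> y"
  have xy: "x \<in> P" "y \<in> P" using g by (auto simp: groupoid_iff valid_iff)
  obtain c where c: "x (0, c) \<noteq> y (0, c)" using path_ext[OF xy] \<open>x \<noteq> y\<close> by blast
  define l where "l = x (0, c)"
  have l: "l \<in> M" "d l = c"
    using path_facts[OF xy(1) vec_zero_le] by (simp_all add: l_def vec_diff_simps)
  define f where "f = (\<lambda>g. if g \<in> unit_space \<Lambda> \<inter> start l then 1 else (0::complex))"
  have f: "f \<in> C_units" using indicator_Cc[OF l(1)] by (auto simp: C_units_def f_def)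
  have B: "cmod (f g) \<le> 1" for g by (simp add: f_def)
  have units: "(x, 0, x) \<in> G" "(y, 0, y) \<in> G" using groupoid_units[OF g] by auto
  have fx: "f (x, 0, x) = 1" "f (y, 0, y) = 0"
    using units c l by (auto simp: f_def mem_units mem_start l_def[symmetric])
  have "(T o\<^sub>L mult_op f) (delta (y, 0, y)) = (mult_op f o\<^sub>L T) (delta (y, 0, y))"
    using comm[OF f] by simp
  then have "T (scaleC 0 (delta (y, 0, y))) = mult_op f (T (delta (y, 0, y)))"
    using units by (simp add: mult_op_delta[OF B] fx)
  then have "ell2_apply (scaleC 0 (T (delta (y, 0, y)))) (x, n, y) = ell2_apply (mult_op f (T (delta (y, 0, y)))) (x, n, y)"
    using A_scaleC[OF T, of 0 "delta (y, 0, y)"] by simp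
  then have "as_function T (x, n, y) = 0"
    using g by (simp add: as_function_def scaleC.rep_eq mult_op_apply[OF B] fx)
  then show False using ne by simp
qed

lemma as_function_nonzero_near:
  assumes T: "T \<in> A" and g: "(x, n, y) \<in> G" and ne: "as_function T (x, n, y) \<noteq> 0"
  obtains p q where "valid p q (x, n, y)" "\<And>h. h \<in> nbhd p q x y \<Longrightarrow> as_function T h \<noteq> 0"
proof -
  \<comment> \<open>Three errors below e occur: T against f at two arrows, and the variation of f
    between them. With a third of the modulus their sum stays below it.\<close>
  define e where "e = cmod (as_function T (x, n, y)) / 3"
  have e: "0 < e" using ne by (simp add: e_def)
  obtain f S where f: "f \<in> Cc" "conv f S" "norm (S - T) < e" using A_approx[OF T e] .
  have close: "cmod (f h - as_function T h) < e" if "h \<in> G" for h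
    using as_function_diff_le[of S h T] conv_as_function[OF f(2) that] f(3) by simp
  obtain p q where pq: "valid p q (x, n, y)" "\<And>h. h \<in> nbhd p q x y \<Longrightarrow> cmod (f h - f (x, n, y)) < e"
    using Cc_near[OF f(1) g e] by blast
  have "as_function T h \<noteq> 0" if h: "h \<in> nbhd p q x y" for h
  proof
    assume "as_function T h = 0"
    then have "cmod (f h) < e" using close[of h] subsetD[OF nbhd_subset h] by simp
    moreover have "cmod (f (x, n, y)) \<le> cmod (f h) + cmod (f h - f (x, n, y))"
      using norm_triangle_ineq4[of "f h" "f h - f (x, n, y)"] by simp
    moreover have "cmod (as_function T (x, n, y)) \<le> cmod (f (x, n, y)) + cmod (f (x, n, y) - as_function T (x, n, y))"
      using norm_triangle_ineq4[of "f (x, n, y)" "f (x, n, y) - as_function T (x, n, y)"] by simp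
    ultimately show False using pq(2)[OF h] close[OF g] by (simp add: e_def)
  qed
  then show thesis using that pq(1) by blast
qed

lemma commutant_in_diagonal:
  assumes ap: "aperiodicity_condition \<Lambda>"
    and T: "T \<in> A" and comm: "\<And>f. f \<in> C_units \<Longrightarrow> T o\<^sub>L mult_op f = mult_op f o\<^sub>L T"
  shows "T \<in> D"
proof (rule ccontr)
  assume "T \<notin> D"
  then obtain g where g: "g \<in> G" "g \<notin> unit_space \<Lambda>" "as_function T g \<noteq> 0"
    using T by (auto simp: diagonal_def)
  obtain x n y where g_eq: "g = (x, n, y)" by (cases g)
  have "x = y" using commutant_off_isotropy[OF T comm] g g_eq by blast
  then have n: "n \<noteq> 0" using g g_eq by (auto simp: mem_units)
  obtain p q where pq: "valid p q (x, n, y)" "\<And>h. h \<in> nbhd p q x y \<Longrightarrow> as_function T h \<noteq> 0"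
    using as_function_nonzero_near[OF T] g g_eq by blast
  have iso: "x' = y'" if "(x', n', y') \<in> nbhd p q x y" for x' n' y'
    using commutant_off_isotropy[OF T comm] pq(2)[OF that] nbhd_subset that by blast
  have "p \<noteq> q" using pq(1) n by (auto simp: valid_iff)
  note e = valid_ends[OF pq(1)]
  have "s (x (0, p)) \<in> objects \<Lambda>" using cat(2,10)[OF e(1)] by (simp add: object_iff)
  then obtain z where z: "z \<in> P" "z (0, 0) = s (x (0, p))" "\<not> eventually_periodic z"
    using ap unfolding aperiodicity_condition_def inf_paths_at_def by blast
  define x' where "x' = prepend \<Lambda> (x (0, p)) z"
  define y' where "y' = prepend \<Lambda> (y (0, q)) z"
  have x': "x' \<in> P" "x' (0, p) = x (0, p)" "shift p x' = z"
    using prepend_props[OF e(1) z(1,2)] by (simp_all add: x'_def e)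
  have y': "y' \<in> P" "y' (0, q) = y (0, q)" "shift q y' = z"
    using prepend_props[OF e(2) z(1)] z(2) by (simp_all add: y'_def e)
  have "(x', int_vec p - int_vec q, y') \<in> nbhd p q x y"
    using x' y' by (simp add: mem_nbhd valid_iff)
  then have "x' = y'" by (rule iso)
  then have "shift p x' = shift q x'" using x'(3) y'(3) by simp
  \<comment> \<open>The tail \<open>shift q x'\<close> is z itself; writing it as
    \<open>shift 0 z\<close> then matches the form of \<open>eventually_periodic\<close>.\<close>
  then have "periodic (shift q x')" using \<open>p \<noteq> q\<close> by (rule periodic_of_shift_eq)
  then have "periodic (shift 0 z)" using y'(3) \<open>x' = y'\<close> shift_zero[OF z(1)] by simp
  then show False using z(3) unfolding eventually_periodic_def by blast
qed

lemma masa_if_aperiodic: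
  assumes "aperiodicity_condition \<Lambda>"
  shows "is_masa A D"
  unfolding is_masa_def
proof (intro conjI allI impI)
  show "D \<subseteq> A" by (auto simp: diagonal_def)
  fix B assume B: "D \<subseteq> B \<and> B \<subseteq> A \<and> star_subalgebra B \<and> abelian B"
  have "T \<in> D" if "T \<in> B" for T
  proof (rule commutant_in_diagonal[OF assms])
    show "T o\<^sub>L mult_op f = mult_op f o\<^sub>L T" if "f \<in> C_units" for f
      using B \<open>T \<in> B\<close> mult_op_in_D[OF that] unfolding abelian_def by blast
  qed (use B that in blast)
  then show "B = D" using B by blast
qed (rule D_star_subalgebra D_abelian)+

subsection \<open>Maximality implies aperiodicity\<close>

lemma has_period_shift_eq:
  assumes x: "x \<in> P" and per: "has_period x (int_vec a - int_vec b)"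
  shows "shift a x = shift b x"
proof (rule path_ext[OF shift_path[OF x] shift_path[OF x]])
  fix n :: "nat^'k"
  have "x (0 + a, n + a) = x (0 + b, n + b)"
    using per[unfolded has_period_def, rule_format, of "0 + b" "n + b" "0 + a" "n + a"]
    by (simp add: int_vec_add int_vec_zero vec_le_add)
  then show "shift a x (0, n) = shift b x (0, n)" by (simp add: shift_apply vec_zero_le)
qed

text \<open>Failure of a period shows on a finite part of a path, so a longer prefix enforces it:
  the open and dense condition of the Baire argument. For c = 0 only the length is asked for, so
  that an enumeration of all vectors can be used.\<close>

lemma extend_off_period:
  assumes l: "l \<in> M"
    and ex: "c \<noteq> 0 \<Longrightarrow> \<exists>x\<in>P. x (0, d l) = l \<and> \<not> has_period (shift N x) c"
  shows "\<exists>e\<in>M. s l = r e \<and> diag_vec i \<le> d (l \<cdot> e) \<and>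
    (c \<noteq> 0 \<longrightarrow> (\<forall>y\<in>P. y (0, d (l \<cdot> e)) = l \<cdot> e \<longrightarrow> \<not> has_period (shift N y) c))"
proof (cases "c = 0")
  case True
  obtain e where "e \<in> M" "s l = r e" "d e = diag_vec i" using extend_by_degree[OF l] .
  then show ?thesis using True comp_facts(4)[OF l, of e] by (intro bexI[of _ e]) (simp_all add: vec_le_add)
next
  case False
  obtain x where x: "x \<in> P" "x (0, d l) = l" "\<not> has_period (shift N x) c" using ex[OF False] by blast
  obtain m n m' n' where mn: "m \<le> n" "int_vec m' = int_vec m + c" "int_vec n' = int_vec n + c"
      "shift N x (m', n') \<noteq> shift N x (m, n)"
    using x(3) unfolding has_period_def by blast
  \<comment> \<open>The order of m' and n' is inherited from m and n, since both pairs differ by the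
    same c.\<close>
  have "int_vec (m' + n) = int_vec (m + n')" unfolding int_vec_add mn by simp
  then have eq: "m' + n = m + n'" by (simp only: int_vec_inj)
  have mn': "m' \<le> n'"
    unfolding less_eq_vec_def
  proof
    fix j
    have "m' $ j + n $ j = m $ j + n' $ j" using eq by (metis vector_add_component)
    moreover have "m $ j \<le> n $ j" using mn(1) by (simp add: less_eq_vec_def)
    ultimately show "m' $ j \<le> n' $ j" by simp
  qed
  \<comment> \<open>A common upper bound for \<open>d l\<close>, for the ends of the two segments
    that witness the failure, and for the required length.\<close>
  define Q where "Q = d l + (n + N) + (n' + N) + diag_vec i"
  define e where "e = x (d l, Q)"
  have Q: "d l \<le> Q" "n + N \<le> Q" "n' + N \<le> Q" "diag_vec i \<le> Q"
    by (simp_all add: Q_def less_eq_vec_def)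
  have le: "l \<cdot> e = x (0, Q)" using path_comp[OF x(1) vec_zero_le Q(1)] x(2) by (simp add: e_def)
  have dQ: "d (l \<cdot> e) = Q" unfolding le using path_facts[OF x(1) vec_zero_le] by (simp add: vec_diff_simps)
  have e: "e \<in> M" "s l = r e"
    using path_facts[OF x(1) Q(1)] path_facts(3)[OF x(1) vec_zero_le, of "d l"] x(2)
    by (simp_all add: e_def)
  have "\<not> has_period (shift N y) c" if y: "y \<in> P" "y (0, Q) = x (0, Q)" for y
  proof
    assume "has_period (shift N y) c"
    then have "shift N y (m', n') = shift N y (m, n)" using mn unfolding has_period_def by blast
    moreover have "y (m' + N, n' + N) = x (m' + N, n' + N)"
      by (rule path_prefix_eq[OF y(1) x(1) y(2) vec_add_mono[OF mn'] Q(3)])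
    moreover have "y (m + N, n + N) = x (m + N, n + N)"
      by (rule path_prefix_eq[OF y(1) x(1) y(2) vec_add_mono[OF mn(1)] Q(2)])
    ultimately show False using mn(1,4) mn' by (simp add: shift_apply)
  qed
  then show ?thesis using e Q(4) by (intro bexI[of _ e]) (simp_all add: dQ, simp add: le)
qed

text \<open>
  A Baire category argument: if no cylinder at \<open>v\<close> consisted of paths with a common eventual period,
  successive extensions could avoid each of the countably many pairs of a shift and a period.
\<close>

lemma common_period:
  assumes v: "v \<in> objects \<Lambda>" and per: "\<And>x. x \<in> inf_paths_at \<Lambda> v \<Longrightarrow> eventually_periodic x"
  shows "\<exists>l\<in>M. \<exists>N c. c \<noteq> 0 \<and> (\<forall>x\<in>P. x (0, d l) = l \<longrightarrow> has_period (shift N x) c)"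
proof (rule ccontr)
  assume contra: "\<not> ?thesis"
  have ex: "\<exists>x\<in>P. x (0, d l) = l \<and> \<not> has_period (shift N x) c" if "l \<in> M" "c \<noteq> 0" for l N c
    using contra that by blast
  \<comment> \<open>Decoding naturals lists every pair of a shift and a candidate period; stage i
    disposes of pair i.\<close>
  define N where "N i = fst (from_nat i :: (nat^'k) \<times> (int^'k))" for i
  define c where "c i = snd (from_nat i :: (nat^'k) \<times> (int^'k))" for i
  define R where "R i l e \<longleftrightarrow> e \<in> M \<and> s l = r e \<and> diag_vec i \<le> d (l \<cdot> e) \<and>
    (c i \<noteq> 0 \<longrightarrow> (\<forall>y\<in>P. y (0, d (l \<cdot> e)) = l \<cdot> e \<longrightarrow> \<not> has_period (shift (N i) y) (c i)))" for i l e
  define ext where "ext i l = (SOME e. R i l e)" for i l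
  have ext: "R i l (ext i l)" if "l \<in> M" for i l
  proof -
    have "\<exists>e. R i l e"
      using extend_off_period[where c = "c i" and N = "N i" and i = i, OF that ex[OF that]] unfolding R_def by blast
    then show ?thesis unfolding ext_def by (rule someI_ex)
  qed
  define f where "f = rec_nat v (\<lambda>i a. a \<cdot> ext i a)"
  have f_Suc: "f (Suc i) = f i \<cdot> ext i (f i)" for i by (simp add: f_def)
  have fM: "f i \<in> M" for i
  proof (induction i)
    case 0
    show ?case using v by (simp add: f_def object_iff)
  next
    case (Suc i)
    then show ?case using ext[OF Suc, of i] comp_facts(1) unfolding R_def f_Suc by blast
  qed
  have R: "R i (f i) (ext i (f i))" for i by (rule ext[OF fM])
  have f_ext: "\<exists>e\<in>M. s (f i) = r e \<and> f (Suc i) = f i \<cdot> e" for i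
    using R[of i] f_Suc[of i] unfolding R_def by blast
  have cofinal: "\<exists>i. n \<le> d (f i)" for n
  proof -
    obtain i where "n \<le> diag_vec i" using diag_vec_cofinal by blast
    also have "diag_vec i \<le> d (f (Suc i))" using R[of i] unfolding R_def f_Suc by blast
    finally show ?thesis by blast
  qed
  obtain x where x: "x \<in> P" "\<And>i. x (0, d (f i)) = f i"
    using path_of_chain[of f, OF fM f_ext cofinal] by blast
  have "x (0, 0) = v" using x(2)[of 0] v by (simp add: f_def object_iff)
  then have "eventually_periodic x" using per x(1) by (simp add: inf_paths_at_def)
  then obtain N' c' where c': "c' \<noteq> 0" "has_period (shift N' x) c'"
    unfolding eventually_periodic_def periodic_def by blast
  define i where "i = to_nat (N', c')"
  have Nc: "N i = N'" "c i = c'" by (simp_all add: N_def c_def i_def)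
  \<comment> \<open>Stage i fixed the prefix \<open>f (Suc i)\<close> of x, and no path with this
    prefix has that period.\<close>
  have "\<not> has_period (shift (N i) x) (c i)"
    using R[of i] x(1) x(2)[of "Suc i"] c'(1) unfolding R_def f_Suc Nc by blast
  then show False using c'(2) by (simp add: Nc)
qed

lemma common_shift:
  assumes v: "v \<in> objects \<Lambda>" and per: "\<And>x. x \<in> inf_paths_at \<Lambda> v \<Longrightarrow> eventually_periodic x"
  shows "\<exists>w\<in>objects \<Lambda>. \<exists>a b. a \<noteq> b \<and> (\<forall>z\<in>P. z (0, 0) = w \<longrightarrow> shift a z = shift b z)"
proof -
  obtain l N c where l: "l \<in> M" and c: "c \<noteq> 0"
    and hp: "\<forall>x\<in>P. x (0, d l) = l \<longrightarrow> has_period (shift N x) c"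
    using common_period[OF v per] by blast
  \<comment> \<open>Positive and negative parts of c; adding N to both will absorb the shift after
    which the period holds.\<close>
  define a0 :: "nat^'k" where "a0 = (\<chi> i. nat (c $ i))"
  define b0 :: "nat^'k" where "b0 = (\<chi> i. nat (- c $ i))"
  have c_eq: "c = int_vec a0 - int_vec b0"
    by (simp add: vec_eq_iff a0_def b0_def int_vec_def)
  have "s l \<in> objects \<Lambda>" using cat[OF l] by (simp add: object_iff)
  moreover have "a0 + N \<noteq> b0 + N" using c c_eq by auto
  moreover have "shift (a0 + N) z = shift (b0 + N) z" if z: "z \<in> P" "z (0, 0) = s l" for z
  proof -
    define x where "x = prepend \<Lambda> l z"
    have x: "x \<in> P" "x (0, d l) = l" "shift (d l) x = z"
      unfolding x_def using prepend_props[OF l z] .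
    have "shift a0 (shift N x) = shift b0 (shift N x)"
      using has_period_shift_eq[OF shift_path[OF x(1)]] hp x(1,2) c_eq by blast
    \<comment> \<open>Shifting by \<open>d l\<close> strips the prefix \<open>l\<close>; after
      commuting the shifts the statement concerns z alone.\<close>
    then have "shift (d l) (shift (a0 + N) x) = shift (d l) (shift (b0 + N) x)"
      by (simp add: shift_shift)
    then show ?thesis
      using shift_commute[of "d l" _ x] x(3) by simp
  qed
  ultimately show ?thesis by blast
qed

text \<open>The operator of left convolution by the indicator that underlies
  \<open>translate\<close>.\<close>

definition translation_op :: "'m \<Rightarrow> int^'k \<Rightarrow> ('m, 'k) arrow_op" where
  "translation_op w c = weighted_comp (\<lambda>g. if g \<in> start w then 1 else 0) (\<lambda>(x, n, y). (x, n - c, y))"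

lemma translation_op_apply:
  "ell2_apply (translation_op w c \<xi>) (x, n, y) = (if (x, n, y) \<in> start w then ell2_apply \<xi> (x, n - c, y) else 0)"
proof -
  have "inj (\<lambda>(x, n, y). (x, n - c, y))" by (auto simp: inj_def)
  from weighted_comp(1)[OF this, of "\<lambda>g. if g \<in> start w then 1 else 0" 1 \<xi> "(x, n, y)"]
  show ?thesis by (simp add: translation_op_def)
qed

lemma masa_imp_aperiodic:
  assumes masa: "is_masa A D"
  shows "aperiodicity_condition \<Lambda>"
proof (rule ccontr)
  assume "\<not> aperiodicity_condition \<Lambda>"
  then obtain v where v: "v \<in> objects \<Lambda>" "\<And>x. x \<in> inf_paths_at \<Lambda> v \<Longrightarrow> eventually_periodic x"
    unfolding aperiodicity_condition_def by blast
  obtain w a b where w: "w \<in> objects \<Lambda>" and ab: "a \<noteq> b"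
    and all: "\<forall>z\<in>P. z (0, 0) = w \<longrightarrow> shift a z = shift b z"
    using common_shift[OF v] by blast
  have per: "shift a z = shift b z" if "z \<in> P" "z (0, 0) = w" for z
    using all that by blast
  define c where "c = int_vec a - int_vec b"
  have c0: "c \<noteq> 0" using ab int_vec_inj[of a b] by (simp add: c_def)
  have per': "shift b z = shift a z" if "z \<in> P" "z (0, 0) = w" for z
    using per[OF that] by simp
  have plus: "(x, n + c, y) \<in> start w" if "(x, n, y) \<in> start w" for x n y
    using start_translate[OF per w that] by (simp add: c_def)
  have minus: "(x, n - c, y) \<in> start w" if "(x, n, y) \<in> start w" for x n y
    using start_translate[OF per' w that] by (simp add: c_def algebra_simps)
  have plus_iff: "(x, n + c, y) \<in> start w \<longleftrightarrow> (x, n, y) \<in> start w" for x n y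
    using plus[of x n y] minus[of x "n + c" y] by auto
  have minus_iff: "(x, n - c, y) \<in> start w \<longleftrightarrow> (x, n, y) \<in> start w" for x n y
    using plus_iff[of x "n - c" y] by simp
  have start_G: "(x, n, y) \<in> G" if "(x, n, y) \<in> start w" for x n y
    using that by (simp add: mem_start)
  define V where "V = translation_op w c + translation_op w (- c)"
  have V_apply: "ell2_apply (V \<xi>) (x, n, y) =
      (if (x, n, y) \<in> start w then ell2_apply \<xi> (x, n - c, y) + ell2_apply \<xi> (x, n + c, y) else 0)" for \<xi> x n y
    by (simp add: V_def blinfun.add_left plus_ell2.rep_eq translation_op_apply)
  \<comment> \<open>Translation permutes each range fibre over \<open>w\<close>, so reindexing the
    convolution sum moves it from the result onto f.\<close>
  have conv_tr: "translation_op w c' o\<^sub>L T \<in> A" if f: "f \<in> Cc" "conv f T" and c': "c' = c \<or> c' = - c" for f T c'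
  proof -
    have tr: "translate w c' f \<in> Cc"
      using Cc_translate[OF per w f(1)] Cc_translate[OF per' w f(1)] c' by (auto simp: c_def)
    have st: "(x, n - c', y) \<in> start w \<longleftrightarrow> (x, n, y) \<in> start w" for x n y
      using c' plus_iff minus_iff by auto
    have "conv (translate w c' f) (translation_op w c' o\<^sub>L T)"
      unfolding acts_by_convolution_def
    proof (intro allI)
      fix \<xi> and g :: "('m, 'k) arrow"
      obtain x n y where g: "g = (x, n, y)" by (cases g)
      let ?F = "{h \<in> G. grng h = (x, 0, x)}"
      show "ell2_apply ((translation_op w c' o\<^sub>L T) \<xi>) g = (if g \<in> G
         then \<Sum>\<^sub>\<infinity>h\<in>{h \<in> G. grng h = grng g}. translate w c' f h * ell2_apply \<xi> (gmult (ginv h) g) else 0)"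
      proof (cases "g \<in> start w")
        case True
        then have gS: "(x, n - c', y) \<in> G" "g \<in> G" "x (0, d w) = w"
          using st start_G g by (auto simp: mem_start)
        have FS: "(x, m, z) \<in> start w" if "(x, m, z) \<in> G" for m z
          using that gS(3) by (simp add: mem_start)
        have bij: "bij_betw (\<lambda>(x, m, z). (x, m - c', z)) ?F ?F"
        proof (rule bij_betw_byWitness[where f' = "\<lambda>(x, m, z). (x, m + c', z)"])
          have "(x, m - c', z) \<in> G" "(x, m + c', z) \<in> G" if "(x, m, z) \<in> G" for m z
            using st[of x m z] st[of x "m + c'" z] FS[OF that] start_G by auto
          then show "(\<lambda>(x, m, z). (x, m - c', z)) ` ?F \<subseteq> ?F" "(\<lambda>(x, m, z). (x, m + c', z)) ` ?F \<subseteq> ?F"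
            by auto
        qed auto
        have "ell2_apply ((translation_op w c' o\<^sub>L T) \<xi>) g = ell2_apply (T \<xi>) (x, n - c', y)"
          using True by (simp add: g translation_op_apply)
        also have "\<dots> = (\<Sum>\<^sub>\<infinity>h\<in>?F. f h * ell2_apply \<xi> (gmult (ginv h) (x, n - c', y)))"
          using gS(1) by (simp only: conv_apply[OF f(2)] if_True grng.simps)
        also have "\<dots> = (\<Sum>\<^sub>\<infinity>h\<in>?F. f ((\<lambda>(x, m, z). (x, m - c', z)) h) *
            ell2_apply \<xi> (gmult (ginv ((\<lambda>(x, m, z). (x, m - c', z)) h)) (x, n - c', y)))"
          using infsum_reindex_bij_betw[OF bij, of "\<lambda>h. f h * ell2_apply \<xi> (gmult (ginv h) (x, n - c', y))"] by simp
        also have "\<dots> = (\<Sum>\<^sub>\<infinity>h\<in>?F. translate w c' f h * ell2_apply \<xi> (gmult (ginv h) g))"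
        proof (rule infsum_cong)
          fix h assume "h \<in> ?F"
          moreover obtain x1 m z where h: "h = (x1, m, z)" by (cases h)
          ultimately have "x1 = x" "(x, m, z) \<in> G" by auto
          then show "f ((\<lambda>(x, m, z). (x, m - c', z)) h) *
            ell2_apply \<xi> (gmult (ginv ((\<lambda>(x, m, z). (x, m - c', z)) h)) (x, n - c', y)) =
            translate w c' f h * ell2_apply \<xi> (gmult (ginv h) g)"
            using FS[of m z] by (simp add: h g translate_def)
        qed
        finally show ?thesis using gS(2) by (simp add: g)
      next
        case False
        \<comment> \<open>Membership in \<open>start w\<close> depends on the range only, so the
          translate vanishes on the whole fibre of g.\<close>
        have "translate w c' f h * c = 0" if "g \<in> G" "h \<in> G" "grng h = grng g" for h c
          using that False by (cases h) (auto simp: g translate_def mem_start)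
        then have "g \<in> G \<Longrightarrow> (\<Sum>\<^sub>\<infinity>h\<in>{h \<in> G. grng h = grng g}. translate w c' f h * ell2_apply \<xi> (gmult (ginv h) g)) = 0"
          by (intro infsum_0) auto
        then show ?thesis using False by (simp add: g translation_op_apply)
      qed
    qed
    then show ?thesis by (rule conv_in_A[OF tr])
  qed
  have VA: "V o\<^sub>L T \<in> A" if "T \<in> A" for T
    using that
  proof (rule A_compose_left)
    fix f T assume f: "f \<in> Cc" "conv f T"
    show "V o\<^sub>L T \<in> A"
      using A_add[OF conv_tr[OF f, of c] conv_tr[OF f, of "- c"]] by (simp add: V_def blinfun_compose_add)
  qed
  have VD: "V o\<^sub>L T = T o\<^sub>L V" if T: "T \<in> D" for T
  proof -
    \<comment> \<open>Translation keeps the range of an arrow, and the multiplier depends on nothing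
      else.\<close>
    have "V o\<^sub>L mult_op (as_function T) = mult_op (as_function T) o\<^sub>L V"
    proof (rule ell2_blinfun_eqI)
      fix \<xi> and g :: "('m, 'k) arrow"
      obtain x n y where g: "g = (x, n, y)" by (cases g)
      show "ell2_apply ((V o\<^sub>L mult_op (as_function T)) \<xi>) g = ell2_apply ((mult_op (as_function T) o\<^sub>L V) \<xi>) g"
        using plus[of x n y] minus[of x n y] start_G
        by (auto simp: g V_apply mult_op_apply[OF as_function_le] distrib_left)
    qed
    then show ?thesis using D_eq_mult_op[OF T] by simp
  qed
  have bd: "cmod (if g \<in> start w then 1 else 0) \<le> 1" for g by simp
  have adj1: "is_cadjoint (translation_op w c) (translation_op w (- c))"
    unfolding translation_op_def
    by (rule is_cadjoint_weighted_comp[OF _ _ bd]) (auto simp: plus_iff)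
  have adj2: "is_cadjoint (translation_op w (- c)) (translation_op w c)"
    unfolding translation_op_def
    by (rule is_cadjoint_weighted_comp[OF _ _ bd]) (auto simp: minus_iff)
  have "is_cadjoint V (translation_op w (- c) + translation_op w c)"
    unfolding V_def by (rule is_cadjoint_add[OF adj1 adj2])
  then have adj: "is_cadjoint V V" by (simp add: V_def add.commute)
  have lin: "V (scaleC k \<xi>) = scaleC k (V \<xi>)" for k \<xi>
  proof (rule ell2_eqI)
    fix g :: "('m, 'k) arrow"
    show "ell2_apply (V (scaleC k \<xi>)) g = ell2_apply (scaleC k (V \<xi>)) g"
      by (cases g) (simp add: V_apply scaleC.rep_eq distrib_left)
  qed
  let ?B = "horner_polys D V"
  have "?B \<subseteq> A"
  proof
    fix T assume "T \<in> ?B"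
    then show "T \<in> A"
    proof induction
      case (const E)
      then show ?case by (simp add: diagonal_def)
    next
      case (step E X)
      then show ?case using A_add VA by (simp add: diagonal_def)
    qed
  qed
  moreover have "D \<subseteq> ?B" using horner_polys.const by blast
  ultimately have BD: "?B = D"
    using masa horner_polys_abelian_star_subalgebra[OF D_star_subalgebra D_abelian VD adj lin]
    unfolding is_masa_def by blast
  define f where "f = (\<lambda>g. if g \<in> unit_space \<Lambda> \<inter> start w then 1 else (0::complex))"
  have wM: "w \<in> M" "d w = 0" using w by (simp_all add: object_iff)
  have f: "f \<in> C_units" using indicator_Cc[OF wM(1)] by (auto simp: C_units_def f_def)
  have fB: "cmod (f g) \<le> 1" for g by (simp add: f_def)
  have f_start: "f (x, 0, x) = 1" "(x, n, y) \<in> G" if "(x, n, y) \<in> start w" for x n y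
    using that groupoid_units(1)[of x n y] by (auto simp: f_def mem_units mem_start)
  \<comment> \<open>\<open>f\<close> acts as an identity over \<open>w\<close>, where
    \<open>V\<close> is supported, so \<open>V\<close> is the Horner polynomial with coefficients 0
    and \<open>mult_op f\<close>.\<close>
  have "V o\<^sub>L mult_op f = V"
  proof (rule ell2_blinfun_eqI)
    fix \<xi> and g :: "('m, 'k) arrow"
    obtain x n y where g: "g = (x, n, y)" by (cases g)
    show "ell2_apply ((V o\<^sub>L mult_op f) \<xi>) g = ell2_apply (V \<xi>) g"
      using plus[of x n y] minus[of x n y] f_start[of x n y] start_G
      by (auto simp: g V_apply mult_op_apply[OF fB])
  qed
  then have "V \<in> ?B"
    using horner_polys.step[of 0 D "mult_op f" V] horner_polys.const[OF mult_op_in_D[OF f]]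
      D_star_subalgebra by (simp add: star_subalgebra_def)
  then have V: "V \<in> D" using BD by simp
  obtain x where x: "x \<in> P" "x (0, 0) = w" using path_exists[OF wM(1)] wM(2) by metis
  have x0: "(x, 0, x) \<in> start w" using x wM by (auto simp: mem_start intro: groupoidI[of 0 0] simp: valid_iff)
  then have xc: "(x, c, x) \<in> start w" using plus[of x 0 x] by simp
  \<comment> \<open>For the delta at (x, 0, x), evaluated at (x, c, x), one term of \<open>V\<close>
    gives 1 and the other reads the delta at (x, c + c, x), where it is 0.\<close>
  have "c + c \<noteq> 0" using c0 by (simp add: vec_eq_iff)
  then have "as_function V (x, c, x) = 1"
    using xc by (simp add: as_function_def V_apply delta.rep_eq)
  moreover have "(x, c, x) \<in> G - unit_space \<Lambda>" using start_G[OF xc] c0 by (simp add: mem_units)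
  ultimately show False using V by (simp add: diagonal_def)
qed

end

theorem mainTheorem2:
  fixes \<Lambda> :: "('m, 'k::finite) kgraph"
  assumes "is_kgraph \<Lambda>" and "row_finite_no_sources \<Lambda>"
  shows "is_masa (kgraph_cstar \<Lambda>) (diagonal \<Lambda>) \<longleftrightarrow> aperiodicity_condition \<Lambda>"
proof -
  interpret row_finite_kgraph \<Lambda> by standard (rule assms)+
  show ?thesis using masa_if_aperiodic masa_imp_aperiodic by blast
qed

end
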